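(* Let $\Lambda_E$ be a subset of $\mathbb{R}^2$ containing the line segment joining two distinct points $(a_1,a_2)$ and $(b_1,b_2)$ such that $0<a_1\le a_2$, $0<b_1\le b_2$, $a_1<b_1$, $a_2<b_2$, and either $a_1<a_2$ or $b_1<b_2$. Let $$E=\{\xi\in\mathbb{R}^{2\times2}: (\lambda_1(\xi),\lambda_2(\xi))\in\Lambda_E,\ \det\xi>0\},$$ let $\Omega\subset\mathbb{R}^2$ be a bounded open set and let $\varphi\in C^1_{piec}(\overline\Omega,\mathbb{R}^2)$ be such that for a.e. $x$ in $\Omega$, $$a_1a_2<\det D\varphi(x)<b_1b_2,$$ $$\lambda_2(D\varphi(x))<\lambda_1(D\varphi(x))\,\frac{b_2-a_2}{b_1-a_1}+\frac{a_2b_1-b_2a_1}{b_1-a_1}.$$ Then there exists a map $u\in\varphi+W^{1,\infty}_0(\Omega,\mathbb{R}^2)$ such that $Du(x)\in E$ for a.e. $x$ in $\Omega$.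
   Context: For $\xi\in\mathbb{R}^{2\times 2}$, $0\le\lambda_1(\xi)\le\lambda_2(\xi)$ denote the singular values of $\xi$, i.e. the eigenvalues of $\sqrt{\xi\xi^t}$. Conventions: $C^1_{piec}(\overline\Omega,\mathbb{R}^N)$ is the set of piecewise $C^1$ maps, i.e. maps $u\in W^{1,\infty}(\Omega;\mathbb{R}^N)\cap C(\overline\Omega;\mathbb{R}^N)$ for which there are countably many disjoint open sets $\Omega_k\subset\Omega$ with $\operatorname{meas}(\Omega\setminus\bigcup_k\Omega_k)=0$ such that $u\in C^1(\overline{\Omega_k};\mathbb{R}^N)$ for each $k$. $W^{1,\infty}_0(\Omega;\mathbb{R}^N)=W^{1,\infty}(\Omega;\mathbb{R}^N)\cap W^{1,1}_0(\Omega;\mathbb{R}^N)$. *)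

theory Defs
  imports "HOL-Analysis.Analysis"
begin

section \<open>Singular values of a real two-by-two matrix\<close>

text \<open>The positive semidefinite symmetric square root; it is unique whenever
  \<open>A\<close> is itself symmetric positive semidefinite.\<close>

definition psd_sqrt :: "real^'n^'n \<Rightarrow> real^'n^'n" where
  "psd_sqrt A = (THE S. transpose S = S \<and> (\<forall>x. 0 \<le> x \<bullet> (S *v x)) \<and> S ** S = A)"

definition eigenvalues :: "real^'n^'n \<Rightarrow> real set" where
  "eigenvalues M = {c. \<exists>v. v \<noteq> 0 \<and> M *v v = c *\<^sub>R v}"

text \<open>In dimension two the ordered pair of eigenvalues, listed with multiplicity, is the pair
  consisting of the smallest and the largest eigenvalue.\<close>

definition lambda1 :: "real^2^2 \<Rightarrow> real" where
  "lambda1 \<xi> = Min (eigenvalues (psd_sqrt (\<xi> ** transpose \<xi>)))"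

definition lambda2 :: "real^2^2 \<Rightarrow> real" where
  "lambda2 \<xi> = Max (eigenvalues (psd_sqrt (\<xi> ** transpose \<xi>)))"

section \<open>Test functions and weak gradients\<close>

text \<open>All iterated partial derivatives up to order \<open>k\<close> exist and are continuous.\<close>

primrec Ck :: "nat \<Rightarrow> ('a::euclidean_space \<Rightarrow> 'b::real_normed_vector) \<Rightarrow> bool" where
  "Ck 0 f \<longleftrightarrow> continuous_on UNIV f"
| "Ck (Suc k) f \<longleftrightarrow> (\<forall>x. f differentiable (at x)) \<and>
     (\<forall>b\<in>Basis. Ck k (\<lambda>x. frechet_derivative f (at x) b))"

definition test_function :: "'a::euclidean_space set \<Rightarrow> ('a \<Rightarrow> 'b::real_normed_vector) \<Rightarrow> bool" where
  "test_function \<Omega> \<psi> \<longleftrightarrow> (\<forall>k. Ck k \<psi>) \<and>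
     compact (closure {x. \<psi> x \<noteq> 0}) \<and> closure {x. \<psi> x \<noteq> 0} \<subseteq> \<Omega>"

definition loc_integrable ::
  "'a::euclidean_space set \<Rightarrow> ('a \<Rightarrow> 'b::{banach, second_countable_topology}) \<Rightarrow> bool" where
  "loc_integrable \<Omega> f \<longleftrightarrow> (\<forall>K. compact K \<and> K \<subseteq> \<Omega> \<longrightarrow> set_integrable lebesgue K f)"

text \<open>\<open>G x $ i $ j\<close> is the weak derivative of the \<open>i\<close>-th component of \<open>u\<close> in direction \<open>j\<close>;
  this is the same layout as \<open>matrix (frechet_derivative u (at x))\<close>. The weak gradient is kept as
  a relation, since it is determined only up to null sets.\<close>

definition weak_gradient ::
  "(real^'n) set \<Rightarrow> (real^'n \<Rightarrow> real^'m) \<Rightarrow> (real^'n \<Rightarrow> real^'n^'m) \<Rightarrow> bool" where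
  "weak_gradient \<Omega> u G \<longleftrightarrow> loc_integrable \<Omega> u \<and> loc_integrable \<Omega> G \<and>
     (\<forall>\<psi> :: real^'n \<Rightarrow> real. test_function \<Omega> \<psi> \<longrightarrow>
       (\<forall>i j. (LINT x:\<Omega>|lebesgue. u x $ i * frechet_derivative \<psi> (at x) (axis j 1))
            = - (LINT x:\<Omega>|lebesgue. G x $ i $ j * \<psi> x)))"

section \<open>Sobolev spaces\<close>

definition Linf :: "(real^'n) set \<Rightarrow> (real^'n \<Rightarrow> 'b::real_normed_vector) \<Rightarrow> bool" where
  "Linf \<Omega> f \<longleftrightarrow> f \<in> borel_measurable (lebesgue_on \<Omega>) \<and>
     (\<exists>C. AE x in lebesgue_on \<Omega>. norm (f x) \<le> C)"

definition W1inf :: "(real^'n) set \<Rightarrow> (real^'n \<Rightarrow> real^'m) set" where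
  "W1inf \<Omega> = {u. Linf \<Omega> u \<and> (\<exists>G. weak_gradient \<Omega> u G \<and> Linf \<Omega> G)}"

text \<open>The closure of the test functions in the norm of \<open>W\<^sup>1\<^sup>,\<^sup>1\<close>.\<close>

definition W11_0 :: "(real^'n) set \<Rightarrow> (real^'n \<Rightarrow> real^'m) set" where
  "W11_0 \<Omega> = {u. \<exists>G \<psi>. weak_gradient \<Omega> u G \<and>
     integrable (lebesgue_on \<Omega>) u \<and> integrable (lebesgue_on \<Omega>) G \<and>
     (\<forall>n::nat. test_function \<Omega> (\<psi> n)) \<and>
     (\<lambda>n. LINT x|lebesgue_on \<Omega>. norm (\<psi> n x - u x)) \<longlonglongrightarrow> 0 \<and>
     (\<lambda>n. LINT x|lebesgue_on \<Omega>. norm (matrix (frechet_derivative (\<psi> n) (at x)) - G x))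
       \<longlonglongrightarrow> 0}"

definition W1inf_0 :: "(real^'n) set \<Rightarrow> (real^'n \<Rightarrow> real^'m) set" where
  "W1inf_0 \<Omega> = W1inf \<Omega> \<inter> W11_0 \<Omega>"

section \<open>Piecewise continuously differentiable maps\<close>

text \<open>\<open>C\<^sup>1\<close> up to the boundary of an open set \<open>U\<close>: the map is continuous on the closure,
  differentiable in \<open>U\<close>, and its gradient extends continuously from \<open>U\<close> to the closure.\<close>

definition C1_closure :: "(real^'n) set \<Rightarrow> (real^'n \<Rightarrow> real^'m) \<Rightarrow> bool" where
  "C1_closure U u \<longleftrightarrow> continuous_on (closure U) u \<and> (\<forall>x\<in>U. u differentiable (at x)) \<and>
     (\<exists>g. continuous_on (closure U) g \<and>
       (\<forall>x\<in>U. g x = matrix (frechet_derivative u (at x))))"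

definition C1_piec :: "(real^'n) set \<Rightarrow> (real^'n \<Rightarrow> real^'m) set" where
  "C1_piec \<Omega> = {u. u \<in> W1inf \<Omega> \<and> continuous_on (closure \<Omega>) u \<and>
     (\<exists>\<U>. countable \<U> \<and> disjoint \<U> \<and> (\<forall>U\<in>\<U>. open U \<and> U \<subseteq> \<Omega> \<and> C1_closure U u) \<and>
        \<Omega> - \<Union>\<U> \<in> null_sets lebesgue)}"

end

(* In conformal coordinates a 2x2 matrix is a pair (z, w) of complex numbers with
   det = |z|^2 - |w|^2 and, for det > 0, singular values |z| - |w| and |z| + |w|.  Let R(d) be
   the value of |w| at the point of the segment with determinant d; the target is
   |w| = R(det), and the admissible gradients are those for which gap = R(det)^2 - |w|^2 is
   positive and det lies strictly between a1 a2 and b1 b2.  Moving z and w orthogonally to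
   themselves at equal speed is a rank-one direction along which det is constant and the gap
   decreases quadratically.  Hence, on a fine family of boxes on which the gradient is almost
   constant, adding cutoff * sin(N n.x)/N in that direction keeps the gradient admissible, reduces
   the integral of the gap by a fixed factor and changes the gradient, in the L^2 sense, by at
   most the square root of that integral.  All perturbations are smooth with compact support in
   the open set of full measure where the gradient of the boundary datum is continuous and
   admissible.  Iterating, they converge uniformly and their gradients converge almost
   everywhere and boundedly, to a map whose gradient has gap zero. *)

theory Submission
  imports Defs "HOL-Real_Asymp.Real_Asymp"
begin

section \<open>Smooth functions and bump functions\<close>

text \<open>Weak convergence of the gradients would not suffice, since \<open>gap\<close> is not
  affine. Strong convergence comes from tying the squared length of each oscillation to the gap
  itself: \<open>dir\<close> bounds it by \<open>C * F \<xi>\<close>, so geometric decay of the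
  integrals of the gap controls the gradient increments. Orthogonality in both conformal coordinates
  removes the terms linear in the amplitude, so both signs of the oscillation lower the gap; equal
  speeds add the same amount to \<open>zsq\<close> and \<open>wsq\<close>, so the determinant is
  unchanged. Both coordinates increase strictly along the segment, hence the determinant
  parametrizes it, and the condition on the singular values becomes one inequality for
  \<open>wsq\<close> on each level set of the determinant. Openness of the admissible set is what
  permits cutoffs and freezing of the gradient: their errors are small perturbations of a compact
  rank-one segment inside it. Smooth perturbations with compact support also give the boundary
  condition directly, because \<open>W11_0\<close> is the closure of the test functions.\<close>

lemma Ck_Suc_imp: "Ck (Suc k) f \<Longrightarrow> Ck k f"
proof (induction k arbitrary: f)
  case 0
  then show ?case
    by (simp add: differentiable_imp_continuous_on differentiable_on_def differentiable_at_withinI)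
next
  case (Suc k)
  then show ?case by auto
qed

lemma Ck_const: "Ck k (\<lambda>x. c)"
  by (induction k arbitrary: c) auto

lemma frechet_derivative_eqI:
  "(f has_derivative f') (at x) \<Longrightarrow> frechet_derivative f (at x) = f'"
  using frechet_derivative_at by metis

lemma Ck_add: "Ck k f \<Longrightarrow> Ck k g \<Longrightarrow> Ck k (\<lambda>x. f x + g x)"
proof (induction k arbitrary: f g)
  case 0 then show ?case by (simp add: continuous_on_add)
next
  case (Suc k)
  have "frechet_derivative (\<lambda>x. f x + g x) (at x) = (\<lambda>h. frechet_derivative f (at x) h + frechet_derivative g (at x) h)" for x
    using Suc.prems by (intro frechet_derivative_eqI has_derivative_add) (auto simp: frechet_derivative_works[symmetric])
  with Suc show ?case by simp
qed

lemma Ck_scaleR: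
  fixes f :: "'a::euclidean_space \<Rightarrow> real" and g :: "'a \<Rightarrow> 'b::real_normed_vector"
  shows "Ck k f \<Longrightarrow> Ck k g \<Longrightarrow> Ck k (\<lambda>x. f x *\<^sub>R g x)"
proof (induction k arbitrary: f g)
  case 0 then show ?case by (simp add: continuous_on_scaleR)
next
  case (Suc k)
  have D: "frechet_derivative (\<lambda>x. f x *\<^sub>R g x) (at x) = (\<lambda>h. f x *\<^sub>R frechet_derivative g (at x) h + frechet_derivative f (at x) h *\<^sub>R g x)" for x
    using Suc.prems by (intro frechet_derivative_eqI has_derivative_scaleR) (auto simp: frechet_derivative_works[symmetric])
  have "Ck k f" "Ck k g" using Suc.prems Ck_Suc_imp by blast+
  with Suc show ?case unfolding Ck.simps D by (auto intro!: Ck_add)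
qed

lemma Ck_mult:
  fixes f g :: "'a::euclidean_space \<Rightarrow> real"
  shows "Ck k f \<Longrightarrow> Ck k g \<Longrightarrow> Ck k (\<lambda>x. f x * g x)"
  using Ck_scaleR[of k f g] by simp

lemma Ck_sum: "(\<And>i. i \<in> I \<Longrightarrow> Ck k (f i)) \<Longrightarrow> Ck k (\<lambda>x. \<Sum>i\<in>I. f i x)"
  by (induction I rule: infinite_finite_induct) (auto intro: Ck_add Ck_const)

lemma Ck_prod:
  fixes f :: "'i \<Rightarrow> 'a::euclidean_space \<Rightarrow> real"
  shows "(\<And>i. i \<in> I \<Longrightarrow> Ck k (f i)) \<Longrightarrow> Ck k (\<lambda>x. \<Prod>i\<in>I. f i x)"
  by (induction I rule: infinite_finite_induct) (auto intro: Ck_mult Ck_const)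

text \<open>The inner functions below, in the cutoffs and in the oscillating factor, are all affine.
  For these the derivative contributes only the constant factor \<open>v \<bullet> b\<close>, so the
  induction closes without a general chain rule.\<close>

lemma Ck_compose_affine:
  fixes f :: "real \<Rightarrow> real" and v :: "'a::euclidean_space"
  shows "Ck k f \<Longrightarrow> Ck k (\<lambda>x. f (v \<bullet> x + c))"
proof (induction k arbitrary: f)
  case 0 then show ?case by (auto intro!: continuous_intros intro: continuous_on_compose2[of UNIV f])
next
  case (Suc k)
  have D: "((\<lambda>x. f (v \<bullet> x + c)) has_derivative (\<lambda>h. (v \<bullet> h) * frechet_derivative f (at (v \<bullet> x + c)) 1)) (at x)" for x
  proof -
    have d: "(f has_derivative frechet_derivative f (at (v \<bullet> x + c))) (at (v \<bullet> x + c))"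
      using Suc.prems by (simp add: frechet_derivative_works[symmetric])
    have l: "linear (frechet_derivative f (at (v \<bullet> x + c)))"
      using d has_derivative_linear by blast
    have i: "((\<lambda>x. v \<bullet> x + c) has_derivative (\<lambda>h. v \<bullet> h)) (at x)"
      by (auto intro!: derivative_eq_intros)
    have "frechet_derivative f (at (v \<bullet> x + c)) (v \<bullet> h) = (v \<bullet> h) * frechet_derivative f (at (v \<bullet> x + c)) 1" for h
      using linear_cmul[OF l, of "v \<bullet> h" 1] by simp
    then have "(\<lambda>h. frechet_derivative f (at (v \<bullet> x + c)) (v \<bullet> h)) = (\<lambda>h. (v \<bullet> h) * frechet_derivative f (at (v \<bullet> x + c)) 1)"
      by (rule ext)
    then show ?thesis
      using has_derivative_compose[of "\<lambda>x. v \<bullet> x + c" "\<lambda>h. v \<bullet> h" x UNIV f, OF i d] by (simp only:)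
  qed
  have "Ck k (\<lambda>x. (v \<bullet> b) * frechet_derivative f (at (v \<bullet> x + c)) 1)" for b
    using Suc.IH[of "\<lambda>y. frechet_derivative f (at y) 1"] Suc.prems by (intro Ck_mult Ck_const) simp
  moreover have "(\<lambda>x. f (v \<bullet> x + c)) differentiable (at x)" for x
    using D unfolding differentiable_def by blast
  ultimately show ?case
    unfolding Ck.simps frechet_derivative_eqI[OF D] by blast
qed

lemma Ck_realI:
  fixes f f' :: "real \<Rightarrow> real"
  assumes "\<And>x. (f has_real_derivative f' x) (at x)" "Ck k f'"
  shows "Ck (Suc k) f"
proof -
  have "(f has_derivative (\<lambda>h. f' x * h)) (at x)" for x
    using assms(1) by (simp add: has_field_derivative_def)
  note D = this
  have "f differentiable (at x)" for x
    using D unfolding differentiable_def by blast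
  then show ?thesis using assms(2)
    by (simp add: frechet_derivative_eqI[OF D])
qed

lemma Ck_sin_cos: "Ck k (sin :: real \<Rightarrow> real) \<and> Ck k (cos :: real \<Rightarrow> real)"
proof (induction k)
  case 0 then show ?case by (auto intro!: continuous_intros)
next
  case (Suc k)
  have "Ck (Suc k) (sin :: real \<Rightarrow> real)"
    by (rule Ck_realI[where f'=cos]) (use Suc in \<open>auto intro: DERIV_sin\<close>)
  moreover have "Ck (Suc k) (cos :: real \<Rightarrow> real)"
  proof (rule Ck_realI)
    show "(cos has_real_derivative - 1 * sin x) (at x)" for x :: real
      by (auto intro!: derivative_eq_intros)
    show "Ck k (\<lambda>x::real. - 1 * sin x)"
      using Suc by (intro Ck_mult Ck_const) auto
  qed
  ultimately show ?case by blast
qed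

section \<open>A smooth flat function on the line and cutoffs supported in boxes\<close>

definition flat :: "nat \<Rightarrow> real \<Rightarrow> real" where
  "flat m x = (if x > 0 then (1/x)^m * exp (- (1/x)) else 0)"

lemma flat_tendsto_0: "(flat m \<longlongrightarrow> 0) (at_right 0)"
proof -
  have "((\<lambda>x::real. (1/x)^m * exp (- (1/x))) \<longlongrightarrow> 0) (at_right 0)"
    by real_asymp
  then show ?thesis
    by (rule Lim_transform_eventually) (auto simp: flat_def eventually_at_filter)
qed

text \<open>The reason for the parameter \<open>m\<close>: the span of the functions
  \<open>flat m\<close> is closed under differentiation, so smoothness follows by induction on the
  order with \<open>m\<close> arbitrary. The cutoffs use only \<open>flat 0\<close>.\<close>

lemma flat_deriv: "(flat m has_real_derivative - real m * flat (Suc m) x + flat (Suc (Suc m)) x) (at x)"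
proof (cases x "0::real" rule: linorder_cases)
  case greater
  have "((\<lambda>x. (1/x)^m * exp (- (1/x))) has_real_derivative - real m * flat (Suc m) x + flat (Suc (Suc m)) x) (at x)"
    using greater by (auto intro!: derivative_eq_intros simp: flat_def field_simps power2_eq_square power_Suc[symmetric] simp del: power_Suc)
     (cases m; simp add: field_simps)
  then show ?thesis
    by (rule has_field_derivative_transform_within_open[where S="{0<..}"]) (use greater in \<open>auto simp: flat_def\<close>)
next
  case less
  have "((\<lambda>x. 0) has_real_derivative 0) (at x)" by simp
  then have "(flat m has_real_derivative 0) (at x)"
    by (rule has_field_derivative_transform_within_open[where S="{..<0}"]) (use less in \<open>auto simp: flat_def\<close>)
  then show ?thesis using less by (simp add: flat_def)
next
  case equal
  \<comment> \<open>For h > 0 the difference quotient at 0 is exactly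
    \<open>flat (Suc m) h\<close>.\<close>
  have "((\<lambda>h. (flat m (0 + h) - flat m 0) / h) \<longlongrightarrow> 0) (at_right 0)"
    using flat_tendsto_0[of "Suc m"]
    by (rule Lim_transform_eventually) (auto simp: flat_def eventually_at_filter)
  moreover have "((\<lambda>h. (flat m (0 + h) - flat m 0) / h) \<longlongrightarrow> 0) (at_left 0)"
    by (rule tendsto_eventually) (auto simp: flat_def eventually_at_filter)
  ultimately have "((\<lambda>h. (flat m (0 + h) - flat m 0) / h) \<longlongrightarrow> 0) (at 0)"
    by (simp add: filterlim_split_at)
  then show ?thesis using equal
    by (simp add: DERIV_def flat_def)
qed

lemma Ck_flat: "Ck k (flat m)"
proof (induction k arbitrary: m)
  case 0
  show ?case unfolding Ck.simps
    by (rule DERIV_continuous_on) (rule has_field_derivative_at_within[OF flat_deriv])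
next
  case (Suc k)
  show ?case
    by (rule Ck_realI[OF flat_deriv]) (intro Ck_add Ck_mult Ck_const Suc)
qed

text \<open>The factor \<open>Suc k\<close> makes these cutoffs tend to the indicator of the box.\<close>

definition bump :: "real^'n \<Rightarrow> real^'n \<Rightarrow> nat \<Rightarrow> real^'n \<Rightarrow> real" where
  "bump a b k x = (\<Prod>i\<in>UNIV. flat 0 (real (Suc k) * (x$i - a$i)) * flat 0 (real (Suc k) * (b$i - x$i)))"

lemma flat0_bounds: "0 \<le> flat 0 x" "flat 0 x \<le> 1"
  by (auto simp: flat_def)

lemma Ck_bump:
  fixes a b :: "real^'n"
  shows "Ck j (bump a b k)"
proof -
  have "Ck j (\<lambda>x::real^'n. flat 0 (real (Suc k) * (x$i - a$i)))" for i
    using Ck_compose_affine[OF Ck_flat[of j 0], of "axis i (real (Suc k))" "- real (Suc k) * a$i"]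
    by (simp add: inner_axis' algebra_simps)
  moreover have "Ck j (\<lambda>x::real^'n. flat 0 (real (Suc k) * (b$i - x$i)))" for i
    using Ck_compose_affine[OF Ck_flat[of j 0], of "axis i (- real (Suc k))" "real (Suc k) * b$i"]
    by (simp add: inner_axis' algebra_simps)
  ultimately show ?thesis unfolding bump_def[abs_def]
    by (intro Ck_prod Ck_mult)
qed

lemma bump_bounds: "0 \<le> bump a b k x" "bump a b k x \<le> 1"
  unfolding bump_def by (auto intro!: prod_nonneg prod_le_1 mult_nonneg_nonneg mult_le_one flat0_bounds)

lemma bump_outside: "x \<notin> box a b \<Longrightarrow> bump a b k x = 0"
  unfolding bump_def mem_box_cart by (simp add: flat_def zero_less_mult_iff not_less) (meson not_le)

text \<open>For fixed t > 0 the factor exp (-1 / ((k + 1) t)) tends to 1. This convergence, bounded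
  by 1, makes the mean square of a cutoff nearly full and lets test functions detect integrals over
  boxes.\<close>

lemma bump_tendsto_indicator:
  fixes a b x :: "real^'n"
  shows "(\<lambda>k. bump a b k x) \<longlonglongrightarrow> indicator (box a b) x"
proof (cases "x \<in> box a b")
  case True
  have *: "(\<lambda>k. flat 0 (real (Suc k) * t)) \<longlonglongrightarrow> 1" if "t > 0" for t
    using that unfolding flat_def by (simp add: zero_less_mult_iff) real_asymp
  have "(\<lambda>k. bump a b k x) \<longlonglongrightarrow> (\<Prod>i\<in>(UNIV::'n set). 1*1)"
    unfolding bump_def using True by (intro tendsto_prod tendsto_mult *) (auto simp: mem_box_cart)
  with True show ?thesis by simp
qed (simp add: bump_outside)

section \<open>Oscillating perturbations on a box\<close>

lemma continuous_compact_support_bounded: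
  fixes f :: "'a::metric_space \<Rightarrow> 'b::real_normed_vector"
  assumes "continuous_on UNIV f" "compact K" "\<And>x. x \<notin> K \<Longrightarrow> f x = 0"
  obtains B where "B > 0" "\<And>x. norm (f x) \<le> B"
proof -
  have "bounded (f ` K)"
    using assms by (intro compact_imp_bounded compact_continuous_image) (auto intro: continuous_on_subset)
  then obtain B where "B > 0" "\<And>x. x \<in> K \<Longrightarrow> norm (f x) \<le> B"
    by (auto simp: bounded_pos)
  then show ?thesis using that[of B] assms(3) by (metis norm_zero less_imp_le)
qed

lemma continuous_compact_support_integrable:
  fixes f :: "'a::euclidean_space \<Rightarrow> 'b::euclidean_space"
  assumes "continuous_on UNIV f" "compact K" "\<And>x. x \<notin> K \<Longrightarrow> f x = 0"
  shows "integrable lebesgue f"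
proof -
  have "integrable lborel (\<lambda>x. indicator K x *\<^sub>R f x)"
    using assms by (intro borel_integrable_compact) (auto intro: continuous_on_subset)
  also have "(\<lambda>x. indicator K x *\<^sub>R f x) = f"
    using assms(3) by (auto simp: indicator_def)
  finally have "integrable lborel f" .
  then show ?thesis by (simp add: integrable_completion borel_measurable_integrable)
qed

text \<open>Difference quotients of \<open>F\<close> have integral \<open>0\<close> by translation invariance.\<close>

lemma integral_directional_derivative_eq_0:
  fixes F :: "'a::euclidean_space \<Rightarrow> real"
  assumes D: "\<And>x. (F has_derivative F' x) (at x)"
    and bd: "\<And>x. \<bar>F' x v\<bar> \<le> B"
    and K: "compact K" "\<And>x. x \<notin> K \<Longrightarrow> F x = 0"
  shows "(LINT x|lebesgue. F' x v) = 0"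
proof -
  have cont: "continuous_on UNIV F"
    using D has_derivative_continuous_on by blast
  then have meas: "F \<in> borel_measurable borel" by (rule borel_measurable_continuous_onI)
  have Fint: "integrable lborel F"
  proof -
    have "integrable lborel (\<lambda>x. indicator K x *\<^sub>R F x)"
      using cont K by (intro borel_integrable_compact) (auto intro: continuous_on_subset)
    also have "(\<lambda>x. indicator K x *\<^sub>R F x) = F"
      using K(2) by (auto simp: indicator_def fun_eq_iff)
    finally show ?thesis .
  qed
  obtain r where r: "\<And>x. x \<in> K \<Longrightarrow> norm x \<le> r"
    using compact_imp_bounded[OF K(1)] by (auto simp: bounded_iff)
  define h where "h n = inverse (real (Suc n))" for n
  have h: "0 < h n" "h n \<le> 1" for n
    by (auto simp: h_def divide_simps)
  define q where "q n x = (F (x + h n *\<^sub>R v) - F x) / h n" for n x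
  have der: "((\<lambda>t. F (x + t *\<^sub>R v)) has_real_derivative F' (x + t *\<^sub>R v) v) (at t)" for x t
  proof -
    have "((\<lambda>t. x + t *\<^sub>R v) has_derivative (\<lambda>s. s *\<^sub>R v)) (at t)"
      by (auto intro!: derivative_eq_intros)
    from has_derivative_compose[OF this D[of "x + t *\<^sub>R v"]]
    have "((\<lambda>t. F (x + t *\<^sub>R v)) has_derivative (\<lambda>s. F' (x + t *\<^sub>R v) (s *\<^sub>R v))) (at t)" .
    moreover have "F' (x + t *\<^sub>R v) (s *\<^sub>R v) = F' (x + t *\<^sub>R v) v * s" for s
      using linear_cmul[OF has_derivative_linear[OF D], of "x + t *\<^sub>R v" s v] by simp
    ultimately show ?thesis by (simp add: has_field_derivative_def)
  qed
  \<comment> \<open>Domination for the limit: the mean value theorem bounds each quotient by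
    \<open>B\<close>, and since \<open>h n \<le> 1\<close> its support lies within distance
    \<open>norm v\<close> of the ball containing \<open>K\<close>.\<close>
  have qbd: "norm (q n x) \<le> indicator (cball 0 (r + norm v)) x * B" for n x
  proof (cases "x \<in> cball 0 (r + norm v)")
    case True
    obtain z where "F (x + h n *\<^sub>R v) - F (x + 0 *\<^sub>R v) = (h n - 0) * F' (x + z *\<^sub>R v) v"
      using MVT2[OF h(1)[of n], of "\<lambda>t. F (x + t *\<^sub>R v)" "\<lambda>t. F' (x + t *\<^sub>R v) v"] der by blast
    then have "q n x = F' (x + z *\<^sub>R v) v" using h(1)[of n] by (simp add: q_def)
    with bd True show ?thesis by simp
  next
    case False
    then have 1: "norm x > r + norm v" by simp
    moreover have "norm x \<le> norm (x + h n *\<^sub>R v) + norm (h n *\<^sub>R v)"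
      using norm_triangle_ineq4[of "x + h n *\<^sub>R v" "h n *\<^sub>R v"] by simp
    moreover have "norm (h n *\<^sub>R v) \<le> norm v" using h[of n] by (simp add: mult_left_le_one_le)
    ultimately have "norm (x + h n *\<^sub>R v) > r" by linarith
    moreover have "norm x > r" using 1 norm_ge_zero[of v] by linarith
    ultimately have "x \<notin> K" "x + h n *\<^sub>R v \<notin> K" using r leD by blast+
    then show ?thesis using K False by (simp add: q_def)
  qed
  have qlim: "(\<lambda>n. q n x) \<longlonglongrightarrow> F' x v" for x
  proof -
    have "((\<lambda>t. (F (x + (0 + t) *\<^sub>R v) - F (x + 0 *\<^sub>R v)) / t) \<longlongrightarrow> F' (x + 0 *\<^sub>R v) v) (at 0)"
      using der[of x 0] by (simp only: DERIV_def)
    moreover have "filterlim h (at 0) sequentially"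
      unfolding filterlim_at using LIMSEQ_inverse_real_of_nat h
      by (auto simp: h_def[abs_def] intro!: always_eventually)
    ultimately have "(\<lambda>n. (F (x + (0 + h n) *\<^sub>R v) - F (x + 0 *\<^sub>R v)) / h n) \<longlonglongrightarrow> F' (x + 0 *\<^sub>R v) v"
      by (rule filterlim_compose)
    then show ?thesis by (simp add: q_def)
  qed
  have trans: "integrable lborel (\<lambda>x. F (x + c))" "(LINT x|lborel. F (x + c)) = (LINT x|lborel. F x)" for c
  proof -
    have d: "distr lborel borel (\<lambda>x. x + c) = lborel"
    proof -
      have "(\<lambda>x. x + c) = (+) c" by (simp add: fun_eq_iff add.commute)
      then show ?thesis using lborel_distr_plus[of c] by simp
    qed
    show "(LINT x|lborel. F (x + c)) = (LINT x|lborel. F x)"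
      using integral_distr[of "\<lambda>x. x + c" lborel borel F] meas unfolding d by simp
    show "integrable lborel (\<lambda>x. F (x + c))"
      using integrable_distr_eq[of "\<lambda>x. x + c" lborel borel F] meas Fint unfolding d by simp
  qed
  have q0: "(LINT x|lborel. q n x) = 0" for n
    unfolding q_def using trans[of "h n *\<^sub>R v"] Fint by (simp add: Bochner_Integration.integral_diff)
  have qm: "q n \<in> borel_measurable borel" for n
    unfolding q_def[abs_def] by (intro borel_measurable_divide borel_measurable_diff measurable_compose[OF _ meas]) (auto intro: meas)
  \<comment> \<open>The derivative is not assumed continuous; its measurability is inherited from
    the difference quotients.\<close>
  have limm: "(\<lambda>x. F' x v) \<in> borel_measurable borel"
    using borel_measurable_LIMSEQ_real[OF qlim qm] by simp
  have "(\<lambda>n. LINT x|lborel. q n x) \<longlonglongrightarrow> (LINT x|lborel. F' x v)"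
  proof (rule integral_dominated_convergence)
    show "integrable lborel (\<lambda>x. indicator (cball 0 (r + norm v)) x * B)"
      using borel_integrable_compact[of "cball 0 (r + norm v)" "\<lambda>_. B"] by simp
  qed (use qm limm qlim qbd in auto)
  then have "(LINT x|lborel. F' x v) = 0"
    unfolding q0 by (simp add: LIMSEQ_const_iff)
  then show ?thesis using limm by (simp add: integral_completion)
qed

definition jac :: "(real^'n \<Rightarrow> real^'m) \<Rightarrow> real^'n \<Rightarrow> real^'n^'m" where
  "jac f x = matrix (frechet_derivative f (at x))"

definition outer :: "real^'m \<Rightarrow> real^'n \<Rightarrow> real^'n^'m" where
  "outer A n = (\<chi> i j. A $ i * n $ j)"

lemma jac_eqI: "(f has_derivative f') (at x) \<Longrightarrow> jac f x = matrix f'"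
  by (simp add: jac_def frechet_derivative_eqI)

lemma Ck_1_continuous: "Ck (Suc 0) f \<Longrightarrow> b \<in> Basis \<Longrightarrow> continuous_on UNIV (\<lambda>x. frechet_derivative f (at x) b)"
  by simp

text \<open>The witness is \<open>\<psi> x = (c x * sin (N * (n \<bullet> x)) / N) *\<^sub>R A\<close> with a bump function \<open>c\<close> and a large
  \<open>N\<close>, so that \<open>s x = c x * cos (N * (n \<bullet> x))\<close>.\<close>

lemma oscillation_on_box:
  fixes a b n :: "real^'n" and A :: "real^'m"
  assumes box: "box a b \<noteq> {}" and n: "n \<noteq> 0" and e: "e > 0"
  obtains \<psi> :: "real^'n \<Rightarrow> real^'m" and s where
    "\<And>k. Ck k \<psi>" "\<And>x. x \<notin> box a b \<Longrightarrow> \<psi> x = 0" "\<And>x. x \<notin> box a b \<Longrightarrow> s x = 0"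
    "\<And>x. x \<notin> box a b \<Longrightarrow> jac \<psi> x = 0"
    "\<And>x. norm (\<psi> x) \<le> e" "\<And>x. \<bar>s x\<bar> \<le> 1" "continuous_on UNIV s"
    "\<And>x. norm (jac \<psi> x - s x *\<^sub>R outer A n) \<le> e"
    "(LINT x|lebesgue. (s x)\<^sup>2) \<ge> measure lebesgue (box a b) / 4"
proof -
  let ?m = "measure lebesgue (box a b)"
  have mpos: "?m > 0"
    using box unfolding box_ne_empty
    by (simp add: measure_completion measure_lborel_box_eq less_imp_le) (auto intro!: prod_pos simp: inner_diff_left)
  have "(\<lambda>k. LINT x|lebesgue. (bump a b k x)\<^sup>2) \<longlonglongrightarrow> (LINT x|lebesgue. indicator (box a b) x)"
  proof (rule integral_dominated_convergence)
    show "integrable lebesgue (\<lambda>x. indicator (cbox a b) x :: real)"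
      using lmeasurable_cbox[of a b] by (simp only: lmeasurable_iff_integrable)
    show "(\<lambda>x. indicator (box a b) x :: real) \<in> borel_measurable lebesgue" by (intro borel_measurable_indicator) simp
    show "(\<lambda>x. (bump a b k x)\<^sup>2) \<in> borel_measurable lebesgue" for k
      using Ck_bump[of 0 a b k] by (intro borel_measurable_power) (simp add: borel_measurable_continuous_onI measurable_completion)
    show "AE x in lebesgue. (\<lambda>k. (bump a b k x)\<^sup>2) \<longlonglongrightarrow> indicator (box a b) x"
    proof (rule AE_I2)
      fix x
      have "(indicator (box a b) x :: real)\<^sup>2 = indicator (box a b) x" by (simp add: indicator_def)
      then show "(\<lambda>k. (bump a b k x)\<^sup>2) \<longlonglongrightarrow> indicator (box a b) x"
        using tendsto_power[OF bump_tendsto_indicator[of a b x], of 2] by (simp only:)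
    qed
    show "AE x in lebesgue. norm ((bump a b k x)\<^sup>2) \<le> indicator (cbox a b) x" for k
    proof (rule AE_I2)
      fix x
      have "(bump a b k x)\<^sup>2 \<le> 1" using bump_bounds[of a b k x] by (simp add: power_le_one)
      then show "norm ((bump a b k x)\<^sup>2) \<le> indicator (cbox a b) x"
        using bump_outside[of x a b k] box_subset_cbox[of a b] by (auto simp: indicator_def)
    qed
  qed
  also have "(LINT x|lebesgue. indicator (box a b) x) = ?m" by simp
  \<comment> \<open>Origin of the quarter in the conclusion: the square of \<open>s\<close> is half
    of \<open>c\<close> squared plus half of an oscillating term whose integral will be at least
    minus a quarter of the measure, and (3/4 - 1/4) / 2 = 1/4.\<close>
  finally have "eventually (\<lambda>k. (LINT x|lebesgue. (bump a b k x)\<^sup>2) > 3/4 * ?m) sequentially"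
    by (rule order_tendstoD) (use mpos in simp)
  then obtain k where k: "(LINT x|lebesgue. (bump a b k x)\<^sup>2) > 3/4 * ?m"
    by (auto simp: eventually_sequentially)
  define c where "c = bump a b k"
  define c' where "c' x = frechet_derivative c (at x)" for x
  have Ckc: "Ck j c" for j by (simp add: c_def Ck_bump)
  have Dc: "(c has_derivative c' x) (at x)" for x
    using Ckc[of 1] by (simp add: c'_def frechet_derivative_works[symmetric])
  have c0: "c x = 0" if "x \<notin> box a b" for x using bump_outside[OF that] by (simp add: c_def)
  have cb: "0 \<le> c x" "c x \<le> 1" for x by (auto simp: c_def bump_bounds)
  \<comment> \<open>This includes the boundary of the box, where a support argument fails: a
    nonnegative function has a minimum wherever it vanishes. Thus perturbations on adjacent boxes do
    not interact even on common faces.\<close>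
  have c'0: "c' x = (\<lambda>_. 0)" if "x \<notin> box a b" for x
    by (rule differential_zero_maxmin[OF _ open_UNIV Dc]) (use c0[OF that] cb in auto)
  have c0c: "c x = 0" and c'0c: "c' x = (\<lambda>_. 0)" if "x \<notin> cbox a b" for x
    using that c0[of x] c'0[of x] box_subset_cbox[of a b] by blast+
  have contc: "continuous_on UNIV c" using Ckc[of 0] by simp
  have contc': "continuous_on UNIV (\<lambda>x. c' x (axis j 1))" for j
    using Ck_1_continuous[OF Ckc, of "axis j 1"] by (simp add: c'_def axis_in_Basis_iff)
  have linc': "c' x h = (\<Sum>j\<in>UNIV. h $ j * c' x (axis j 1))" for x h
  proof -
    have "h = (\<Sum>j\<in>UNIV. h $ j *\<^sub>R axis j 1)" 
      using basis_expansion[of h] by (simp add: scalar_mult_eq_scaleR)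
    then have "c' x h = c' x (\<Sum>j\<in>UNIV. h $ j *\<^sub>R axis j 1)" by simp
    also have "\<dots> = (\<Sum>j\<in>UNIV. h $ j * c' x (axis j 1))"
      using has_derivative_linear[OF Dc[of x]] by (simp add: linear_sum linear_cmul)
    finally show ?thesis .
  qed
  have contc'n: "continuous_on UNIV (\<lambda>x. c' x n)"
    unfolding linc'[of _ n] by (intro continuous_intros contc')
  define g where "g x = (\<chi> j. c' x (axis j 1))" for x
  have "continuous_on UNIV (\<lambda>x. outer A (g x))"
    unfolding outer_def g_def by (intro continuous_on_vec_lambda continuous_intros) (simp add: contc')
  then obtain B where B: "B > 0" "\<And>x. norm (outer A (g x)) \<le> B"
    by (rule continuous_compact_support_bounded[OF _ compact_cbox[of a b]])
      (use c'0c in \<open>auto simp: outer_def g_def vec_eq_iff\<close>)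
  obtain C0 where C0: "C0 > 0" "\<And>x. norm (2 * c x * c' x n) \<le> C0"
    by (rule continuous_compact_support_bounded[OF _ compact_cbox[of a b], of "\<lambda>x. 2 * c x * c' x n"])
      (use c0c in \<open>auto intro!: continuous_intros contc contc'n\<close>)
  define C where "C = (LINT x|lebesgue. \<bar>2 * c x * c' x n\<bar>)"
  have "C \<ge> 0" by (simp add: C_def)
  \<comment> \<open>After \<open>N > 1\<close>, the bounds control in turn the size of
    \<open>\<psi>\<close>, the part of its gradient that comes from the derivative of the cutoff,
    and the oscillating part of the mean square of \<open>s\<close>.\<close>
  obtain N0 where N0: "real N0 > max (max 1 ((norm A + 1) / e)) (max (B / e) (2 * C / ((norm n)\<^sup>2 * ?m)))"
    using reals_Archimedean2 by blast
  define N where "N = real N0"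
  have N: "N > 1" "(norm A + 1) / e < N" "B / e < N" "2 * C / ((norm n)\<^sup>2 * ?m) < N" using N0 by (auto simp: N_def)
  have nn: "(norm n)\<^sup>2 > 0" using n by simp
  \<comment> \<open>The summand \<open>+ 0\<close> gives the argument the affine form required by
    \<open>Ck_compose_affine\<close>.\<close>
  define s where "s x = c x * cos (N *\<^sub>R n \<bullet> x + 0)" for x
  define \<psi> where "\<psi> x = (c x * (1 / N * sin (N *\<^sub>R n \<bullet> x + 0))) *\<^sub>R A" for x
  show thesis
  proof
    show "Ck k \<psi>" for k
      unfolding \<psi>_def by (intro Ck_scaleR Ck_mult Ck_const Ckc Ck_compose_affine) (use Ck_sin_cos in blast)
    show "\<psi> x = 0" "s x = 0" if "x \<notin> box a b" for x
      using c0[OF that] by (simp_all add: \<psi>_def s_def)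
    have D\<psi>: "(\<psi> has_derivative (\<lambda>h. (c x * cos (N *\<^sub>R n \<bullet> x + 0) * (n \<bullet> h) + c' x h * sin (N *\<^sub>R n \<bullet> x + 0) / N) *\<^sub>R A)) (at x)" for x
      unfolding \<psi>_def using N(1)
      by (auto intro!: derivative_eq_intros Dc simp: fun_eq_iff field_simps)
    have J: "jac \<psi> x = s x *\<^sub>R outer A n + (sin (N *\<^sub>R n \<bullet> x + 0) / N) *\<^sub>R outer A (g x)" for x
      unfolding jac_eqI[OF D\<psi>]
      by (simp add: matrix_def vec_eq_iff s_def outer_def g_def inner_axis algebra_simps)
    show "jac \<psi> x = 0" if "x \<notin> box a b" for x
      unfolding J using c0[OF that] c'0[OF that] by (simp add: s_def g_def outer_def vec_eq_iff)
    show "norm (\<psi> x) \<le> e" for x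
    proof -
      have "norm (\<psi> x) = \<bar>c x\<bar> * \<bar>sin (N *\<^sub>R n \<bullet> x + 0)\<bar> * (norm A / N)"
        using N(1) by (simp add: \<psi>_def abs_mult)
      also have "\<dots> \<le> 1 * 1 * (norm A / N)"
        using cb[of x] N(1) by (intro mult_mono) auto
      also have "\<dots> \<le> e" using N(1,2) e by (simp add: field_simps)
      finally show ?thesis .
    qed
    show "\<bar>s x\<bar> \<le> 1" for x
      using cb[of x] mult_mono[of "\<bar>c x\<bar>" 1 "\<bar>cos (N *\<^sub>R n \<bullet> x + 0)\<bar>" 1] by (simp add: s_def abs_mult)
    show conts: "continuous_on UNIV s" unfolding s_def by (intro continuous_intros contc)
    show "norm (jac \<psi> x - s x *\<^sub>R outer A n) \<le> e" for x
    proof -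
      have "norm (jac \<psi> x - s x *\<^sub>R outer A n) = \<bar>sin (N *\<^sub>R n \<bullet> x + 0)\<bar> * (norm (outer A (g x)) / N)"
        unfolding J using N(1) by simp
      also have "\<dots> \<le> 1 * (B / N)" using B N(1) by (intro mult_mono divide_right_mono) auto
      also have "\<dots> \<le> e" using N(1,3) e by (simp add: field_simps)
      finally show ?thesis .
    qed
    \<comment> \<open>A quantitative Riemann-Lebesgue estimate: the derivative of the squared cutoff
      times the doubled-frequency sine, taken along \<open>n\<close>, has integral 0. This expresses
      the integral of the cosine term through a bounded quantity divided by
      \<open>N\<close>.\<close>
    define F' where "F' x h = 2 * c x * c' x h * sin (2 * (N *\<^sub>R n \<bullet> x)) + (c x)\<^sup>2 * (cos (2 * (N *\<^sub>R n \<bullet> x)) * (2 * N * (n \<bullet> h)))" for x h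
    have DF: "((\<lambda>x. (c x)\<^sup>2 * sin (2 * (N *\<^sub>R n \<bullet> x))) has_derivative F' x) (at x)" for x
      unfolding F'_def by (auto intro!: derivative_eq_intros Dc simp: fun_eq_iff algebra_simps)
    have contF': "continuous_on UNIV (\<lambda>x. F' x n)"
      unfolding F'_def by (intro continuous_intros contc contc'n)
    obtain BF where BF: "BF > 0" "\<And>x. norm (F' x n) \<le> BF"
      by (rule continuous_compact_support_bounded[OF contF' compact_cbox[of a b]])
        (use c0c in \<open>auto simp: F'_def\<close>)
    have "(LINT x|lebesgue. F' x n) = 0"
      by (rule integral_directional_derivative_eq_0[OF DF _ compact_cbox[of a b], of n BF])
        (use BF c0c in auto)
    moreover have i1: "integrable lebesgue (\<lambda>x. 2 * c x * c' x n * sin (2 * (N *\<^sub>R n \<bullet> x)))"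
      by (rule continuous_compact_support_integrable[OF _ compact_cbox[of a b]])
        (use c0c in \<open>auto intro!: continuous_intros contc contc'n\<close>)
    moreover have i2: "integrable lebesgue (\<lambda>x. (c x)\<^sup>2 * cos (2 * (N *\<^sub>R n \<bullet> x)))"
      by (rule continuous_compact_support_integrable[OF _ compact_cbox[of a b]])
        (use c0c in \<open>auto intro!: continuous_intros contc contc'n\<close>)
    moreover have "F' x n = 2 * c x * c' x n * sin (2 * (N *\<^sub>R n \<bullet> x)) + (2 * N * (norm n)\<^sup>2) * ((c x)\<^sup>2 * cos (2 * (N *\<^sub>R n \<bullet> x)))" for x
      by (simp add: F'_def power2_norm_eq_inner)
    ultimately have E: "(LINT x|lebesgue. 2 * c x * c' x n * sin (2 * (N *\<^sub>R n \<bullet> x))) + (2 * N * (norm n)\<^sup>2) * (LINT x|lebesgue. (c x)\<^sup>2 * cos (2 * (N *\<^sub>R n \<bullet> x))) = 0"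
      by simp
    have "\<bar>LINT x|lebesgue. 2 * c x * c' x n * sin (2 * (N *\<^sub>R n \<bullet> x))\<bar> \<le> C"
    proof -
      have "\<bar>LINT x|lebesgue. 2 * c x * c' x n * sin (2 * (N *\<^sub>R n \<bullet> x))\<bar> \<le> (LINT x|lebesgue. \<bar>2 * c x * c' x n * sin (2 * (N *\<^sub>R n \<bullet> x))\<bar>)"
        using integral_norm_bound[of lebesgue "\<lambda>x. 2 * c x * c' x n * sin (2 * (N *\<^sub>R n \<bullet> x))"] by simp
      also have "\<dots> \<le> C" unfolding C_def
      proof (rule integral_mono)
        show "integrable lebesgue (\<lambda>x. \<bar>2 * c x * c' x n * sin (2 * (N *\<^sub>R n \<bullet> x))\<bar>)"
          using i1 by (rule integrable_abs)
        show "integrable lebesgue (\<lambda>x. \<bar>2 * c x * c' x n\<bar>)"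
          by (rule continuous_compact_support_integrable[OF _ compact_cbox[of a b]])
            (use c0c in \<open>auto intro!: continuous_intros contc contc'n\<close>)
        show "\<bar>2 * c x * c' x n * sin (2 * (N *\<^sub>R n \<bullet> x))\<bar> \<le> \<bar>2 * c x * c' x n\<bar>" for x
          using abs_sin_le_one[of "2 * (N *\<^sub>R n \<bullet> x)"] by (simp add: abs_mult mult_left_le)
      qed
      finally show ?thesis .
    qed
    with E have 1: "(2 * N * (norm n)\<^sup>2) * (LINT x|lebesgue. (c x)\<^sup>2 * cos (2 * (N *\<^sub>R n \<bullet> x))) \<ge> - C" by linarith
    have "2 * C \<le> N * ((norm n)\<^sup>2 * ?m)" using N(4) nn mpos by (simp add: divide_less_eq less_imp_le)
    then have "(2 * N * (norm n)\<^sup>2) * (LINT x|lebesgue. (c x)\<^sup>2 * cos (2 * (N *\<^sub>R n \<bullet> x))) \<ge> (2 * N * (norm n)\<^sup>2) * (- ?m / 4)"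
      using 1 by (simp add: algebra_simps)
    then have 2: "(LINT x|lebesgue. (c x)\<^sup>2 * cos (2 * (N *\<^sub>R n \<bullet> x))) \<ge> - ?m / 4"
      using N(1) nn by (subst (asm) mult_le_cancel_left_pos) auto
    have i3: "integrable lebesgue (\<lambda>x. (c x)\<^sup>2)"
      by (rule continuous_compact_support_integrable[OF _ compact_cbox[of a b]])
        (use c0c in \<open>auto intro!: continuous_intros contc\<close>)
    have s2: "(s x)\<^sup>2 = ((c x)\<^sup>2 + (c x)\<^sup>2 * cos (2 * (N *\<^sub>R n \<bullet> x))) / 2" for x
      unfolding s_def cos_double_cos[of "N *\<^sub>R n \<bullet> x"] by (simp add: power_mult_distrib algebra_simps)
    have "(LINT x|lebesgue. (s x)\<^sup>2) = ((LINT x|lebesgue. (c x)\<^sup>2) + (LINT x|lebesgue. (c x)\<^sup>2 * cos (2 * (N *\<^sub>R n \<bullet> x)))) / 2"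
      unfolding s2 using i2 i3 by simp
    then show "(LINT x|lebesgue. (s x)\<^sup>2) \<ge> ?m / 4" using 2 k by (simp add: c_def)
  qed
qed

section \<open>Singular values of two-by-two matrices\<close>

text \<open>Squared moduli of the conformal coordinates, \<open>\<xi> v = z v + w (cnj v)\<close> on the complex plane.\<close>

definition zsq :: "real^2^2 \<Rightarrow> real" where
  "zsq \<xi> = ((\<xi>$1$1 + \<xi>$2$2)\<^sup>2 + (\<xi>$2$1 - \<xi>$1$2)\<^sup>2) / 4"

definition wsq :: "real^2^2 \<Rightarrow> real" where
  "wsq \<xi> = ((\<xi>$1$1 - \<xi>$2$2)\<^sup>2 + (\<xi>$2$1 + \<xi>$1$2)\<^sup>2) / 4"

lemma det_eq_zsq_wsq: "det \<xi> = zsq \<xi> - wsq \<xi>"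
  by (simp add: det_2 zsq_def wsq_def power2_eq_square field_simps)

lemma norm_eq_zsq_wsq: "(norm \<xi>)\<^sup>2 = 2 * (zsq \<xi> + wsq \<xi>)"
  by (simp add: power2_norm_eq_inner inner_vec_def sum_2 zsq_def wsq_def) (simp add: power2_eq_square field_simps)

lemma zsq_wsq_nonneg: "zsq \<xi> \<ge> 0" "wsq \<xi> \<ge> 0"
  by (simp_all add: zsq_def wsq_def)

lemma mat2_eqI:
  "(A::real^2^2)$1$1 = B$1$1 \<Longrightarrow> A$1$2 = B$1$2 \<Longrightarrow> A$2$1 = B$2$1 \<Longrightarrow> A$2$2 = B$2$2 \<Longrightarrow> A = B"
  by (simp add: vec_eq_iff forall_2)

text \<open>Together with \<open>psd_2_I\<close> this replaces the quadratic form by signs of the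
  diagonal and the determinant. One direction verifies the candidate square root, the other gives
  its uniqueness, as the definite description in \<open>psd_sqrt\<close> demands.\<close>

lemma psd_2_conds:
  fixes S :: "real^2^2"
  assumes sym: "transpose S = S" and pos: "\<And>x. 0 \<le> x \<bullet> (S *v x)"
  shows "S$2$1 = S$1$2" "S$1$1 \<ge> 0" "S$2$2 \<ge> 0" "det S \<ge> 0"
proof -
  show s: "S$2$1 = S$1$2"
  proof -
    have "transpose S $ 1 $ 2 = S $ 1 $ 2" using sym by simp
    then show ?thesis by (simp add: transpose_def)
  qed
  have q: "0 \<le> S$1$1 * p\<^sup>2 + 2 * S$1$2 * p * r + S$2$2 * r\<^sup>2" for p r
    using pos[of "vector [p, r]"]
    by (simp add: inner_vec_def sum_2 matrix_vector_mult_def s power2_eq_square algebra_simps)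
  show a: "S$1$1 \<ge> 0" and b: "S$2$2 \<ge> 0" using q[of 1 0] q[of 0 1] by auto
  show "det S \<ge> 0"
  proof (cases "S$1$1 = 0")
    case True
    have "S$1$2 = 0"
    proof (rule ccontr)
      assume "S$1$2 \<noteq> 0"
      \<comment> \<open>At the chosen vector the form takes the value -1.\<close>
      then show False
        using q[of "- (S$2$2 + 1) / (2 * S$1$2)" 1] True by (simp add: field_simps)
    qed
    then show ?thesis by (simp add: det_2 True s)
  next
    case False
    then have "S$1$1 > 0" using a by simp
    \<comment> \<open>The vector (S12, -S11) is chosen so that the form equals S11 times the
      determinant.\<close>
    moreover have "0 \<le> S$1$1 * det S"
      using q[of "S$1$2" "- S$1$1"] by (simp add: det_2 s power2_eq_square algebra_simps)
    ultimately show ?thesis by (simp add: zero_le_mult_iff)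
  qed
qed

lemma psd_2_I:
  fixes S :: "real^2^2"
  assumes "S$2$1 = S$1$2" "S$1$1 \<ge> 0" "S$2$2 \<ge> 0" "det S \<ge> 0"
  shows "transpose S = S" "0 \<le> x \<bullet> (S *v x)"
proof -
  show "transpose S = S" using assms(1) by (simp add: vec_eq_iff forall_2 transpose_def)
  have e: "x \<bullet> (S *v x) = S$1$1 * (x$1)\<^sup>2 + 2 * S$1$2 * x$1 * x$2 + S$2$2 * (x$2)\<^sup>2"
    by (simp add: inner_vec_def sum_2 matrix_vector_mult_def assms(1) power2_eq_square algebra_simps)
  have d: "S$1$1 * S$2$2 - S$1$2 * S$1$2 \<ge> 0" using assms(4) by (simp add: det_2 assms(1))
  show "0 \<le> x \<bullet> (S *v x)"
  proof (cases "S$1$1 = 0")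
    case True
    then have "S$1$2 = 0" using d by (smt (verit) mult_eq_0_iff not_real_square_gt_zero mult_zero_left)
    then show ?thesis using assms by (simp add: e)
  next
    case False
    then have p: "S$1$1 > 0" using assms by simp
    have "S$1$1 * (x \<bullet> (S *v x)) = (S$1$1 * x$1 + S$1$2 * x$2)\<^sup>2 + (S$1$1 * S$2$2 - S$1$2 * S$1$2) * (x$2)\<^sup>2"
      unfolding e by (simp add: power2_eq_square algebra_simps)
    also have "\<dots> \<ge> 0" using d by (intro add_nonneg_nonneg mult_nonneg_nonneg) auto
    finally show ?thesis using p by (simp add: zero_le_mult_iff)
  qed
qed

text \<open>By Cayley--Hamilton, a positive semidefinite \<open>S\<close> with \<open>S ** S = A\<close> satisfies
  \<open>tr S * S = A + sqrt (det A) * I\<close>, where \<open>(tr S)\<^sup>2 = tr A + 2 sqrt (det A)\<close>.\<close>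

lemma psd_sqrt_mult_transpose:
  fixes \<xi> :: "real^2^2"
  assumes d: "det \<xi> > 0"
  defines "A \<equiv> \<xi> ** transpose \<xi>" and "t \<equiv> 2 * sqrt (zsq \<xi>)"
  shows "psd_sqrt A = (1 / t) *\<^sub>R (A + det \<xi> *\<^sub>R mat 1)"
proof -
  have z: "zsq \<xi> > 0" using d zsq_wsq_nonneg[of \<xi>] by (simp add: det_eq_zsq_wsq)
  have t: "t > 0" "t\<^sup>2 = 4 * zsq \<xi>" using z by (auto simp: t_def power_mult_distrib)
  have A: "A$1$1 = (\<xi>$1$1)\<^sup>2 + (\<xi>$1$2)\<^sup>2" "A$1$2 = \<xi>$1$1 * \<xi>$2$1 + \<xi>$1$2 * \<xi>$2$2"
      "A$2$1 = A$1$2" "A$2$2 = (\<xi>$2$1)\<^sup>2 + (\<xi>$2$2)\<^sup>2"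
    by (simp_all add: A_def matrix_matrix_mult_def transpose_def sum_2 power2_eq_square algebra_simps)
  have dA: "A$1$1 * A$2$2 - A$1$2 * A$1$2 = (det \<xi>)\<^sup>2"
    unfolding A det_2 by (simp add: power2_eq_square algebra_simps)
  have trA: "A$1$1 + A$2$2 + 2 * det \<xi> = t\<^sup>2"
    unfolding A det_2 t(2) by (simp add: zsq_def power2_eq_square algebra_simps)
  define S where "S = (1 / t) *\<^sub>R (A + det \<xi> *\<^sub>R mat 1)"
  have Sc: "S$1$1 = (A$1$1 + det \<xi>) / t" "S$1$2 = A$1$2 / t" "S$2$1 = A$1$2 / t" "S$2$2 = (A$2$2 + det \<xi>) / t"
    by (simp_all add: S_def mat_def A(3))
  have detS: "det S = det \<xi>"
  proof -
    have "det S * t\<^sup>2 = (A$1$1 * A$2$2 - A$1$2 * A$1$2) + det \<xi> * (A$1$1 + A$2$2) + (det \<xi>)\<^sup>2"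
      unfolding det_2[of S] Sc using t(1) by (simp add: field_simps power2_eq_square)
    also have "\<dots> = det \<xi> * t\<^sup>2" unfolding dA trA[symmetric] by (simp add: power2_eq_square algebra_simps)
    finally show ?thesis using t(1) by simp
  qed
  have Spos: "S$1$1 \<ge> 0" "S$2$2 \<ge> 0" unfolding Sc using t(1) d by (simp_all add: A)
  have SS: "S ** S = A"
  proof (rule mat2_eqI)
    define M where "M = A + det \<xi> *\<^sub>R mat 1"
    have e: "(S ** S)$i$j = (M$i$1 * M$1$j + M$i$2 * M$2$j) / t\<^sup>2" for i j
      by (simp add: matrix_matrix_mult_def sum_2 S_def M_def[symmetric] power2_eq_square add_divide_distrib)
    have M: "M$1$1 = A$1$1 + det \<xi>" "M$1$2 = A$1$2" "M$2$1 = A$1$2" "M$2$2 = A$2$2 + det \<xi>"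
      by (simp_all add: M_def mat_def A(3))
    have t0: "t\<^sup>2 \<noteq> 0" using t(1) by simp
    have "M$1$1 * M$1$1 + M$1$2 * M$2$1 = A$1$1 * t\<^sup>2" "M$2$1 * M$1$2 + M$2$2 * M$2$2 = A$2$2 * t\<^sup>2"
      "M$1$1 * M$1$2 + M$1$2 * M$2$2 = A$1$2 * t\<^sup>2" "M$2$1 * M$1$1 + M$2$2 * M$2$1 = A$1$2 * t\<^sup>2"
      unfolding M trA[symmetric] using dA by (simp_all add: power2_eq_square algebra_simps)
    then show "(S ** S)$1$1 = A$1$1" "(S ** S)$2$2 = A$2$2" "(S ** S)$1$2 = A$1$2" "(S ** S)$2$1 = A$2$1"
      unfolding e A(3) using t0 by (simp_all only: nonzero_mult_div_cancel_right not_False_eq_True)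
  qed
  show ?thesis unfolding psd_sqrt_def S_def[symmetric]
  proof (rule the_equality)
    show "transpose S = S \<and> (\<forall>x. 0 \<le> x \<bullet> (S *v x)) \<and> S ** S = A"
      using psd_2_I[of S] Spos detS d SS by (auto simp: Sc)
    fix T :: "real^2^2"
    assume T: "transpose T = T \<and> (\<forall>x. 0 \<le> x \<bullet> (T *v x)) \<and> T ** T = A"
    then have c: "T$2$1 = T$1$2" "T$1$1 \<ge> 0" "T$2$2 \<ge> 0" "det T \<ge> 0"
      using psd_2_conds[of T] by auto
    have TA: "A$1$1 = (T$1$1)\<^sup>2 + (T$1$2)\<^sup>2" "A$1$2 = T$1$2 * (T$1$1 + T$2$2)" "A$2$2 = (T$1$2)\<^sup>2 + (T$2$2)\<^sup>2"
      using T c(1) by (auto simp: matrix_matrix_mult_def sum_2 power2_eq_square algebra_simps)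
    \<comment> \<open>Determinant and trace of \<open>T\<close> are determined by \<open>A\<close>
      up to sign, and positivity fixes the signs; Cayley-Hamilton then determines every
      entry.\<close>
    have "(det T)\<^sup>2 = A$1$1 * A$2$2 - A$1$2 * A$1$2"
      unfolding TA det_2 c(1) by (simp add: power2_eq_square algebra_simps)
    then have "(det T)\<^sup>2 = (det \<xi>)\<^sup>2" unfolding dA .
    then have dT: "det T = det \<xi>" using c(4) d by simp
    have "(T$1$1 + T$2$2)\<^sup>2 = A$1$1 + A$2$2 + 2 * det T"
      unfolding TA det_2 c(1) by (simp add: power2_eq_square algebra_simps)
    then have "(T$1$1 + T$2$2)\<^sup>2 = t\<^sup>2" using dT trA by simp
    then have tT: "T$1$1 + T$2$2 = t" using c t(1) by simp
    have dT': "T$1$1 * T$2$2 - T$1$2 * T$1$2 = det \<xi>" using dT by (simp add: det_2 c(1))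
    show "T = S"
    proof (rule mat2_eqI)
      show "T$1$1 = S$1$1" unfolding Sc TA using t(1) dT' tT[symmetric]
        by (simp add: eq_divide_eq) (simp add: power2_eq_square algebra_simps)
      show "T$2$2 = S$2$2" unfolding Sc TA using t(1) dT' tT[symmetric]
        by (simp add: eq_divide_eq) (simp add: power2_eq_square algebra_simps)
      show "T$1$2 = S$1$2" "T$2$1 = S$2$1" unfolding Sc TA c(1) using t(1) tT by auto
    qed
  qed
qed

lemma eigenvalues_iff_det: "c \<in> eigenvalues (M::real^2^2) \<longleftrightarrow> c\<^sup>2 - (M$1$1 + M$2$2) * c + det M = 0"
proof -
  have "c \<in> eigenvalues M \<longleftrightarrow> (\<exists>v. v \<noteq> 0 \<and> (M - c *\<^sub>R mat 1) *v v = 0)"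
    by (simp add: eigenvalues_def matrix_vector_mult_diff_rdistrib scaleR_matrix_vector_assoc[symmetric])
  also have "\<dots> \<longleftrightarrow> \<not> invertible (M - c *\<^sub>R mat 1)"
    by (metis invertible_left_inverse matrix_left_invertible_ker)
  also have "\<dots> \<longleftrightarrow> det (M - c *\<^sub>R mat 1) = 0" by (simp add: invertible_det_nz)
  also have "det (M - c *\<^sub>R mat 1) = c\<^sup>2 - (M$1$1 + M$2$2) * c + det M"
    by (simp add: det_2 mat_def power2_eq_square algebra_simps)
  finally show ?thesis .
qed

text \<open>The square root has trace 2 |z| and determinant |z|^2 - |w|^2, so its characteristic
  polynomial factors with roots |z| - |w| and |z| + |w|.\<close>

lemma singular_values_2:
  fixes \<xi> :: "real^2^2"
  assumes d: "det \<xi> > 0"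
  shows "lambda1 \<xi> = sqrt (zsq \<xi>) - sqrt (wsq \<xi>)" "lambda2 \<xi> = sqrt (zsq \<xi>) + sqrt (wsq \<xi>)"
proof -
  let ?A = "\<xi> ** transpose \<xi>" and ?t = "2 * sqrt (zsq \<xi>)"
  have z: "zsq \<xi> > 0" using d zsq_wsq_nonneg[of \<xi>] by (simp add: det_eq_zsq_wsq)
  have t: "?t > 0" "?t\<^sup>2 = 4 * zsq \<xi>" using z by (auto simp: power_mult_distrib)
  define S where "S = psd_sqrt ?A"
  have S: "S = (1 / ?t) *\<^sub>R (?A + det \<xi> *\<^sub>R mat 1)"
    unfolding S_def by (rule psd_sqrt_mult_transpose[OF d])
  have A: "?A$1$1 = (\<xi>$1$1)\<^sup>2 + (\<xi>$1$2)\<^sup>2" "?A$1$2 = \<xi>$1$1 * \<xi>$2$1 + \<xi>$1$2 * \<xi>$2$2"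
      "?A$2$1 = ?A$1$2" "?A$2$2 = (\<xi>$2$1)\<^sup>2 + (\<xi>$2$2)\<^sup>2"
    by (simp_all add: matrix_matrix_mult_def transpose_def sum_2 power2_eq_square algebra_simps)
  have dA: "?A$1$1 * ?A$2$2 - ?A$1$2 * ?A$1$2 = (det \<xi>)\<^sup>2"
    unfolding A det_2 by (simp add: power2_eq_square algebra_simps)
  have trA: "?A$1$1 + ?A$2$2 + 2 * det \<xi> = ?t\<^sup>2"
    unfolding A det_2 t(2) by (simp add: zsq_def power2_eq_square algebra_simps)
  have Sc: "S$1$1 = (?A$1$1 + det \<xi>) / ?t" "S$1$2 = ?A$1$2 / ?t" "S$2$1 = ?A$1$2 / ?t" "S$2$2 = (?A$2$2 + det \<xi>) / ?t"
    by (simp_all add: S mat_def A(3))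
  have trS: "S$1$1 + S$2$2 = ?t"
  proof -
    have "S$1$1 + S$2$2 = ?t\<^sup>2 / ?t" unfolding Sc trA[symmetric] by (simp add: add_divide_distrib)
    also have "\<dots> = ?t" using t(1) by (simp only: power2_eq_square nonzero_mult_div_cancel_right)
    finally show ?thesis .
  qed
  have detS: "det S = det \<xi>"
  proof -
    have "det S * ?t\<^sup>2 = (?A$1$1 * ?A$2$2 - ?A$1$2 * ?A$1$2) + det \<xi> * (?A$1$1 + ?A$2$2) + (det \<xi>)\<^sup>2"
      unfolding det_2[of S] Sc using t(1) by (simp add: field_simps power2_eq_square)
    also have "\<dots> = det \<xi> * ?t\<^sup>2" unfolding dA trA[symmetric] by (simp add: power2_eq_square algebra_simps)
    finally show ?thesis using t(1) by simp
  qed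
  have "c \<in> eigenvalues S \<longleftrightarrow> (c - (sqrt (zsq \<xi>) - sqrt (wsq \<xi>))) * (c - (sqrt (zsq \<xi>) + sqrt (wsq \<xi>))) = 0" for c
  proof -
    have "det S = (sqrt (zsq \<xi>))\<^sup>2 - (sqrt (wsq \<xi>))\<^sup>2"
      unfolding detS using zsq_wsq_nonneg[of \<xi>] by (simp add: det_eq_zsq_wsq)
    then have "c\<^sup>2 - ?t * c + det S = (c - (sqrt (zsq \<xi>) - sqrt (wsq \<xi>))) * (c - (sqrt (zsq \<xi>) + sqrt (wsq \<xi>)))"
      by algebra
    then show ?thesis unfolding eigenvalues_iff_det trS by (simp only:)
  qed
  then have "eigenvalues S = {sqrt (zsq \<xi>) - sqrt (wsq \<xi>), sqrt (zsq \<xi>) + sqrt (wsq \<xi>)}"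
    by auto
  then show "lambda1 \<xi> = sqrt (zsq \<xi>) - sqrt (wsq \<xi>)" "lambda2 \<xi> = sqrt (zsq \<xi>) + sqrt (wsq \<xi>)"
    unfolding lambda1_def lambda2_def S_def using zsq_wsq_nonneg[of \<xi>] by auto
qed

text \<open>In the conformal coordinates \<open>\<xi> = (z, w)\<close> the direction \<open>\<eta>\<close> moves \<open>z\<close> and \<open>w\<close> at equal
  speed orthogonally to themselves: it has rank one, preserves the determinant and increases
  \<open>\<bar>w\<bar>\<^sup>2\<close> quadratically in both directions.\<close>

lemma rank_one_direction:
  fixes \<xi> :: "real^2^2"
  assumes t: "t > 0"
  obtains A n :: "real^2" where
    "n \<noteq> 0" "(norm (outer A n))\<^sup>2 = 4 * t" 
    "\<And>s. det (\<xi> + s *\<^sub>R outer A n) = det \<xi>"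
    "\<And>s. wsq (\<xi> + s *\<^sub>R outer A n) = wsq \<xi> + s\<^sup>2 * t"
proof -
  \<comment> \<open>If the given vector is zero, which for the coordinate w means that \<xi> is
    conformal, every direction is orthogonal to it and (1, 0) serves as a default.\<close>
  have orth: "\<exists>p q. p\<^sup>2 + q\<^sup>2 = 1 \<and> p * x + q * y = 0" for x y :: real
  proof (cases "x = 0 \<and> y = 0")
    case True
    then show ?thesis by (intro exI[of _ 1] exI[of _ 0]) simp
  next
    case False
    define r where "r = sqrt (x\<^sup>2 + y\<^sup>2)"
    have r2: "r\<^sup>2 = x\<^sup>2 + y\<^sup>2" by (simp add: r_def)
    moreover have "r \<noteq> 0" using False by (simp add: r_def sum_power2_eq_zero_iff)
    ultimately show ?thesis
      by (intro exI[of _ "- y / r"] exI[of _ "x / r"]) (auto simp: power_divide add_divide_distrib[symmetric] field_simps)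
  qed
  obtain p q where z: "p\<^sup>2 + q\<^sup>2 = 1" "p * (\<xi>$1$1 + \<xi>$2$2) + q * (\<xi>$2$1 - \<xi>$1$2) = 0"
    using orth by blast
  obtain c d where w: "c\<^sup>2 + d\<^sup>2 = 1" "c * (\<xi>$1$1 - \<xi>$2$2) + d * (\<xi>$2$1 + \<xi>$1$2) = 0"
    using orth by blast
  define r where "r = sqrt t"
  have r: "r\<^sup>2 = t" using t by (simp add: r_def)
  \<comment> \<open>The matrix with conformal coordinates r (p + i q) and r (c + i d). Their moduli
    agree, hence its determinant is 0.\<close>
  define \<eta> :: "real^2^2" where "\<eta> = vector [vector [r * (p + c), r * (d - q)], vector [r * (q + d), r * (p - c)]]"
  have \<eta>: "\<eta>$1$1 = r * (p + c)" "\<eta>$1$2 = r * (d - q)" "\<eta>$2$1 = r * (q + d)" "\<eta>$2$2 = r * (p - c)"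
    by (simp_all add: \<eta>_def)
  have det\<eta>: "(p + c) * (p - c) = (d - q) * (q + d)"
    using z(1) w(1) by (simp add: power2_eq_square algebra_simps)
  have zs: "zsq (\<xi> + s *\<^sub>R \<eta>) = zsq \<xi> + s\<^sup>2 * t" for s
  proof -
    have "zsq (\<xi> + s *\<^sub>R \<eta>) = zsq \<xi> + s * r * (p * (\<xi>$1$1 + \<xi>$2$2) + q * (\<xi>$2$1 - \<xi>$1$2)) + s\<^sup>2 * r\<^sup>2 * (p\<^sup>2 + q\<^sup>2)"
      by (simp add: zsq_def \<eta>) (simp add: power2_eq_square field_simps)
    then show ?thesis by (simp add: z r)
  qed
  have ws: "wsq (\<xi> + s *\<^sub>R \<eta>) = wsq \<xi> + s\<^sup>2 * t" for s
  proof -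
    have "wsq (\<xi> + s *\<^sub>R \<eta>) = wsq \<xi> + s * r * (c * (\<xi>$1$1 - \<xi>$2$2) + d * (\<xi>$2$1 + \<xi>$1$2)) + s\<^sup>2 * r\<^sup>2 * (c\<^sup>2 + d\<^sup>2)"
      by (simp add: wsq_def \<eta>) (simp add: power2_eq_square field_simps)
    then show ?thesis by (simp add: w r)
  qed
  have n\<eta>: "(norm \<eta>)\<^sup>2 = 4 * t"
    using zs[of 1] ws[of 1] unfolding norm_eq_zsq_wsq
  proof -
    have "zsq \<eta> = r\<^sup>2 * (p\<^sup>2 + q\<^sup>2)" "wsq \<eta> = r\<^sup>2 * (c\<^sup>2 + d\<^sup>2)"
      by (simp_all add: zsq_def wsq_def \<eta>) (simp_all add: power2_eq_square field_simps)
    then show "2 * (zsq \<eta> + wsq \<eta>) = 4 * t" by (simp add: z w r)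
  qed
  \<comment> \<open>A singular matrix has dependent rows: either the first row is zero, or the
    second is a multiple of it, with factor read off from a nonzero entry.\<close>
  have "\<exists>A n. \<eta> = outer A n"
  proof (cases "p + c = 0 \<and> d - q = 0")
    case True
    then have "\<eta> = outer (vector [0, 1]) (vector [r * (q + d), r * (p - c)])"
      by (intro mat2_eqI) (simp_all add: \<eta> outer_def)
    then show ?thesis by blast
  next
    case False
    show ?thesis
    proof (cases "p + c = 0")
      case True
      with False have 1: "d - q \<noteq> 0" by simp
      then have 2: "q + d = 0" using det\<eta> True by simp
      have "\<eta> = outer (vector [1, (p - c) / (d - q)]) (vector [r * (p + c), r * (d - q)])"
        using 1 by (intro mat2_eqI) (simp_all add: \<eta> outer_def True 2)
      then show ?thesis by blast
    next
      case False
      have "p - c = (d - q) * (q + d) / (p + c)" using det\<eta> False by (simp add: field_simps)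
      then have "\<eta> = outer (vector [1, (q + d) / (p + c)]) (vector [r * (p + c), r * (d - q)])"
        using False by (intro mat2_eqI) (simp_all add: \<eta> outer_def)
      then show ?thesis by blast
    qed
  qed
  then obtain A n where An: "\<eta> = outer A n" by blast
  show thesis
  proof
    show "n \<noteq> 0"
    proof
      assume "n = 0"
      then have "\<eta> = 0" by (simp add: An outer_def vec_eq_iff)
      then show False using n\<eta> t by simp
    qed
    show "(norm (outer A n))\<^sup>2 = 4 * t" using n\<eta> An by simp
    show "det (\<xi> + s *\<^sub>R outer A n) = det \<xi>" for s
      unfolding det_eq_zsq_wsq An[symmetric] by (simp add: zs ws)
    show "wsq (\<xi> + s *\<^sub>R outer A n) = wsq \<xi> + s\<^sup>2 * t" for s
      using ws[of s] An by simp
  qed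
qed

section \<open>Perturbing a gradient towards the target set\<close>

lemma Ck_has_derivative: "Ck (Suc k) f \<Longrightarrow> (f has_derivative frechet_derivative f (at x)) (at x)"
  by (simp add: frechet_derivative_works[symmetric])

lemma jac_continuous:
  assumes "Ck (Suc 0) f"
  shows "continuous_on UNIV (jac f)"
  unfolding jac_def matrix_def
  by (intro continuous_on_vec_lambda continuous_on_component) (use assms axis_in_Basis_iff in auto)

lemma jac_add:
  assumes "Ck (Suc 0) f" "Ck (Suc 0) g"
  shows "jac (\<lambda>x. f x + g x) x = jac f x + jac g x"
proof -
  have "jac (\<lambda>x. f x + g x) x = matrix (\<lambda>h. frechet_derivative f (at x) h + frechet_derivative g (at x) h)"
    by (intro jac_eqI has_derivative_add Ck_has_derivative[OF assms(1)] Ck_has_derivative[OF assms(2)])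
  then show ?thesis by (simp add: jac_def matrix_def vec_eq_iff)
qed

lemma jac_const: "jac (\<lambda>x. c) x = 0"
  by (simp add: jac_def matrix_def vec_eq_iff)

lemma jac_sum:
  assumes "\<And>i. i \<in> I \<Longrightarrow> Ck (Suc 0) (f i)"
  shows "jac (\<lambda>x. \<Sum>i\<in>I. f i x) x = (\<Sum>i\<in>I. jac (f i) x)"
  using assms
proof (induction I rule: infinite_finite_induct)
  case (insert i I)
  then have "jac (\<lambda>x. f i x + (\<Sum>i\<in>I. f i x)) x = jac (f i) x + jac (\<lambda>x. \<Sum>i\<in>I. f i x) x"
    by (intro jac_add Ck_sum) auto
  with insert show ?case by simp
qed (simp_all add: jac_const)

lemma bounded_measurable_integrable:
  fixes f :: "'a::euclidean_space \<Rightarrow> 'b::{banach, second_countable_topology}"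
  assumes "W \<in> lmeasurable" "f \<in> borel_measurable (lebesgue_on W)" "AE x in lebesgue_on W. norm (f x) \<le> B"
  shows "integrable (lebesgue_on W) f"
  using finite_measure.integrable_const_bound[OF finite_measure_lebesgue_on] assms by blast

lemma bounded_continuous_integrable:
  fixes f :: "'a::euclidean_space \<Rightarrow> 'b::{banach, second_countable_topology}"
  assumes "open W" "bounded W" "continuous_on W f" "\<And>x. x \<in> W \<Longrightarrow> norm (f x) \<le> B"
  shows "integrable (lebesgue_on W) f"
proof (rule bounded_measurable_integrable[where B=B])
  show W: "W \<in> lmeasurable" using assms by (simp add: lmeasurable_open)
  show "f \<in> borel_measurable (lebesgue_on W)"
    by (rule continuous_imp_measurable_on_sets_lebesgue[OF assms(3) fmeasurableD[OF W]])
  show "AE x in lebesgue_on W. norm (f x) \<le> B"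
    by (rule AE_I2) (use assms in simp)
qed

text \<open>The covering lemma gives countably many nonoverlapping boxes subordinate to
  \<open>g\<close>; their boundaries are negligible, so continuity of the measure from below leaves
  a finite subfamily missing less than \<open>r\<close>. Finiteness keeps the later sum of
  perturbations smooth and compactly supported in W.\<close>

lemma exhaustion_by_disjoint_boxes:
  fixes W :: "'a::euclidean_space set"
  assumes W: "open W" "bounded W" and g: "\<forall>x\<in>W. x \<in> g x \<and> open (g x) \<and> g x \<subseteq> W" and r: "r > 0"
  obtains D where "finite D" "\<And>K. K \<in> D \<Longrightarrow> \<exists>c d. K = cbox c d \<and> box c d \<noteq> {}"
    "\<And>K. K \<in> D \<Longrightarrow> \<exists>x\<in>W. K \<subseteq> g x"
    "pairwise (\<lambda>A B. interior A \<inter> interior B = {}) D"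
    "measure lebesgue (W - \<Union>(interior ` D)) < r"
proof -
  \<comment> \<open>Inserting 0 makes the enclosing box nonempty even when \<open>W\<close> is
    empty.\<close>
  have "bounded (insert 0 W)" using W by simp
  then obtain a where a: "insert 0 W \<subseteq> box (-a) a" by (rule bounded_subset_box_symmetric)
  \<comment> \<open>A gauge must be defined at every point; the unit balls off \<open>W\<close> are
    placeholders, since the tags of the covering lie in \<open>W\<close>.\<close>
  define g' where "g' x = (if x \<in> W then g x else ball x 1)" for x
  have "gauge g'" using g by (auto simp: gauge_def g'_def)
  moreover have "W \<subseteq> cbox (-a) a" "box (-a) a \<noteq> {}" using a box_subset_cbox[of "-a" a] by auto
  ultimately obtain D where D: "countable D"
      "\<And>K. K \<in> D \<Longrightarrow> interior K \<noteq> {} \<and> (\<exists>c d. K = cbox c d)"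
      "pairwise (\<lambda>A B. interior A \<inter> interior B = {}) D"
      "\<And>K. K \<in> D \<Longrightarrow> \<exists>x \<in> W \<inter> K. K \<subseteq> g' x" "W \<subseteq> \<Union>D"
    by (metis covering_lemma[of W "-a" a g'])
  have DW: "\<exists>x\<in>W. K \<subseteq> g x" if "K \<in> D" for K using D(4)[OF that] by (auto simp: g'_def)
  have KW: "K \<subseteq> W" if "K \<in> D" for K using DW[OF that] g by blast
  show thesis
  proof (cases "D = {}")
    case True
    show ?thesis by (rule that[of "{}"]) (use True D(5) r in auto)
  next
    case False
    define S where "S n = \<Union>(interior ` (from_nat_into D ` {..n}))" for n :: nat
    have frD: "from_nat_into D n \<in> D" for n using False by (rule from_nat_into)
    have Uk: "(\<Union>n. S n) = \<Union>(interior ` D)"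
    proof -
      have "\<Union>(interior ` D) = \<Union>(interior ` range (from_nat_into D))"
        by (simp only: range_from_nat_into[OF False D(1)])
      also have "\<dots> = (\<Union>n. S n)" unfolding S_def by auto
      finally show ?thesis by simp
    qed
    have UW: "\<Union>(interior ` D) \<subseteq> W" using KW interior_subset by blast
    have Wm: "W \<in> lmeasurable" using W by (simp add: lmeasurable_open)
    have Sopen: "open (S n)" for n unfolding S_def by auto
    have SW: "S n \<subseteq> W" for n using UW Uk by blast
    have Um: "\<Union>(interior ` D) \<in> lmeasurable"
      using UW W bounded_subset by (intro lmeasurable_open) auto
    have "(\<lambda>n. measure lebesgue (S n)) \<longlonglongrightarrow> measure lebesgue (\<Union>n. S n)"
    proof (rule Lim_measure_incseq)
      show "range S \<subseteq> sets lebesgue" using Sopen by auto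
      show "incseq S" unfolding S_def by (intro monoI Union_mono image_mono) simp
      show "emeasure lebesgue (\<Union>n. S n) \<noteq> \<infinity>" unfolding Uk using Um by (auto simp: fmeasurable_def)
    qed
    moreover have "measure lebesgue (\<Union>n. S n) = measure lebesgue W"
    proof -
      have "negligible (\<Union>((\<lambda>K. K - interior K) ` D))"
      proof (rule negligible_countable_Union)
        show "countable ((\<lambda>K. K - interior K) ` D)" using D(1) by simp
        fix S assume "S \<in> (\<lambda>K. K - interior K) ` D"
        then obtain K where K: "K \<in> D" "S = K - interior K" by blast
        obtain c d where "K = cbox c d" using D(2)[OF K(1)] by blast
        then show "negligible S" using negligible_frontier_interval[of c d] K by simp
      qed
      moreover have "W - \<Union>(interior ` D) \<subseteq> \<Union>((\<lambda>K. K - interior K) ` D)" using D(5) by blast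
      ultimately have "negligible (W - \<Union>(interior ` D))" using negligible_subset by blast
      then have sd: "negligible (sym_diff W (\<Union>(interior ` D)))"
        using UW by (simp add: Diff_eq_empty_iff[THEN iffD2])
      show ?thesis unfolding Uk by (rule measure_negligible_symdiff[OF Wm sd])
    qed
    ultimately have "(\<lambda>n. measure lebesgue (S n)) \<longlonglongrightarrow> measure lebesgue W" by simp
    then have "eventually (\<lambda>n. measure lebesgue (S n) > measure lebesgue W - r) sequentially"
      by (rule order_tendstoD) (use r in simp)
    then obtain n where n: "measure lebesgue (S n) > measure lebesgue W - r"
      by (auto simp: eventually_sequentially)
    have "S n \<in> lmeasurable" using Sopen[of n] SW[of n] W bounded_subset by (intro lmeasurable_open) auto
    then have m: "measure lebesgue (W - S n) < r"
      using n measurable_measure_Diff[OF Wm fmeasurableD SW, of n] by simp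
    show ?thesis
    proof (rule that[of "from_nat_into D ` {..n}"])
      show "\<exists>c d. K = cbox c d \<and> box c d \<noteq> {}" if "K \<in> from_nat_into D ` {..n}" for K
      proof -
        have "K \<in> D" using that frD by blast
        then show ?thesis using D(2)[of K] by (auto simp: interior_cbox)
      qed
      show "pairwise (\<lambda>A B. interior A \<inter> interior B = {}) (from_nat_into D ` {..n})"
        using D(3) by (rule pairwise_subset) (use frD in blast)
      show "\<exists>x\<in>W. K \<subseteq> g x" if "K \<in> from_nat_into D ` {..n}" for K
        using that frD DW by blast
      show "measure lebesgue (W - \<Union> (interior ` from_nat_into D ` {..n})) < r"
        using m by (simp add: S_def)
    qed simp
  qed
qed

section \<open>Perturbation scheme for an abstract gap function\<close>

text \<open>\<open>F\<close> measures how far a gradient in \<open>U\<close> is from the target set. In \<open>dir\<close> the length of the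
  rank-one segment is comparable to the square root of the gap, which makes the successive
  perturbations summable.\<close>

locale laminate_gap =
  fixes U :: "(real^'n^'m) set" and F :: "real^'n^'m \<Rightarrow> real" and C \<kappa> :: real
  assumes open_U: "open U" and bounded_U: "bounded U" and cont_F: "continuous_on UNIV F"
    and F_pos: "\<And>\<xi>. \<xi> \<in> U \<Longrightarrow> F \<xi> > 0"
    and C_pos: "C \<ge> 0" and \<kappa>: "0 < \<kappa>" "\<kappa> \<le> 1"
    and dir: "\<And>\<xi>. \<xi> \<in> U \<Longrightarrow> \<exists>A n. n \<noteq> 0 \<and> (norm (outer A n))\<^sup>2 \<le> C * F \<xi> \<and>
        (\<forall>s. \<bar>s\<bar> \<le> 1 \<longrightarrow> \<xi> + s *\<^sub>R outer A n \<in> U \<and> F (\<xi> + s *\<^sub>R outer A n) \<le> F \<xi> - \<kappa> * s\<^sup>2 * F \<xi>)"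
begin

lemma F_bounded: obtains M where "M > 0" "\<And>\<xi>. \<xi> \<in> U \<Longrightarrow> F \<xi> \<le> M"
proof -
  have "compact (closure U)" using bounded_U by (simp add: compact_closure)
  then have "bounded (F ` closure U)"
    using cont_F by (intro compact_imp_bounded compact_continuous_image) (auto intro: continuous_on_subset)
  then obtain M where "M > 0" "\<And>\<xi>. \<xi> \<in> closure U \<Longrightarrow> \<bar>F \<xi>\<bar> \<le> M" by (auto simp: bounded_pos)
  then show ?thesis using that[of M] closure_subset[of U] by force
qed

lemma F_uniform:
  assumes "\<epsilon> > 0"
  obtains \<delta> where "\<delta> > 0" "\<And>\<xi> \<zeta>. \<xi> \<in> U \<Longrightarrow> \<zeta> \<in> U \<Longrightarrow> norm (\<xi> - \<zeta>) < \<delta> \<Longrightarrow> \<bar>F \<xi> - F \<zeta>\<bar> < \<epsilon>"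
proof -
  have "compact (closure U)" using bounded_U by (simp add: compact_closure)
  then have "uniformly_continuous_on (closure U) F"
    using cont_F by (intro compact_uniformly_continuous) (auto intro: continuous_on_subset)
  then obtain \<delta> where "\<delta> > 0" "\<And>\<xi> \<zeta>. \<xi> \<in> closure U \<Longrightarrow> \<zeta> \<in> closure U \<Longrightarrow> dist \<xi> \<zeta> < \<delta> \<Longrightarrow> dist (F \<xi>) (F \<zeta>) < \<epsilon>"
    using assms unfolding uniformly_continuous_on_def by metis
  then show ?thesis using that[of \<delta>] closure_subset[of U] by (force simp: dist_norm)
qed

text \<open>The gradient is frozen at \<xi>. The whole rank-one segment through \<xi> is compact in
  the open set \<open>U\<close> and \<open>F\<close> is uniformly continuous there, so one radius
  \<delta>, chosen before the box and the field \<open>G\<close>, makes the oscillation built for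
  \<xi> work for every \<open>G\<close> that stays within \<delta> of \<xi>.\<close>

lemma box_perturbation:
  assumes \<xi>: "\<xi> \<in> U" and e: "e > 0" and \<epsilon>: "\<epsilon> > 0"
  obtains \<delta> where "\<delta> > 0" "\<And>c d G. box c d \<noteq> {} \<Longrightarrow> (\<And>y. y \<in> cbox c d \<Longrightarrow> G y \<in> U \<and> norm (G y - \<xi>) < \<delta>) \<Longrightarrow>
    \<exists>\<psi> :: real^'n \<Rightarrow> real^'m. \<exists>s. (\<forall>k. Ck k \<psi>) \<and> (\<forall>x. x \<notin> box c d \<longrightarrow> \<psi> x = 0 \<and> s x = 0 \<and> jac \<psi> x = 0) \<and>
      (\<forall>x. norm (\<psi> x) \<le> e) \<and> continuous_on UNIV s \<and> (\<forall>x. \<bar>s x\<bar> \<le> 1) \<and>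
      (LINT x|lebesgue. (s x)\<^sup>2) \<ge> measure lebesgue (box c d) / 4 \<and>
      (\<forall>y\<in>cbox c d. G y + jac \<psi> y \<in> U \<and> F (G y + jac \<psi> y) \<le> F (G y) + 2 * \<epsilon> - \<kappa> * (s y)\<^sup>2 * F \<xi> \<and>
         (norm (jac \<psi> y))\<^sup>2 \<le> 2 * C * F (G y) + e \<and> F (G y) - \<epsilon> \<le> F \<xi>)"
proof -
  obtain A n where An: "n \<noteq> 0" "(norm (outer A n))\<^sup>2 \<le> C * F \<xi>"
      "\<And>s. \<bar>s\<bar> \<le> 1 \<Longrightarrow> \<xi> + s *\<^sub>R outer A n \<in> U"
      "\<And>s. \<bar>s\<bar> \<le> 1 \<Longrightarrow> F (\<xi> + s *\<^sub>R outer A n) \<le> F \<xi> - \<kappa> * s\<^sup>2 * F \<xi>"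
    using dir[OF \<xi>] by blast
  \<comment> \<open>The second bound makes replacing \<open>F \<xi>\<close> by
    \<open>F (G y)\<close> in the length estimate cost at most \<open>e / 2\<close>;
    \<open>C + 1\<close> avoids dividing by zero when \<open>C\<close> is 0.\<close>
  define \<epsilon>' where "\<epsilon>' = min \<epsilon> (e / (4 * (C + 1)))"
  have \<epsilon>': "\<epsilon>' > 0" using \<epsilon> e C_pos by (simp add: \<epsilon>'_def)
  have \<epsilon>'e: "2 * C * \<epsilon>' \<le> e / 2"
  proof -
    have "\<epsilon>' * (4 * (C + 1)) \<le> e" using C_pos by (simp add: \<epsilon>'_def min_le_iff_disj pos_le_divide_eq[symmetric] del: mult_le_cancel_right)
    then show ?thesis using \<epsilon>' by (simp add: algebra_simps)
  qed
  obtain \<delta>1 where \<delta>1: "\<delta>1 > 0" "\<And>\<xi> \<zeta>. \<xi> \<in> U \<Longrightarrow> \<zeta> \<in> U \<Longrightarrow> norm (\<xi> - \<zeta>) < \<delta>1 \<Longrightarrow> \<bar>F \<xi> - F \<zeta>\<bar> < \<epsilon>'"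
    using F_uniform[OF \<epsilon>'] by blast
  have "compact ((\<lambda>s. \<xi> + s *\<^sub>R outer A n) ` {-1..1})"
    by (intro compact_continuous_image continuous_intros) simp
  moreover have "(\<lambda>s. \<xi> + s *\<^sub>R outer A n) ` {-1..1} \<subseteq> U" using An(3) by (auto simp: abs_le_iff)
  ultimately obtain \<delta>2 where \<delta>2: "\<delta>2 > 0" "(\<Union>x\<in>(\<lambda>s. \<xi> + s *\<^sub>R outer A n) ` {-1..1}. ball x \<delta>2) \<subseteq> U"
    using compact_subset_open_imp_ball_epsilon_subset[OF _ open_U] by metis
  have \<delta>2': "\<zeta> \<in> U" if "\<bar>s\<bar> \<le> 1" "norm (\<xi> + s *\<^sub>R outer A n - \<zeta>) < \<delta>2" for s \<zeta>
  proof -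
    have "s \<in> {-1..1}" "\<zeta> \<in> ball (\<xi> + s *\<^sub>R outer A n) \<delta>2" using that by (auto simp: abs_le_iff dist_norm)
    then show ?thesis using \<delta>2(2) by blast
  qed
  \<comment> \<open>Halving leaves room for two errors: the distance of \<open>G y\<close> from
    \<xi> and the deviation of \<open>jac \<psi>\<close> from the pure rank-one oscillation.\<close>
  define \<delta> where "\<delta> = min (min \<delta>1 \<delta>2 / 2) 1"
  have \<delta>: "\<delta> > 0" "2 * \<delta> \<le> \<delta>1" "2 * \<delta> \<le> \<delta>2" using \<delta>1 \<delta>2 by (auto simp: \<delta>_def)
  \<comment> \<open>The bounds 1 and \<open>e / 4\<close> yield twice the square of
    \<open>e'\<close> at most \<open>e / 2\<close>, the other half of the error in the length
    estimate.\<close>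
  define e' where "e' = min (min e \<delta>) (min 1 (e / 4))"
  have e': "e' > 0" "e' \<le> e" "e' \<le> \<delta>" "e' \<le> 1" "e' \<le> e / 4" using e \<delta> by (auto simp: e'_def)
  show thesis
  proof (rule that[OF \<delta>(1)])
    fix c d :: "real^'n" and G
    assume box: "box c d \<noteq> {}" and G: "\<And>y. y \<in> cbox c d \<Longrightarrow> G y \<in> U \<and> norm (G y - \<xi>) < \<delta>"
    obtain \<psi> :: "real^'n \<Rightarrow> real^'m" and s where *:
      "\<And>k. Ck k \<psi>" "\<And>x. x \<notin> box c d \<Longrightarrow> \<psi> x = 0" "\<And>x. x \<notin> box c d \<Longrightarrow> s x = 0"
      "\<And>x. x \<notin> box c d \<Longrightarrow> jac \<psi> x = 0"
      "\<And>x. norm (\<psi> x) \<le> e'" "\<And>x. \<bar>s x\<bar> \<le> 1" "continuous_on UNIV s"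
      "\<And>x. norm (jac \<psi> x - s x *\<^sub>R outer A n) \<le> e'"
      "(LINT x|lebesgue. (s x)\<^sup>2) \<ge> measure lebesgue (box c d) / 4"
      by (rule oscillation_on_box[OF box An(1) e'(1), where A=A]) (rule that; assumption)
    have "G y + jac \<psi> y \<in> U \<and> F (G y + jac \<psi> y) \<le> F (G y) + 2 * \<epsilon> - \<kappa> * (s y)\<^sup>2 * F \<xi> \<and>
         (norm (jac \<psi> y))\<^sup>2 \<le> 2 * C * F (G y) + e \<and> F (G y) - \<epsilon> \<le> F \<xi>" if y: "y \<in> cbox c d" for y
    proof -
      have Gy: "G y \<in> U" "norm (G y - \<xi>) < \<delta>" using G[OF y] by auto
      let ?p = "\<xi> + s y *\<^sub>R outer A n"
      have "?p - (G y + jac \<psi> y) = - (G y - \<xi>) - (jac \<psi> y - s y *\<^sub>R outer A n)" by simp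
      then have "norm (?p - (G y + jac \<psi> y)) \<le> norm (G y - \<xi>) + norm (jac \<psi> y - s y *\<^sub>R outer A n)"
        by (metis norm_minus_cancel norm_triangle_ineq4)
      then have near: "norm (?p - (G y + jac \<psi> y)) < 2 * \<delta>"
        using Gy(2) *(8)[of y] e'(3) by linarith
      then have in_U: "G y + jac \<psi> y \<in> U" using \<delta>2'[OF *(6)[of y]] \<delta>(3) by force
      have 1: "\<bar>F ?p - F (G y + jac \<psi> y)\<bar> < \<epsilon>'"
        using \<delta>1(2)[OF An(3)[OF *(6)[of y]] in_U] near \<delta>(2) by force
      have 2: "\<bar>F (G y) - F \<xi>\<bar> < \<epsilon>'" using \<delta>1(2)[OF Gy(1) \<xi>] Gy(2) \<delta>(1,2) by force
      have "\<epsilon>' \<le> \<epsilon>" by (simp add: \<epsilon>'_def)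
      then have 3: "F (G y + jac \<psi> y) \<le> F (G y) + 2 * \<epsilon> - \<kappa> * (s y)\<^sup>2 * F \<xi>" "F (G y) - \<epsilon> \<le> F \<xi>"
        using 1 2 An(4)[OF *(6)[of y]] by linarith+
      have "norm (jac \<psi> y) \<le> norm (jac \<psi> y - s y *\<^sub>R outer A n) + norm (s y *\<^sub>R outer A n)"
        using norm_triangle_ineq[of "jac \<psi> y - s y *\<^sub>R outer A n" "s y *\<^sub>R outer A n"] by simp
      also have "\<dots> \<le> e' + norm (outer A n)"
        using *(8)[of y] *(6)[of y] mult_right_mono[OF *(6)[of y], of "norm (outer A n)"] by simp
      finally have "(norm (jac \<psi> y))\<^sup>2 \<le> (e' + norm (outer A n))\<^sup>2" by (simp add: power_mono)
      \<comment> \<open>Origin of the factor 2 in \<open>2 * C * F (G y)\<close>: the square of a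
        sum is at most twice the sum of the squares.\<close>
      also have "\<dots> \<le> 2 * e'\<^sup>2 + 2 * (norm (outer A n))\<^sup>2"
        using sum_squares_bound[of e' "norm (outer A n)"] by (simp add: power2_sum)
      also have "\<dots> \<le> 2 * (e / 4) + 2 * (C * F \<xi>)"
      proof -
        have "e'\<^sup>2 \<le> e' * 1" unfolding power2_eq_square using e' by (intro mult_left_mono) auto
        then show ?thesis using e' An(2) by simp
      qed
      also have "C * F \<xi> \<le> C * (F (G y) + \<epsilon>')" using 2 C_pos by (intro mult_left_mono) auto
      finally have "(norm (jac \<psi> y))\<^sup>2 \<le> 2 * C * F (G y) + e" using \<epsilon>'e by (simp add: algebra_simps)
      with 3 in_U show ?thesis by blast
    qed
    moreover have "\<forall>x. norm (\<psi> x) \<le> e" using *(5) e'(2) order_trans by blast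
    ultimately show "\<exists>\<psi> :: real^'n \<Rightarrow> real^'m. \<exists>s. (\<forall>k. Ck k \<psi>) \<and> (\<forall>x. x \<notin> box c d \<longrightarrow> \<psi> x = 0 \<and> s x = 0 \<and> jac \<psi> x = 0) \<and>
      (\<forall>x. norm (\<psi> x) \<le> e) \<and> continuous_on UNIV s \<and> (\<forall>x. \<bar>s x\<bar> \<le> 1) \<and>
      (LINT x|lebesgue. (s x)\<^sup>2) \<ge> measure lebesgue (box c d) / 4 \<and>
      (\<forall>y\<in>cbox c d. G y + jac \<psi> y \<in> U \<and> F (G y + jac \<psi> y) \<le> F (G y) + 2 * \<epsilon> - \<kappa> * (s y)\<^sup>2 * F \<xi> \<and>
         (norm (jac \<psi> y))\<^sup>2 \<le> 2 * C * F (G y) + e \<and> F (G y) - \<epsilon> \<le> F \<xi>)"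
      using * by (intro exI[of _ \<psi>] exI[of _ s]) blast
  qed
qed

end

lemma sum_eq_single:
  fixes h :: "'i \<Rightarrow> 'b::comm_monoid_add"
  assumes "finite D" "K \<in> D" "\<And>L. L \<in> D \<Longrightarrow> L \<noteq> K \<Longrightarrow> h L = 0"
  shows "(\<Sum>L\<in>D. h L) = h K"
proof -
  have "(\<Sum>L\<in>D. h L) = h K + (\<Sum>L\<in>D - {K}. h L)" by (rule sum.remove[OF assms(1,2)])
  also have "(\<Sum>L\<in>D - {K}. h L) = 0" by (rule sum.neutral) (use assms(3) in blast)
  finally show ?thesis by simp
qed

context laminate_gap
begin

text \<open>On every box the mean of the squared profile is at least 1/4, and amplitude s lowers the
  gap by \<kappa> times its square times the gap; this gives the factor
  \<open>1 - \<kappa> / 4\<close>. The additive \<open>e\<close> pays for the variation of the gap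
  on the boxes and for the part of \<open>W\<close> left uncovered.\<close>

lemma gap_reduction:
  assumes W: "open W" "bounded W" and G: "continuous_on W G" "\<And>x. x \<in> W \<Longrightarrow> G x \<in> U" and e: "e > 0"
  obtains \<psi> :: "real^'n \<Rightarrow> real^'m" where
    "test_function W \<psi>" "\<And>x. norm (\<psi> x) \<le> e" "\<And>x. x \<in> W \<Longrightarrow> G x + jac \<psi> x \<in> U"
    "\<And>x. x \<in> W \<Longrightarrow> (norm (jac \<psi> x))\<^sup>2 \<le> 2 * C * F (G x) + e"
    "(LINT x|lebesgue_on W. F (G x + jac \<psi> x)) \<le> (1 - \<kappa> / 4) * (LINT x|lebesgue_on W. F (G x)) + e"
proof -
  obtain M where M: "M > 0" "\<And>\<xi>. \<xi> \<in> U \<Longrightarrow> F \<xi> \<le> M" by (rule F_bounded) (rule that)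
  let ?\<mu> = "measure lebesgue"
  have Wm: "W \<in> lmeasurable" using W by (simp add: lmeasurable_open)
  define \<epsilon> where "\<epsilon> = e / (6 * (?\<mu> W + 1))"
  have \<epsilon>: "\<epsilon> > 0" "3 * (\<epsilon> * ?\<mu> W) \<le> e / 2"
  proof -
    have p: "?\<mu> W + 1 > 0" by (simp add: add_nonneg_pos)
    then show "\<epsilon> > 0" using e by (simp add: \<epsilon>_def)
    then have "\<epsilon> * ?\<mu> W \<le> \<epsilon> * (?\<mu> W + 1)" by simp
    also have "\<dots> = e / 6" unfolding \<epsilon>_def using p by (simp add: field_simps)
    finally show "3 * (\<epsilon> * ?\<mu> W) \<le> e / 2" by simp
  qed
  \<comment> \<open>The gap is at most \<open>M\<close>, so the uncovered set costs the remaining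
    \<open>e / 2\<close>.\<close>
  define r where "r = e / (2 * M)"
  have r: "r > 0" "M * r = e / 2" using e M by (auto simp: r_def)
  \<comment> \<open>The conclusion of \<open>box_perturbation\<close> as one predicate, so that
    radii can be chosen for all points of \<open>W\<close> and then perturbations for all
    boxes.\<close>
  define P where "P \<xi> c d G \<psi> s \<longleftrightarrow> (\<forall>k. Ck k \<psi>) \<and> (\<forall>x. x \<notin> box c d \<longrightarrow> \<psi> x = 0 \<and> s x = 0 \<and> jac \<psi> x = 0) \<and>
      (\<forall>x. norm (\<psi> x) \<le> e) \<and> continuous_on UNIV s \<and> (\<forall>x. \<bar>s x\<bar> \<le> 1) \<and>
      (LINT x|lebesgue. (s x)\<^sup>2) \<ge> ?\<mu> (box c d) / 4 \<and>
      (\<forall>y\<in>cbox c d. G y + jac \<psi> y \<in> U \<and> F (G y + jac \<psi> y) \<le> F (G y) + 2 * \<epsilon> - \<kappa> * (s y)\<^sup>2 * F \<xi> \<and>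
         (norm (jac \<psi> y))\<^sup>2 \<le> 2 * C * F (G y) + e \<and> F (G y) - \<epsilon> \<le> F \<xi>)"
    for \<xi> c d G and \<psi> :: "real^'n \<Rightarrow> real^'m" and s
  have "\<exists>\<delta>>0. \<forall>c d. box c d \<noteq> {} \<longrightarrow> (\<forall>y\<in>cbox c d. G y \<in> U \<and> norm (G y - G x) < \<delta>) \<longrightarrow>
      (\<exists>\<psi> s. P (G x) c d G \<psi> s)" if "x \<in> W" for x
    unfolding P_def by (rule box_perturbation[OF G(2)[OF that] e \<epsilon>(1)]) blast
  then obtain \<delta> where \<delta>: "\<And>x. x \<in> W \<Longrightarrow> \<delta> x > 0"
     "\<And>x c d. x \<in> W \<Longrightarrow> box c d \<noteq> {} \<Longrightarrow> (\<And>y. y \<in> cbox c d \<Longrightarrow> G y \<in> U \<and> norm (G y - G x) < \<delta> x) \<Longrightarrow>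
      \<exists>\<psi> s. P (G x) c d G \<psi> s"
    by metis
  define g where "g x = W \<inter> G -` ball (G x) (\<delta> x)" for x
  have gg: "\<forall>x\<in>W. x \<in> g x \<and> open (g x) \<and> g x \<subseteq> W"
    unfolding g_def using \<delta>(1) continuous_open_preimage[OF G(1) W(1)] by auto
  obtain D where D: "finite D" "\<And>K. K \<in> D \<Longrightarrow> \<exists>c d. K = cbox c d \<and> box c d \<noteq> {}"
    "\<And>K. K \<in> D \<Longrightarrow> \<exists>x\<in>W. K \<subseteq> g x"
    "pairwise (\<lambda>A B. interior A \<inter> interior B = {}) D"
    "?\<mu> (W - \<Union>(interior ` D)) < r"
    by (rule exhaustion_by_disjoint_boxes[OF W gg r(1)]) (rule that; assumption)
  have KW: "K \<subseteq> W" if "K \<in> D" for K using D(3)[OF that] by (auto simp: g_def)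
  have "\<exists>c d x \<psi> s. K = cbox c d \<and> x \<in> W \<and> P (G x) c d G \<psi> s" if K: "K \<in> D" for K
  proof -
    obtain c d where cd: "K = cbox c d" "box c d \<noteq> {}" using D(2)[OF K] by blast
    obtain x where x: "x \<in> W" "K \<subseteq> g x" using D(3)[OF K] by blast
    have "\<exists>\<psi> s. P (G x) c d G \<psi> s"
    proof (rule \<delta>(2)[OF x(1) cd(2)])
      fix y assume "y \<in> cbox c d"
      then have "y \<in> W" "dist (G x) (G y) < \<delta> x" using x(2) cd(1) by (auto simp: g_def)
      then show "G y \<in> U \<and> norm (G y - G x) < \<delta> x" using G(2) by (simp add: dist_norm norm_minus_commute)
    qed
    then show ?thesis using cd(1) x(1) by blast
  qed
  then obtain c d x0 \<psi> s where choice: "\<And>K. K \<in> D \<Longrightarrow> K = cbox (c K) (d K) \<and> x0 K \<in> W \<and> P (G (x0 K)) (c K) (d K) G (\<psi> K) (s K)"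
    by metis
  have int: "interior K = box (c K) (d K)" if "K \<in> D" for K
    using choice[OF that] interior_cbox by metis
  define f where "f K = F (G (x0 K))" for K
  have f: "f K > 0" if "K \<in> D" for K using choice[OF that] G(2) F_pos by (auto simp: f_def)
  have Ck\<psi>: "Ck k (\<psi> K)" if "K \<in> D" for k K using choice[OF that] by (auto simp: P_def)
  have out: "\<psi> K x = 0" "s K x = 0" "jac (\<psi> K) x = 0" if "K \<in> D" "x \<notin> interior K" for K x
    using choice[OF that(1)] that(2) unfolding int[OF that(1)] by (auto simp: P_def)
  have small: "norm (\<psi> K x) \<le> e" if "K \<in> D" for K x using choice[OF that] by (auto simp: P_def)
  have conts: "continuous_on UNIV (s K)" and s1: "\<bar>s K x\<bar> \<le> 1" if "K \<in> D" for K x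
    using choice[OF that] by (auto simp: P_def)
  have s2: "(LINT x|lebesgue. (s K x)\<^sup>2) \<ge> ?\<mu> (interior K) / 4" if "K \<in> D" for K
    using choice[OF that] int[OF that] by (simp add: P_def)
  have inK: "G y + jac (\<psi> K) y \<in> U" "F (G y + jac (\<psi> K) y) \<le> F (G y) + 2 * \<epsilon> - \<kappa> * (s K y)\<^sup>2 * f K"
      "(norm (jac (\<psi> K) y))\<^sup>2 \<le> 2 * C * F (G y) + e" "F (G y) - \<epsilon> \<le> f K" if "K \<in> D" "y \<in> interior K" for K y
  proof -
    have "y \<in> cbox (c K) (d K)" using that interior_subset[of K] choice[OF that(1)] by auto
    then show "G y + jac (\<psi> K) y \<in> U" "F (G y + jac (\<psi> K) y) \<le> F (G y) + 2 * \<epsilon> - \<kappa> * (s K y)\<^sup>2 * f K"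
      "(norm (jac (\<psi> K) y))\<^sup>2 \<le> 2 * C * F (G y) + e" "F (G y) - \<epsilon> \<le> f K"
      using choice[OF that(1)] unfolding P_def f_def by blast+
  qed
  have uniq: "x \<notin> interior L" if "K \<in> D" "L \<in> D" "L \<noteq> K" "x \<in> interior K" for K L x
    using D(4) that unfolding pairwise_def by blast
  define \<Psi> where "\<Psi> x = (\<Sum>K\<in>D. \<psi> K x)" for x
  have J: "jac \<Psi> x = (\<Sum>K\<in>D. jac (\<psi> K) x)" for x
    unfolding \<Psi>_def[abs_def] by (rule jac_sum) (rule Ck\<psi>)
  have in1: "\<Psi> x = \<psi> K x" "jac \<Psi> x = jac (\<psi> K) x" "(\<Sum>K\<in>D. f K * (s K x)\<^sup>2) = f K * (s K x)\<^sup>2"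
     "(\<Sum>K\<in>D. f K * indicator (interior K) x) = f K"
    if "K \<in> D" "x \<in> interior K" for K x
  proof -
    have z: "x \<notin> interior L" if L: "L \<in> D" "L \<noteq> K" for L using uniq[OF \<open>K \<in> D\<close> L \<open>x \<in> interior K\<close>] .
    show "\<Psi> x = \<psi> K x" unfolding \<Psi>_def by (rule sum_eq_single[OF D(1) that(1)]) (use z out in blast)
    show "jac \<Psi> x = jac (\<psi> K) x" unfolding J by (rule sum_eq_single[OF D(1) that(1)]) (use z out in blast)
    show "(\<Sum>K\<in>D. f K * (s K x)\<^sup>2) = f K * (s K x)\<^sup>2" by (rule sum_eq_single[OF D(1) that(1)]) (use z out in simp)
    show "(\<Sum>K\<in>D. f K * indicator (interior K) x) = f K"
      by (subst sum_eq_single[OF D(1) that(1)]) (use z that in simp_all)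
  qed
  have in0: "\<Psi> x = 0" "jac \<Psi> x = 0" "(\<Sum>K\<in>D. f K * (s K x)\<^sup>2) = 0"
      "(\<Sum>K\<in>D. f K * indicator (interior K) x) = 0"
    if "x \<notin> \<Union>(interior ` D)" for x
  proof -
    have z: "x \<notin> interior L" if "L \<in> D" for L using that \<open>x \<notin> \<Union>(interior ` D)\<close> by blast
    show "\<Psi> x = 0" unfolding \<Psi>_def by (rule sum.neutral) (use z out in blast)
    show "jac \<Psi> x = 0" unfolding J by (rule sum.neutral) (use z out in blast)
    show "(\<Sum>K\<in>D. f K * (s K x)\<^sup>2) = 0" by (rule sum.neutral) (use z out in simp)
    show "(\<Sum>K\<in>D. f K * indicator (interior K) x) = 0" by (rule sum.neutral) (use z in simp)
  qed
  have U': "G x + jac \<Psi> x \<in> U" if "x \<in> W" for x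
    using in0(2)[of x] in1(2)[of _ x] inK(1)[of _ x] G(2)[OF that] by (cases "x \<in> \<Union>(interior ` D)") auto
  have Fle: "F (G x + jac \<Psi> x) \<le> F (G x) + 2 * \<epsilon> - \<kappa> * (\<Sum>K\<in>D. f K * (s K x)\<^sup>2)" if "x \<in> W" for x
  proof (cases "x \<in> \<Union>(interior ` D)")
    case True
    then obtain K where "K \<in> D" "x \<in> interior K" by blast
    then show ?thesis using inK(2)[of K x] in1(2,3)[of K x] by (simp add: mult_ac)
  next
    case False
    then show ?thesis using in0(2,3)[of x] \<epsilon>(1) by simp
  qed
  \<comment> \<open>Return from frozen to actual gaps: on a box they differ by at most \<epsilon>,
    and off the boxes the subtracted \<open>M\<close> makes the left side nonpositive.\<close>
  have fge: "F (G x) - \<epsilon> - M * indicator (W - \<Union>(interior ` D)) x \<le> (\<Sum>K\<in>D. f K * indicator (interior K) x)" if "x \<in> W" for x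
  proof (cases "x \<in> \<Union>(interior ` D)")
    case True
    then obtain K where "K \<in> D" "x \<in> interior K" by blast
    then show ?thesis using inK(4)[of K x] in1(4)[of K x] True by simp
  next
    case False
    then show ?thesis using in0(4)[of x] \<epsilon>(1) M(2)[OF G(2)[OF that]] that by simp
  qed
  show thesis
  proof (rule that[of \<Psi>])
    show "test_function W \<Psi>" unfolding test_function_def
    proof (intro conjI allI)
      show "Ck k \<Psi>" for k unfolding \<Psi>_def[abs_def] by (rule Ck_sum) (rule Ck\<psi>)
      have "{x. \<Psi> x \<noteq> 0} \<subseteq> \<Union>D" using in0(1) interior_subset by blast
      moreover have UD: "compact (\<Union>D)"
        using D(1,2) by (intro compact_Union) (auto, metis compact_cbox)
      ultimately have cl: "closure {x. \<Psi> x \<noteq> 0} \<subseteq> \<Union>D"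
        by (simp add: closure_minimal compact_imp_closed)
      then show "closure {x. \<Psi> x \<noteq> 0} \<subseteq> W" using KW by blast
      show "compact (closure {x. \<Psi> x \<noteq> 0})"
        using cl UD by (meson bounded_subset closed_closure compact_eq_bounded_closed)
    qed
    show "norm (\<Psi> x) \<le> e" for x
      using in0(1)[of x] in1(1)[of _ x] small[of _ x] e by (cases "x \<in> \<Union>(interior ` D)") auto
    show "G x + jac \<Psi> x \<in> U" if "x \<in> W" for x by (rule U'[OF that])
    show "(norm (jac \<Psi> x))\<^sup>2 \<le> 2 * C * F (G x) + e" if "x \<in> W" for x
      using in0(2)[of x] in1(2)[of _ x] inK(3)[of _ x] e C_pos F_pos[OF G(2)[OF that]]
      by (cases "x \<in> \<Union>(interior ` D)") auto
    have Ck\<Psi>: "Ck k \<Psi>" for k unfolding \<Psi>_def[abs_def] by (rule Ck_sum) (rule Ck\<psi>)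
    have iF: "integrable (lebesgue_on W) (\<lambda>x. F (H x))" if H: "continuous_on W H" "\<And>x. x \<in> W \<Longrightarrow> H x \<in> U" for H
    proof (rule bounded_continuous_integrable[OF W, of _ M])
      show "continuous_on W (\<lambda>x. F (H x))"
        by (rule continuous_on_compose2[OF cont_F H(1)]) simp
      show "norm (F (H x)) \<le> M" if "x \<in> W" for x
        using M(2)[OF H(2)[OF that]] F_pos[OF H(2)[OF that]] by simp
    qed
    have i1: "integrable (lebesgue_on W) (\<lambda>x. F (G x + jac \<Psi> x))"
      using U' by (intro iF continuous_intros G(1) continuous_on_subset[OF jac_continuous[OF Ck\<Psi>]]) auto
    have i2: "integrable (lebesgue_on W) (\<lambda>x. F (G x))" by (rule iF[OF G]) 
    have sint: "integrable lebesgue (\<lambda>x. (s K x)\<^sup>2)" "integrable (lebesgue_on W) (\<lambda>x. (s K x)\<^sup>2)"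
       "(LINT x|lebesgue_on W. (s K x)\<^sup>2) \<ge> ?\<mu> (interior K) / 4" if K: "K \<in> D" for K
    proof -
      obtain a b where ab: "K = cbox a b" using D(2)[OF K] by blast
      have z: "s K x = 0" if "x \<notin> W" for x using out(2)[OF K] that KW[OF K] interior_subset[of K] by blast
      show i: "integrable lebesgue (\<lambda>x. (s K x)\<^sup>2)"
        by (rule continuous_compact_support_integrable[of _ K])
          (use conts[OF K] ab out(2)[OF K] interior_subset[of K] in \<open>auto intro!: continuous_intros\<close>)
      have eq: "(\<lambda>x. if x \<in> W then (s K x)\<^sup>2 else 0) = (\<lambda>x. (s K x)\<^sup>2)" using z by auto
      show "integrable (lebesgue_on W) (\<lambda>x. (s K x)\<^sup>2)"
        using i Lebesgue_Measure.integrable_restrict_UNIV[OF fmeasurableD[OF Wm], of "\<lambda>x. (s K x)\<^sup>2"] unfolding eq by simp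
      show "(LINT x|lebesgue_on W. (s K x)\<^sup>2) \<ge> ?\<mu> (interior K) / 4"
        using s2[OF K] Lebesgue_Measure.integral_restrict_UNIV[OF fmeasurableD[OF Wm], of "\<lambda>x. (s K x)\<^sup>2"] unfolding eq by simp
    qed
    interpret fW: finite_measure "lebesgue_on W" by (rule finite_measure_lebesgue_on[OF Wm])
    have mW: "measure (lebesgue_on W) S = ?\<mu> S" if "S \<subseteq> W" "S \<in> sets lebesgue" for S
      using that Wm by (simp add: measure_restrict_space)
    have spW: "measure (lebesgue_on W) W = ?\<mu> W" using mW[of W] Wm by auto
    have iI: "integrable (lebesgue_on W) (\<lambda>x. indicator S x :: real)" "(LINT x|lebesgue_on W. indicator S x) = ?\<mu> S"
      if "S \<subseteq> W" "S \<in> sets lebesgue" for S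
    proof -
      have "S \<in> sets (lebesgue_on W)" using that Wm by (simp add: sets_restrict_space_iff)
      then show "integrable (lebesgue_on W) (\<lambda>x. indicator S x :: real)" "(LINT x|lebesgue_on W. indicator S x) = ?\<mu> S"
        using mW[OF that] by (auto intro!: fW.integrable_const_bound[of _ 1] simp: Int_absorb2 sets.sets_into_space that(1))
    qed
    have intW: "interior K \<subseteq> W" "interior K \<in> sets lebesgue" if "K \<in> D" for K
      using KW[OF that] interior_subset[of K] by auto
    have rest: "W - \<Union>(interior ` D) \<subseteq> W" "W - \<Union>(interior ` D) \<in> sets lebesgue"
      using Wm D(1) by (auto intro!: sets.Diff sets.finite_UN)
    let ?I = "LINT x|lebesgue_on W. F (G x)"
    let ?S = "\<Sum>K\<in>D. f K * (LINT x|lebesgue_on W. (s K x)\<^sup>2)"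
    have "(LINT x|lebesgue_on W. F (G x + jac \<Psi> x)) \<le> (LINT x|lebesgue_on W. F (G x) + 2 * \<epsilon> - \<kappa> * (\<Sum>K\<in>D. f K * (s K x)\<^sup>2))"
      using i1 i2 sint(2) Fle
      by (intro integral_mono) (auto intro!: Bochner_Integration.integrable_diff Bochner_Integration.integrable_add integrable_mult_right Bochner_Integration.integrable_sum)
    also have "\<dots> = ?I + 2 * \<epsilon> * ?\<mu> W - \<kappa> * ?S"
      using i2 sint(2) by (simp add: spW Bochner_Integration.integral_sum integral_mult_right)
    finally have 1: "(LINT x|lebesgue_on W. F (G x + jac \<Psi> x)) \<le> ?I + 2 * \<epsilon> * ?\<mu> W - \<kappa> * ?S" .
    have "(LINT x|lebesgue_on W. F (G x) - \<epsilon> - M * indicator (W - \<Union>(interior ` D)) x) \<le> (LINT x|lebesgue_on W. (\<Sum>K\<in>D. f K * indicator (interior K) x))"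
      using i2 iI(1)[OF rest] iI(1)[OF intW] fge
      by (intro integral_mono) (auto intro!: Bochner_Integration.integrable_diff integrable_mult_right Bochner_Integration.integrable_sum)
    moreover have "(LINT x|lebesgue_on W. F (G x) - \<epsilon> - M * indicator (W - \<Union>(interior ` D)) x) = ?I - \<epsilon> * ?\<mu> W - M * ?\<mu> (W - \<Union>(interior ` D))"
      using i2 iI[OF rest] spW
      by (subst Bochner_Integration.integral_diff) (auto intro!: Bochner_Integration.integrable_diff integrable_mult_right)
    moreover have "(LINT x|lebesgue_on W. (\<Sum>K\<in>D. f K * indicator (interior K) x)) = (\<Sum>K\<in>D. f K * ?\<mu> (interior K))"
      using iI[OF intW] by (subst Bochner_Integration.integral_sum) (auto intro!: integrable_mult_right sum.cong)
    moreover have "M * ?\<mu> (W - \<Union>(interior ` D)) \<le> e / 2"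
      unfolding r(2)[symmetric] using D(5) M(1) by (intro mult_left_mono) auto
    ultimately have 2: "?I - \<epsilon> * ?\<mu> W - e / 2 \<le> (\<Sum>K\<in>D. f K * ?\<mu> (interior K))" by linarith
    also have "\<dots> \<le> 4 * ?S"
      unfolding sum_distrib_left
    proof (rule sum_mono)
      fix K assume K: "K \<in> D"
      have "f K * ?\<mu> (interior K) \<le> f K * (4 * (LINT x|lebesgue_on W. (s K x)\<^sup>2))"
        using sint(3)[OF K] f[OF K] by (intro mult_left_mono) auto
      then show "f K * ?\<mu> (interior K) \<le> 4 * (f K * (LINT x|lebesgue_on W. (s K x)\<^sup>2))" by simp
    qed
    finally have "\<kappa> * ((?I - \<epsilon> * ?\<mu> W - e / 2) / 4) \<le> \<kappa> * ?S"
      using \<kappa> by (intro mult_left_mono) auto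
    then have 3: "- (\<kappa> * ?S) \<le> - (\<kappa> / 4) * ?I + (\<kappa> / 4) * (\<epsilon> * ?\<mu> W + e / 2)" by (simp add: algebra_simps)
    have "(\<kappa> / 4) * (\<epsilon> * ?\<mu> W + e / 2) \<le> 1 * (\<epsilon> * ?\<mu> W + e / 2)"
      using \<kappa> \<epsilon> e by (intro mult_right_mono) auto
    then show "(LINT x|lebesgue_on W. F (G x + jac \<Psi> x)) \<le> (1 - \<kappa> / 4) * ?I + e"
      using 1 3 \<epsilon>(2) by (simp add: algebra_simps)
  qed
qed

end

section \<open>Weak gradients\<close>

lemma continuous_on_zero_extension:
  fixes h :: "'a::t2_space \<Rightarrow> 'b::{topological_space, zero}"
  assumes "open V" "continuous_on V h" "compact K" "K \<subseteq> V" "\<And>x. x \<in> V - K \<Longrightarrow> h x = 0"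
  shows "continuous_on UNIV (\<lambda>x. if x \<in> V then h x else 0)"
proof -
  have "continuous_on V (\<lambda>x. if x \<in> V then h x else 0)"
    using assms(2) by (simp cong: continuous_on_cong)
  moreover have "continuous_on (- K) (\<lambda>x. if x \<in> V then h x else 0)"
    by (rule continuous_on_eq[of _ "\<lambda>_. 0"]) (use assms(5) in auto)
  ultimately have "continuous_on (V \<union> - K) (\<lambda>x. if x \<in> V then h x else 0)"
    using assms(1,3) by (intro continuous_on_open_Un) (auto simp: compact_imp_closed open_Compl)
  moreover have "V \<union> - K = UNIV" using assms(4) by blast
  ultimately show ?thesis by simp
qed

lemma frechet_derivative_outside:
  assumes "closed K" "\<And>x. x \<notin> K \<Longrightarrow> f x = 0" "x \<notin> K"
  shows "(f has_derivative (\<lambda>_. 0)) (at x)" "frechet_derivative f (at x) = (\<lambda>_. 0)"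
proof -
  have "((\<lambda>_. 0) has_derivative (\<lambda>_. 0)) (at x)" by simp
  then show D: "(f has_derivative (\<lambda>_. 0)) (at x)"
    by (rule has_derivative_transform_within_open[OF _ open_Compl[OF assms(1)]]) (use assms in auto)
  then show "frechet_derivative f (at x) = (\<lambda>_. 0)" by (rule frechet_derivative_eqI)
qed

lemma jac_outside:
  assumes "closed K" "\<And>x. x \<notin> K \<Longrightarrow> f x = 0" "x \<notin> K"
  shows "jac f x = 0"
  using frechet_derivative_outside(2)[of K f x] assms by (simp add: jac_def matrix_def vec_eq_iff)

text \<open>The product of a component of \<open>f\<close> with \<open>\<zeta>\<close>, extended by
  zero, is differentiable on the whole space, because \<open>\<zeta>\<close> vanishes near every
  point off its compact support; its partial derivatives therefore have integral 0. The extension is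
  by cases since \<open>f\<close> is arbitrary outside \<open>V\<close>.\<close>

lemma integration_by_parts:
  fixes f :: "real^'n \<Rightarrow> real^'m" and \<zeta> :: "real^'n \<Rightarrow> real"
  assumes V: "open V" and f: "\<And>x. x \<in> V \<Longrightarrow> f differentiable (at x)" "continuous_on V (jac f)"
    and \<zeta>: "test_function V \<zeta>"
  shows "(LINT x:V|lebesgue. f x $ i * frechet_derivative \<zeta> (at x) (axis j 1))
       = - (LINT x:V|lebesgue. jac f x $ i $ j * \<zeta> x)"
proof -
  define K where "K = closure {x. \<zeta> x \<noteq> 0}"
  have K: "compact K" "K \<subseteq> V" using \<zeta> by (auto simp: test_function_def K_def)
  have \<zeta>0: "\<zeta> x = 0" if "x \<notin> K" for x
    using that closure_subset[of "{x. \<zeta> x \<noteq> 0}"] by (auto simp: K_def)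
  have Ck\<zeta>: "Ck k \<zeta>" for k using \<zeta> by (simp add: test_function_def)
  have clK: "closed K" using K by (simp add: compact_imp_closed)
  define \<zeta>' where "\<zeta>' x = frechet_derivative \<zeta> (at x)" for x
  have D\<zeta>: "(\<zeta> has_derivative \<zeta>' x) (at x)" for x unfolding \<zeta>'_def by (rule Ck_has_derivative[OF Ck\<zeta>])
  have \<zeta>'0: "\<zeta>' x = (\<lambda>_. 0)" if "x \<notin> K" for x
    unfolding \<zeta>'_def by (rule frechet_derivative_outside(2)[OF clK \<zeta>0 that])
  have cont\<zeta>': "continuous_on UNIV (\<lambda>x. \<zeta>' x (axis j 1))"
    unfolding \<zeta>'_def by (rule Ck_1_continuous[OF Ck\<zeta>]) (simp add: axis_in_Basis_iff)
  have cont\<zeta>: "continuous_on UNIV \<zeta>" using Ck\<zeta>[of 0] by simp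
  have contf: "continuous_on V f"
    using f(1) by (intro differentiable_imp_continuous_on) (auto simp: differentiable_on_def intro: differentiable_at_withinI)
  define f' where "f' x = frechet_derivative f (at x)" for x
  have Df: "(f has_derivative f' x) (at x)" if "x \<in> V" for x
    using f(1)[OF that] by (simp add: f'_def frechet_derivative_works[symmetric])
  have jacf: "jac f x $ i $ j = f' x (axis j 1) $ i" for x by (simp add: jac_def f'_def matrix_def)
  define P where "P x = (if x \<in> V then f x $ i * \<zeta>' x (axis j 1) else 0)" for x
  define Q where "Q x = (if x \<in> V then jac f x $ i $ j * \<zeta> x else 0)" for x
  have cP: "continuous_on UNIV P" unfolding P_def
    by (rule continuous_on_zero_extension[OF V _ K])
      (use \<zeta>'0 in \<open>auto intro!: continuous_intros contf continuous_on_subset[OF cont\<zeta>']\<close>)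
  have cQ: "continuous_on UNIV Q" unfolding Q_def
    by (rule continuous_on_zero_extension[OF V _ K])
      (use \<zeta>0 in \<open>auto intro!: continuous_intros f(2) continuous_on_subset[OF cont\<zeta>]\<close>)
  have P0: "P x = 0" and Q0: "Q x = 0" if "x \<notin> K" for x using \<zeta>0[OF that] \<zeta>'0[OF that] by (auto simp: P_def Q_def)
  define F' where "F' x h = (if x \<in> V then f x $ i * \<zeta>' x h + f' x h $ i * \<zeta> x else 0)" for x h
  have F'PQ: "F' x (axis j 1) = P x + Q x" for x by (simp add: F'_def P_def Q_def jacf)
  have DF: "((\<lambda>x. if x \<in> V then f x $ i * \<zeta> x else 0) has_derivative F' x) (at x)" for x
  proof (cases "x \<in> V")
    case True
    have "((\<lambda>x. f x $ i) has_derivative (\<lambda>h. f' x h $ i)) (at x)"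
      by (rule bounded_linear.has_derivative[OF bounded_linear_vec_nth Df[OF True]])
    from has_derivative_mult[OF this D\<zeta>]
    have "((\<lambda>x. f x $ i * \<zeta> x) has_derivative F' x) (at x)"
      using True by (simp add: F'_def[abs_def])
    then show ?thesis
      by (rule has_derivative_transform_within_open[OF _ V True]) simp
  next
    case False
    have "x \<notin> K" using False K by blast
    have "((\<lambda>x. if x \<in> V then f x $ i * \<zeta> x else 0) has_derivative (\<lambda>_. 0)) (at x)"
      by (rule frechet_derivative_outside(1)[OF clK _ \<open>x \<notin> K\<close>]) (use \<zeta>0 in simp)
    then show ?thesis using False by (simp add: F'_def[abs_def])
  qed
  obtain B where B: "\<And>x. norm (P x + Q x) \<le> B"
    by (rule continuous_compact_support_bounded[OF continuous_on_add[OF cP cQ] K(1)]) (use P0 Q0 in auto)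
  have "(LINT x|lebesgue. F' x (axis j 1)) = 0"
    by (rule integral_directional_derivative_eq_0[OF DF _ K(1)]) (use B F'PQ \<zeta>0 in auto)
  moreover have iP: "integrable lebesgue P" "integrable lebesgue Q"
    by (rule continuous_compact_support_integrable[OF _ K(1)]; use cP cQ P0 Q0 in auto)+
  ultimately have "(LINT x|lebesgue. P x) + (LINT x|lebesgue. Q x) = 0" unfolding F'PQ by simp
  moreover have "(LINT x:V|lebesgue. f x $ i * frechet_derivative \<zeta> (at x) (axis j 1)) = (LINT x|lebesgue. P x)"
    unfolding set_lebesgue_integral_def by (rule Bochner_Integration.integral_cong) (auto simp: P_def \<zeta>'_def)
  moreover have "(LINT x:V|lebesgue. jac f x $ i $ j * \<zeta> x) = (LINT x|lebesgue. Q x)"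
    unfolding set_lebesgue_integral_def by (rule Bochner_Integration.integral_cong) (auto simp: Q_def)
  ultimately show ?thesis by linarith
qed

text \<open>Here \<open>l\<close> will be the identity or the projection to an entry, and
  \<open>k\<close> a test function or one of its partial derivatives; compact support turns local
  into global integrability.\<close>

lemma loc_integrable_mult_integrable:
  fixes f :: "'a::euclidean_space \<Rightarrow> 'b::euclidean_space" and l :: "'b \<Rightarrow> real"
  assumes f: "loc_integrable \<Omega> f" and l: "bounded_linear l" and k: "continuous_on UNIV k" "compact K" "K \<subseteq> \<Omega>" "\<And>x. x \<notin> K \<Longrightarrow> k x = (0::real)"
  shows "set_integrable lebesgue \<Omega> (\<lambda>x. l (f x) * k x)"
proof -
  have "set_integrable lebesgue K f" using f k by (auto simp: loc_integrable_def)
  then have 1: "integrable lebesgue (\<lambda>x. l (indicator K x *\<^sub>R f x))"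
    unfolding set_integrable_def by (rule integrable_bounded_linear[OF l])
  obtain B where B: "\<And>x. norm (k x) \<le> B" by (rule continuous_compact_support_bounded[OF k(1,2,4)]) (assumption, rule that)
  have km: "k \<in> borel_measurable lebesgue"
    using k(1) by (simp add: borel_measurable_continuous_onI measurable_completion)
  have "integrable lebesgue (\<lambda>x. l (indicator K x *\<^sub>R f x) * k x)"
  proof (rule Bochner_Integration.integrable_bound)
    show "integrable lebesgue (\<lambda>x. B * l (indicator K x *\<^sub>R f x))" using 1 by simp
    show "(\<lambda>x. l (indicator K x *\<^sub>R f x) * k x) \<in> borel_measurable lebesgue"
      using 1 km by (intro borel_measurable_times) auto
    show "AE x in lebesgue. norm (l (indicator K x *\<^sub>R f x) * k x) \<le> norm (B * l (indicator K x *\<^sub>R f x))"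
    proof (rule AE_I2)
      fix x
      have "\<bar>k x\<bar> \<le> \<bar>B\<bar>" using B[of x] by simp
      then show "norm (l (indicator K x *\<^sub>R f x) * k x) \<le> norm (B * l (indicator K x *\<^sub>R f x))"
        using mult_right_mono[of "\<bar>k x\<bar>" "\<bar>B\<bar>" "\<bar>l (indicator K x *\<^sub>R f x)\<bar>"] by (simp add: abs_mult mult.commute)
    qed
  qed
  also have "(\<lambda>x. l (indicator K x *\<^sub>R f x) * k x) = (\<lambda>x. indicator \<Omega> x *\<^sub>R (l (f x) * k x))"
    using k(3,4) by (auto simp: indicator_def fun_eq_iff bounded_linear.linear[OF l] linear_0)
  finally show ?thesis by (simp add: set_integrable_def)
qed

lemma test_function_support:
  fixes \<zeta> :: "real^'n \<Rightarrow> real"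
  assumes "test_function \<Omega> \<zeta>"
  obtains K where "compact K" "K \<subseteq> \<Omega>" "\<And>x. x \<notin> K \<Longrightarrow> \<zeta> x = 0"
    "\<And>x. x \<notin> K \<Longrightarrow> frechet_derivative \<zeta> (at x) = (\<lambda>_. 0)" "continuous_on UNIV \<zeta>"
    "\<And>j. continuous_on UNIV (\<lambda>x. frechet_derivative \<zeta> (at x) (axis j 1))"
proof (rule that[of "closure {x. \<zeta> x \<noteq> 0}"])
  let ?K = "closure {x. \<zeta> x \<noteq> 0}"
  have Ck: "Ck k \<zeta>" for k using assms by (simp add: test_function_def)
  show K: "compact ?K" "?K \<subseteq> \<Omega>" using assms by (auto simp: test_function_def)
  show z: "\<zeta> x = 0" if "x \<notin> ?K" for x
    using that closure_subset[of "{x. \<zeta> x \<noteq> 0}"] by auto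
  show "frechet_derivative \<zeta> (at x) = (\<lambda>_. 0)" if "x \<notin> ?K" for x
    by (rule frechet_derivative_outside(2)[OF closed_closure z that])
  show "continuous_on UNIV \<zeta>" using Ck[of 0] by simp
  show "continuous_on UNIV (\<lambda>x. frechet_derivative \<zeta> (at x) (axis j 1))" for j
    by (rule Ck_1_continuous[OF Ck]) (simp add: axis_in_Basis_iff)
qed

text \<open>Nonintegrable functions have integral 0 by convention, so splitting the integral of a
  sum, as in the addition of weak gradients, requires this first.\<close>

lemma weak_gradient_integrable:
  assumes "weak_gradient \<Omega> u G" "test_function \<Omega> \<zeta>"
  shows "set_integrable lebesgue \<Omega> (\<lambda>x. u x $ i * frechet_derivative \<zeta> (at x) (axis j 1))"
    "set_integrable lebesgue \<Omega> (\<lambda>x. G x $ i $ j * \<zeta> x)"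
proof -
  obtain K where K: "compact K" "K \<subseteq> \<Omega>" "\<And>x. x \<notin> K \<Longrightarrow> \<zeta> x = 0"
    "\<And>x. x \<notin> K \<Longrightarrow> frechet_derivative \<zeta> (at x) = (\<lambda>_. 0)" "continuous_on UNIV \<zeta>"
    "\<And>j. continuous_on UNIV (\<lambda>x. frechet_derivative \<zeta> (at x) (axis j 1))"
    by (rule test_function_support[OF assms(2)]) (rule that; assumption)
  have u: "loc_integrable \<Omega> u" "loc_integrable \<Omega> G" using assms(1) by (auto simp: weak_gradient_def)
  show "set_integrable lebesgue \<Omega> (\<lambda>x. u x $ i * frechet_derivative \<zeta> (at x) (axis j 1))"
    by (rule loc_integrable_mult_integrable[OF u(1) bounded_linear_vec_nth K(6,1,2)]) (use K(4) in simp)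
  show "set_integrable lebesgue \<Omega> (\<lambda>x. G x $ i $ j * \<zeta> x)"
    by (rule loc_integrable_mult_integrable[OF u(2) _ K(5,1,2,3)])
      (rule bounded_linear_compose[OF bounded_linear_vec_nth bounded_linear_vec_nth])
qed

lemma weak_gradient_add:
  assumes u: "weak_gradient \<Omega> u G" and v: "weak_gradient \<Omega> v H"
  shows "weak_gradient \<Omega> (\<lambda>x. u x + v x) (\<lambda>x. G x + H x)"
  unfolding weak_gradient_def
proof (intro conjI allI impI)
  show "loc_integrable \<Omega> (\<lambda>x. u x + v x)" "loc_integrable \<Omega> (\<lambda>x. G x + H x)"
    using u v unfolding weak_gradient_def loc_integrable_def by (auto intro: set_integral_add(1))
  fix \<zeta> i j assume \<zeta>: "test_function \<Omega> (\<zeta> :: real^'a \<Rightarrow> real)"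
  note iu = weak_gradient_integrable[OF u \<zeta>, of i j] and iv = weak_gradient_integrable[OF v \<zeta>, of i j]
  have "(LINT x:\<Omega>|lebesgue. (u x + v x) $ i * frechet_derivative \<zeta> (at x) (axis j 1))
      = (LINT x:\<Omega>|lebesgue. u x $ i * frechet_derivative \<zeta> (at x) (axis j 1)) + (LINT x:\<Omega>|lebesgue. v x $ i * frechet_derivative \<zeta> (at x) (axis j 1))"
    using set_integral_add(2)[OF iu(1) iv(1)] by (simp add: algebra_simps)
  moreover have "(LINT x:\<Omega>|lebesgue. (G x + H x) $ i $ j * \<zeta> x)
      = (LINT x:\<Omega>|lebesgue. G x $ i $ j * \<zeta> x) + (LINT x:\<Omega>|lebesgue. H x $ i $ j * \<zeta> x)"
    using set_integral_add(2)[OF iu(2) iv(2)] by (simp add: algebra_simps)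
  ultimately show "(LINT x:\<Omega>|lebesgue. (u x + v x) $ i * frechet_derivative \<zeta> (at x) (axis j 1))
      = - (LINT x:\<Omega>|lebesgue. (G x + H x) $ i $ j * \<zeta> x)"
    using u v \<zeta> by (simp add: weak_gradient_def)
qed

text \<open>The cutoffs are test functions converging boundedly to the indicator of a box, so
  \<open>h\<close> has integral 0 over every closed box in \<open>V\<close>. Differentiation of
  integrals then gives \<open>h = 0\<close> almost everywhere on each box, and countably many boxes
  exhaust \<open>V\<close>.\<close>

lemma fundamental_lemma_calculus_of_variations:
  fixes h :: "real^'n \<Rightarrow> real"
  assumes V: "open V" and h: "loc_integrable V h"
    and zero: "\<And>\<zeta>. test_function V \<zeta> \<Longrightarrow> (LINT x:V|lebesgue. h x * \<zeta> x) = 0"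
  shows "AE x in lebesgue. x \<in> V \<longrightarrow> h x = 0"
proof -
  have box0: "(LINT x:cbox a b|lebesgue. h x) = 0" if ab: "cbox a b \<subseteq> V" for a b
  proof -
    have ih: "integrable lebesgue (\<lambda>x. indicator (cbox a b) x *\<^sub>R h x)"
      using h ab unfolding loc_integrable_def set_integrable_def by auto
    have out: "bump a b k x = 0" if "x \<notin> cbox a b" for k x
      using bump_outside[of x a b k] that box_subset_cbox[of a b] by auto
    have z: "(LINT x|lebesgue. bump a b k x * (indicator (cbox a b) x *\<^sub>R h x)) = 0" for k
    proof -
      have "closure {x. bump a b k x \<noteq> 0} \<subseteq> cbox a b"
        using out by (intro closure_minimal) auto
      moreover from this have "compact (closure {x. bump a b k x \<noteq> 0})"
        by (meson bounded_cbox bounded_subset closed_closure compact_eq_bounded_closed)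
      ultimately have "test_function V (bump a b k)"
        unfolding test_function_def using ab by (intro conjI allI Ck_bump) auto
      from zero[OF this] have "(LINT x:V|lebesgue. h x * bump a b k x) = 0" .
      also have "(LINT x:V|lebesgue. h x * bump a b k x) = (LINT x|lebesgue. bump a b k x * (indicator (cbox a b) x *\<^sub>R h x))"
        unfolding set_lebesgue_integral_def
        by (rule Bochner_Integration.integral_cong) (use out ab in \<open>auto simp: indicator_def\<close>)
      finally show ?thesis .
    qed
    have km: "bump a b k \<in> borel_measurable lebesgue" for k
      using Ck_bump[of 0 a b k] by (simp add: borel_measurable_continuous_onI measurable_completion)
    have "(\<lambda>k. LINT x|lebesgue. bump a b k x * (indicator (cbox a b) x *\<^sub>R h x)) \<longlonglongrightarrow> (LINT x|lebesgue. indicator (box a b) x * (indicator (cbox a b) x *\<^sub>R h x))"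
    proof (rule integral_dominated_convergence)
      show "integrable lebesgue (\<lambda>x. norm (indicator (cbox a b) x *\<^sub>R h x))" using ih by (rule integrable_norm)
      show "(\<lambda>x. indicator (box a b) x * (indicator (cbox a b) x *\<^sub>R h x)) \<in> borel_measurable lebesgue"
        using ih by (intro borel_measurable_times borel_measurable_indicator) auto
      show "(\<lambda>x. bump a b k x * (indicator (cbox a b) x *\<^sub>R h x)) \<in> borel_measurable lebesgue" for k
        using ih km by (intro borel_measurable_times) auto
      show "AE x in lebesgue. (\<lambda>k. bump a b k x * (indicator (cbox a b) x *\<^sub>R h x)) \<longlonglongrightarrow> indicator (box a b) x * (indicator (cbox a b) x *\<^sub>R h x)"
        by (intro AE_I2 tendsto_mult bump_tendsto_indicator tendsto_const)
      show "AE x in lebesgue. norm (bump a b k x * (indicator (cbox a b) x *\<^sub>R h x)) \<le> norm (indicator (cbox a b) x *\<^sub>R h x)" for k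
      proof (rule AE_I2)
        fix x
        have "\<bar>bump a b k x\<bar> \<le> 1" using bump_bounds[of a b k x] by simp
        then show "norm (bump a b k x * (indicator (cbox a b) x *\<^sub>R h x)) \<le> norm (indicator (cbox a b) x *\<^sub>R h x)"
          using mult_right_mono[of "\<bar>bump a b k x\<bar>" 1 "\<bar>indicator (cbox a b) x *\<^sub>R h x\<bar>"] by (simp add: abs_mult)
      qed
    qed
    then have "(LINT x|lebesgue. indicator (box a b) x * (indicator (cbox a b) x *\<^sub>R h x)) = 0"
      unfolding z by (simp add: LIMSEQ_const_iff)
    moreover have "(LINT x|lebesgue. indicator (box a b) x * (indicator (cbox a b) x *\<^sub>R h x)) = (LINT x:cbox a b|lebesgue. h x)"
      unfolding set_lebesgue_integral_def
    proof (rule integral_cong_AE)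
      show "(\<lambda>x. indicator (box a b) x * (indicator (cbox a b) x *\<^sub>R h x)) \<in> borel_measurable lebesgue"
        using ih by (intro borel_measurable_times borel_measurable_indicator) auto
      show "(\<lambda>x. indicator (cbox a b) x *\<^sub>R h x) \<in> borel_measurable lebesgue" using ih by auto
      have "cbox a b - box a b \<in> null_sets lebesgue"
        using negligible_frontier_interval negligible_iff_null_sets by blast
      then show "AE x in lebesgue. indicator (box a b) x * (indicator (cbox a b) x *\<^sub>R h x) = indicator (cbox a b) x *\<^sub>R h x"
        by (rule AE_I') (auto simp: indicator_def)
    qed
    ultimately show ?thesis by simp
  qed
  have cb: "negligible {x \<in> cbox c d. h x \<noteq> 0}" if cd: "cbox c d \<subseteq> V" for c d
  proof -
    \<comment> \<open>Truncation makes the function globally integrable, and an intersection of two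
      boxes is a box, so its integrals over all boxes vanish.\<close>
    define f where "f x = indicator (cbox c d) x *\<^sub>R h x" for x
    have fi: "integrable lebesgue f"
      using h cd unfolding loc_integrable_def set_integrable_def f_def by auto
    have si: "set_integrable lebesgue (cbox a b) f" for a b
      unfolding set_integrable_def using fi by (intro integrable_mult_indicator) auto
    have f0: "integral (cbox a b) f = 0" for a b
    proof -
      obtain p q where pq: "cbox a b \<inter> cbox c d = cbox p q" using Int_interval by blast
      have "integral (cbox a b) f = (LINT x:cbox a b|lebesgue. f x)"
        using set_lebesgue_integral_eq_integral(2)[OF si] by simp
      also have "\<dots> = (LINT x:cbox p q|lebesgue. h x)"
        unfolding set_lebesgue_integral_def pq[symmetric] f_def
        by (rule Bochner_Integration.integral_cong) (auto simp: indicator_def)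
      also have "\<dots> = 0" using box0[of p q] pq cd by blast
      finally show ?thesis .
    qed
    have fint: "f integrable_on cbox a b" for a b
      by (rule set_lebesgue_integral_eq_integral(1)[OF si])
    \<comment> \<open>Lebesgue differentiation along cubes with corner \<open>x\<close>: outside a
      null set the value of \<open>f\<close> is a limit of averages, all of which are 0.\<close>
    obtain N where N: "negligible N"
       "\<And>x e. \<lbrakk>x \<notin> N; 0 < e\<rbrakk> \<Longrightarrow> \<exists>d>0. \<forall>h. 0 < h \<and> h < d \<longrightarrow>
                         norm(integral (cbox x (x + h *\<^sub>R One)) f /\<^sub>R h ^ DIM(real^'n) - f x) < e"
      using integrable_ccontinuous_explicit[of f, OF fint] by blast
    have "f x = 0" if xN: "x \<notin> N" for x
    proof (rule ccontr)
      assume "f x \<noteq> 0"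
      then obtain d where d: "d > 0" "\<And>h. 0 < h \<Longrightarrow> h < d \<Longrightarrow> norm(integral (cbox x (x + h *\<^sub>R One)) f /\<^sub>R h ^ DIM(real^'n) - f x) < norm (f x)"
        using N(2)[OF xN, of "norm (f x)"] by auto
      from d(2)[of "d / 2"] d(1) show False unfolding f0 by simp
    qed
    moreover have "f x \<noteq> 0" if "x \<in> cbox c d" "h x \<noteq> 0" for x using that by (simp add: f_def)
    ultimately have "{x \<in> cbox c d. h x \<noteq> 0} \<subseteq> N" by blast
    then show ?thesis using N(1) negligible_subset by blast
  qed
  obtain \<D> where \<D>: "countable \<D>" "\<D> \<subseteq> Pow V" "\<And>X. X \<in> \<D> \<Longrightarrow> \<exists>a b. X = cbox a b" "\<Union>\<D> = V"
    using open_countable_Union_open_cbox[OF V] by metis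
  have "negligible (\<Union>((\<lambda>X. {x \<in> X. h x \<noteq> 0}) ` \<D>))"
    using \<D>(1,2,3) cb by (intro negligible_countable_Union) (auto, metis PowD subsetD)
  then have "\<Union>((\<lambda>X. {x \<in> X. h x \<noteq> 0}) ` \<D>) \<in> null_sets lebesgue" by (simp add: negligible_iff_null_sets)
  then show ?thesis by (rule AE_I') (use \<D>(4) in auto)
qed

section \<open>Weak and classical gradient on the pieces\<close>

lemma C1_closure_jac:
  assumes "C1_closure V \<phi>"
  shows "x \<in> V \<Longrightarrow> \<phi> differentiable (at x)" "continuous_on V (jac \<phi>)"
proof -
  obtain g where g: "continuous_on (closure V) g" "\<And>x. x \<in> V \<Longrightarrow> g x = jac \<phi> x"
    using assms by (auto simp: C1_closure_def jac_def)
  show "continuous_on V (jac \<phi>)"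
    by (rule continuous_on_eq[OF continuous_on_subset[OF g(1) closure_subset]]) (rule g(2))
  show "x \<in> V \<Longrightarrow> \<phi> differentiable (at x)" using assms by (simp add: C1_closure_def)
qed

lemma test_function_mono: "test_function V \<zeta> \<Longrightarrow> V \<subseteq> \<Omega> \<Longrightarrow> test_function \<Omega> \<zeta>"
  by (auto simp: test_function_def)

text \<open>A test function on \<open>V\<close> is also one on \<open>\<Omega>\<close>, so both
  gradients satisfy the same integration by parts against it and the fundamental lemma applies to
  their difference. This carries the almost-everywhere hypotheses over to a continuous gradient,
  which the perturbation argument needs.\<close>

lemma weak_gradient_eq_classical:
  fixes \<phi> :: "real^'n \<Rightarrow> real^'m"
  assumes V: "open V" "V \<subseteq> \<Omega>" and C1: "C1_closure V \<phi>" and wg: "weak_gradient \<Omega> \<phi> D\<phi>"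
  shows "AE x in lebesgue. x \<in> V \<longrightarrow> D\<phi> x = jac \<phi> x"
proof -
  note d = C1_closure_jac[OF C1]
  have bl: "bounded_linear (\<lambda>A::real^'n^'m. A $ i $ j)" for i j
    by (rule bounded_linear_compose[OF bounded_linear_vec_nth bounded_linear_vec_nth])
  have "AE x in lebesgue. x \<in> V \<longrightarrow> D\<phi> x $ i $ j - jac \<phi> x $ i $ j = 0" for i j
  proof (rule fundamental_lemma_calculus_of_variations[OF V(1)])
    have 1: "loc_integrable V (\<lambda>x. D\<phi> x $ i $ j)"
      unfolding loc_integrable_def
    proof (intro allI impI)
      fix K assume "compact K \<and> K \<subseteq> V"
      then have "integrable lebesgue (\<lambda>x. indicator K x *\<^sub>R D\<phi> x)"
        using wg V(2) by (auto simp: weak_gradient_def loc_integrable_def set_integrable_def)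
      from integrable_bounded_linear[OF bl this, of i j]
      show "set_integrable lebesgue K (\<lambda>x. D\<phi> x $ i $ j)" by (simp add: set_integrable_def)
    qed
    have 2: "loc_integrable V (\<lambda>x. jac \<phi> x $ i $ j)"
      unfolding loc_integrable_def
    proof (intro allI impI)
      fix K assume K: "compact K \<and> K \<subseteq> V"
      have "integrable lborel (\<lambda>x. indicator K x *\<^sub>R (jac \<phi> x $ i $ j))"
        using K by (intro borel_integrable_compact continuous_intros continuous_on_subset[OF d(2)]) auto
      then show "set_integrable lebesgue K (\<lambda>x. jac \<phi> x $ i $ j)"
        unfolding set_integrable_def by (simp add: integrable_completion borel_measurable_integrable)
    qed
    show "loc_integrable V (\<lambda>x. D\<phi> x $ i $ j - jac \<phi> x $ i $ j)"
      using 1 2 unfolding loc_integrable_def by (auto intro: set_integral_diff(1))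
    fix \<zeta> assume \<zeta>: "test_function V (\<zeta> :: real^'n \<Rightarrow> real)"
    have \<zeta>\<Omega>: "test_function \<Omega> \<zeta>" by (rule test_function_mono[OF \<zeta> V(2)])
    obtain K where K: "compact K" "K \<subseteq> V" "\<And>x. x \<notin> K \<Longrightarrow> \<zeta> x = 0"
      "\<And>x. x \<notin> K \<Longrightarrow> frechet_derivative \<zeta> (at x) = (\<lambda>_. 0)" "continuous_on UNIV \<zeta>"
      by (rule test_function_support[OF \<zeta>]) (rule that; assumption)
    have \<zeta>V: "\<zeta> x = 0" "frechet_derivative \<zeta> (at x) (axis j 1) = 0" if "x \<notin> V" for x
    proof -
      have "x \<notin> K" using that K(2) by blast
      then show "\<zeta> x = 0" "frechet_derivative \<zeta> (at x) (axis j 1) = 0" using K(3,4) by simp_all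
    qed
    have i1: "set_integrable lebesgue V (\<lambda>x. D\<phi> x $ i $ j * \<zeta> x)"
      by (rule loc_integrable_mult_integrable[OF 1 bounded_linear_ident K(5,1,2,3)])
    have i2: "set_integrable lebesgue V (\<lambda>x. jac \<phi> x $ i $ j * \<zeta> x)"
      by (rule loc_integrable_mult_integrable[OF 2 bounded_linear_ident K(5,1,2,3)])
    have "(LINT x:V|lebesgue. D\<phi> x $ i $ j * \<zeta> x) = (LINT x:\<Omega>|lebesgue. D\<phi> x $ i $ j * \<zeta> x)"
      unfolding set_lebesgue_integral_def
      by (rule Bochner_Integration.integral_cong) (use \<zeta>V V in \<open>auto simp: indicator_def\<close>)
    also have "\<dots> = - (LINT x:\<Omega>|lebesgue. \<phi> x $ i * frechet_derivative \<zeta> (at x) (axis j 1))"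
      using wg \<zeta>\<Omega> by (simp add: weak_gradient_def)
    also have "(LINT x:\<Omega>|lebesgue. \<phi> x $ i * frechet_derivative \<zeta> (at x) (axis j 1))
        = (LINT x:V|lebesgue. \<phi> x $ i * frechet_derivative \<zeta> (at x) (axis j 1))"
      unfolding set_lebesgue_integral_def
      by (rule Bochner_Integration.integral_cong) (use \<zeta>V V in \<open>auto simp: indicator_def\<close>)
    also have "\<dots> = - (LINT x:V|lebesgue. jac \<phi> x $ i $ j * \<zeta> x)"
      by (rule integration_by_parts[OF V(1) d \<zeta>])
    finally show "(LINT x:V|lebesgue. (D\<phi> x $ i $ j - jac \<phi> x $ i $ j) * \<zeta> x) = 0"
      using set_integral_diff(2)[OF i1 i2] by (simp add: left_diff_distrib)
  qed
  then have "AE x in lebesgue. \<forall>i j. x \<in> V \<longrightarrow> D\<phi> x $ i $ j - jac \<phi> x $ i $ j = 0"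
    unfolding AE_all_countable by blast
  then show ?thesis by (rule AE_mp) (auto simp: vec_eq_iff)
qed

section \<open>Passing to the limit\<close>

text \<open>Monotone convergence exchanges sum and integral; a series with finite integral is finite
  almost everywhere.\<close>

lemma AE_summable_of_summable_integrals:
  fixes f :: "nat \<Rightarrow> 'a \<Rightarrow> real"
  assumes "\<And>n. integrable M (f n)" "\<And>n x. x \<in> space M \<Longrightarrow> 0 \<le> f n x" "summable (\<lambda>n. LINT x|M. f n x)"
  shows "AE x in M. summable (\<lambda>n. f n x)"
proof -
  have n: "(\<integral>\<^sup>+x. ennreal (f n x) \<partial>M) = ennreal (LINT x|M. f n x)" for n
    by (rule nn_integral_eq_integral[OF assms(1)]) (use assms(2) in auto)
  have "(\<integral>\<^sup>+x. (\<Sum>n. ennreal (f n x)) \<partial>M) = (\<Sum>n. ennreal (LINT x|M. f n x))"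
    unfolding n[symmetric] by (rule nn_integral_suminf) (use assms(1) in measurable)
  also have "\<dots> = ennreal (\<Sum>n. LINT x|M. f n x)"
    by (rule suminf_ennreal2[OF _ assms(3)]) (use assms(2) in \<open>auto intro: integral_nonneg_AE\<close>)
  finally have "(\<integral>\<^sup>+x. (\<Sum>n. ennreal (f n x)) \<partial>M) \<noteq> \<infinity>" by simp
  moreover have "(\<lambda>x. \<Sum>n. ennreal (f n x)) \<in> borel_measurable M" using assms(1) by measurable
  ultimately have "AE x in M. (\<Sum>n. ennreal (f n x)) \<noteq> \<infinity>" by (intro nn_integral_PInf_AE)
  then show ?thesis
  proof (rule AE_mp, intro AE_I2 impI)
    fix x assume "x \<in> space M" "(\<Sum>n. ennreal (f n x)) \<noteq> \<infinity>"
    then show "summable (\<lambda>n. f n x)" using assms(2) by (intro summable_suminf_not_top) auto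
  qed
qed

section \<open>The approximating sequence and its convergence\<close>

lemma test_function_0: "test_function \<Omega> (\<lambda>_. 0)"
  by (simp add: test_function_def Ck_const)

lemma test_function_add:
  assumes "test_function \<Omega> f" "test_function \<Omega> g"
  shows "test_function \<Omega> (\<lambda>x. f x + g x)"
proof -
  let ?A = "closure {x. f x \<noteq> 0}" and ?B = "closure {x. g x \<noteq> 0}"
  have AB: "compact (?A \<union> ?B)" "?A \<union> ?B \<subseteq> \<Omega>"
    using assms by (auto simp: test_function_def compact_Un)
  have "{x. f x + g x \<noteq> 0} \<subseteq> {x. f x \<noteq> 0} \<union> {x. g x \<noteq> 0}" by auto
  then have "{x. f x + g x \<noteq> 0} \<subseteq> ?A \<union> ?B"
    using closure_subset[of "{x. f x \<noteq> 0}"] closure_subset[of "{x. g x \<noteq> 0}"] by blast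
  then have cl: "closure {x. f x + g x \<noteq> 0} \<subseteq> ?A \<union> ?B"
    using AB(1) by (intro closure_minimal compact_imp_closed)
  then have "compact (closure {x. f x + g x \<noteq> 0})"
    using AB(1) by (meson bounded_subset closed_closure compact_eq_bounded_closed)
  then show ?thesis using cl AB assms by (auto simp: test_function_def intro: Ck_add)
qed

lemma test_function_Ck: "test_function \<Omega> f \<Longrightarrow> Ck k f"
  by (simp add: test_function_def)

lemma test_function_outside:
  fixes f :: "real^'n \<Rightarrow> real^'m"
  assumes "test_function W f" "x \<notin> W"
  shows "f x = 0" "jac f x = 0"
proof -
  have x: "x \<notin> closure {x. f x \<noteq> 0}" using assms by (auto simp: test_function_def)
  have z: "f y = 0" if "y \<notin> closure {x. f x \<noteq> 0}" for y
    using that closure_subset[of "{x. f x \<noteq> 0}"] by auto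
  show "f x = 0" by (rule z[OF x])
  show "jac f x = 0" by (rule jac_outside[OF closed_closure z x])
qed

context laminate_gap
begin

text \<open>The integrals of the gap decay like \<open>r ^ n\<close>. Half of this rate makes the
  gaps, even divided by \<open>sqrt r ^ n\<close>, summable almost everywhere; the other half turns
  the bound on squared increments of the gradient into summability of the increments
  themselves.\<close>

lemma solution_sequence:
  assumes W: "open W" "bounded W" and G: "continuous_on W G" "\<And>x. x \<in> W \<Longrightarrow> G x \<in> U"
  obtains \<Phi> :: "nat \<Rightarrow> real^'n \<Rightarrow> real^'m" where
    "\<Phi> 0 = (\<lambda>_. 0)" "\<And>n. test_function W (\<Phi> n)" "\<And>n x. norm (\<Phi> (Suc n) x - \<Phi> n x) \<le> (1/2)^n"
    "\<And>n x. x \<in> W \<Longrightarrow> G x + jac (\<Phi> n) x \<in> U"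
    "AE x in lebesgue_on W. convergent (\<lambda>n. jac (\<Phi> n) x) \<and> (\<lambda>n. F (G x + jac (\<Phi> n) x)) \<longlonglongrightarrow> 0"
proof -
  define I where "I \<Phi> = (LINT x|lebesgue_on W. F (G x + jac \<Phi> x))" for \<Phi> :: "real^'n \<Rightarrow> real^'m"
  define B where "B = max 1 (I (\<lambda>_. 0))"
  \<comment> \<open>Each step gains \<open>\<kappa> / 4\<close>; half is kept as decay and half pays
    for the additive error, which \<open>B \<ge> 1\<close> allows to be compared with
    \<open>B * r ^ n\<close>.\<close>
  define r where "r = 1 - \<kappa> / 8"
  have r: "0 < r" "r < 1" using \<kappa> by (auto simp: r_def)
  have Wm: "W \<in> lmeasurable" using W by (simp add: lmeasurable_open)
  \<comment> \<open>The clause for \<open>n = 0\<close> records the start of the sequence, from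
    which the telescoping sums later give \<open>\<Phi> n\<close> itself.\<close>
  define P where "P n \<Phi> \<longleftrightarrow> test_function W \<Phi> \<and> (\<forall>x\<in>W. G x + jac \<Phi> x \<in> U) \<and> I \<Phi> \<le> B * r ^ n \<and> (n = 0 \<longrightarrow> \<Phi> = (\<lambda>_. 0))"
    for n and \<Phi> :: "real^'n \<Rightarrow> real^'m"
  define Q where "Q n \<Phi> \<Phi>' \<longleftrightarrow> (\<forall>x. norm (\<Phi>' x - \<Phi> x) \<le> (1/2)^n) \<and>
     (\<forall>x\<in>W. (norm (jac \<Phi>' x - jac \<Phi> x))\<^sup>2 \<le> 2 * C * F (G x + jac \<Phi> x) + r ^ n)"
    for n and \<Phi> \<Phi>' :: "real^'n \<Rightarrow> real^'m"
  have contG: "continuous_on W (\<lambda>x. G x + jac \<Phi> x)" if "test_function W \<Phi>" for \<Phi> :: "real^'n \<Rightarrow> real^'m"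
    by (intro continuous_on_add G(1) continuous_on_subset[OF jac_continuous[OF test_function_Ck[OF that]]]) simp
  have "\<exists>\<Phi>. \<forall>n. P n (\<Phi> n) \<and> Q n (\<Phi> n) (\<Phi> (Suc n))"
  proof (rule dependent_nat_choice)
    show "\<exists>\<Phi>. P 0 \<Phi>"
      by (rule exI[of _ "\<lambda>_. 0"]) (use G(2) in \<open>auto simp: P_def test_function_0 B_def jac_const\<close>)
    fix \<Phi> n assume P: "P n \<Phi>"
    \<comment> \<open>The first bound gives uniform convergence of the maps, the second the decay of
      the integrals.\<close>
    define e where "e = min ((1/2)^n) (\<kappa> / 8 * r ^ n)"
    have e: "e > 0" "e \<le> (1/2)^n" "e \<le> \<kappa> / 8 * r ^ n" using r \<kappa> by (auto simp: e_def)
    have "\<kappa> / 8 * r ^ n \<le> 1 * r ^ n" using r \<kappa> by (intro mult_right_mono) auto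
    then have e': "e \<le> r ^ n" using e(3) by simp
    have tP: "test_function W \<Phi>" and PU: "\<And>x. x \<in> W \<Longrightarrow> G x + jac \<Phi> x \<in> U" and PI: "I \<Phi> \<le> B * r ^ n"
      using P by (auto simp: P_def)
    obtain \<psi> :: "real^'n \<Rightarrow> real^'m" where \<psi>:
      "test_function W \<psi>" "\<And>x. norm (\<psi> x) \<le> e" "\<And>x. x \<in> W \<Longrightarrow> (G x + jac \<Phi> x) + jac \<psi> x \<in> U"
      "\<And>x. x \<in> W \<Longrightarrow> (norm (jac \<psi> x))\<^sup>2 \<le> 2 * C * F (G x + jac \<Phi> x) + e"
      "(LINT x|lebesgue_on W. F ((G x + jac \<Phi> x) + jac \<psi> x)) \<le> (1 - \<kappa> / 4) * (LINT x|lebesgue_on W. F (G x + jac \<Phi> x)) + e"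
      by (rule gap_reduction[OF W contG[OF tP] PU e(1)]) (assumption, (rule that; assumption))
    let ?\<Phi>' = "\<lambda>x. \<Phi> x + \<psi> x"
    have J: "jac ?\<Phi>' x = jac \<Phi> x + jac \<psi> x" for x
      by (rule jac_add) (rule test_function_Ck[OF tP], rule test_function_Ck[OF \<psi>(1)])
    have "I ?\<Phi>' \<le> (1 - \<kappa> / 4) * I \<Phi> + e" using \<psi>(5) by (simp add: I_def J add.assoc)
    also have "\<dots> \<le> (1 - \<kappa> / 4) * (B * r ^ n) + \<kappa> / 8 * r ^ n"
      using PI e(3) \<kappa> by (intro add_mono mult_left_mono) auto
    also have "\<dots> \<le> (1 - \<kappa> / 4) * (B * r ^ n) + \<kappa> / 8 * (B * r ^ n)"
    proof -
      have "1 * r ^ n \<le> B * r ^ n" using r by (intro mult_right_mono) (auto simp: B_def)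
      then show ?thesis using \<kappa> by (intro add_left_mono mult_left_mono) auto
    qed
    also have "\<dots> = B * r ^ Suc n" by (simp add: r_def algebra_simps)
    finally have "P (Suc n) ?\<Phi>'"
      using test_function_add[OF tP \<psi>(1)] \<psi>(3) by (simp add: P_def J add.assoc)
    moreover have "Q n \<Phi> ?\<Phi>'"
      unfolding Q_def J using \<psi>(2,4) e(2) e' by (auto, (smt (verit))+)
    ultimately show "\<exists>\<Phi>'. P (Suc n) \<Phi>' \<and> Q n \<Phi> \<Phi>'" by blast
  qed
  then obtain \<Phi> where \<Phi>: "\<And>n. P n (\<Phi> n)" "\<And>n. Q n (\<Phi> n) (\<Phi> (Suc n))" by blast
  have t: "test_function W (\<Phi> n)" and \<Phi>U: "x \<in> W \<Longrightarrow> G x + jac (\<Phi> n) x \<in> U" and I: "I (\<Phi> n) \<le> B * r ^ n" for n x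
    using \<Phi>(1)[of n] by (auto simp: P_def)
  define \<rho> where "\<rho> = sqrt r"
  have \<rho>: "0 < \<rho>" "\<rho> < 1" "\<rho> * \<rho> = r" using r by (auto simp: \<rho>_def)
  obtain M where M: "M > 0" "\<And>\<xi>. \<xi> \<in> U \<Longrightarrow> F \<xi> \<le> M" by (rule F_bounded) (rule that)
  define h where "h n x = F (G x + jac (\<Phi> n) x) / \<rho> ^ n" for n x
  have h0: "0 \<le> h n x" if "x \<in> W" for n x
    using F_pos[OF \<Phi>U[OF that]] \<rho>(1) by (simp add: h_def less_imp_le)
  have iF: "integrable (lebesgue_on W) (\<lambda>x. F (G x + jac (\<Phi> n) x))" for n
  proof (rule bounded_continuous_integrable[OF W, of _ M])
    show "continuous_on W (\<lambda>x. F (G x + jac (\<Phi> n) x))"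
      by (rule continuous_on_compose2[OF cont_F contG[OF t]]) simp
    show "norm (F (G x + jac (\<Phi> n) x)) \<le> M" if "x \<in> W" for x
      using M(2)[OF \<Phi>U[OF that, of n]] F_pos[OF \<Phi>U[OF that, of n]] by simp
  qed
  have "AE x in lebesgue_on W. summable (\<lambda>n. h n x)"
  proof (rule AE_summable_of_summable_integrals)
    show "integrable (lebesgue_on W) (h n)" for n unfolding h_def[abs_def] using iF by simp
    show "0 \<le> h n x" if "x \<in> space (lebesgue_on W)" for n x using h0 that by simp
    show "summable (\<lambda>n. LINT x|lebesgue_on W. h n x)"
    proof (rule summable_comparison_test')
      show "summable (\<lambda>n. B * \<rho> ^ n)" using \<rho> by (intro summable_mult summable_geometric) simp
      show "norm (LINT x|lebesgue_on W. h n x) \<le> B * \<rho> ^ n" for n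
      proof -
        have "(LINT x|lebesgue_on W. h n x) \<ge> 0" using h0 by (intro integral_nonneg_AE AE_I2) auto
        moreover have "(LINT x|lebesgue_on W. h n x) = I (\<Phi> n) / \<rho> ^ n" by (simp add: h_def I_def)
        moreover have "I (\<Phi> n) / \<rho> ^ n \<le> B * (\<rho> ^ n * \<rho> ^ n) / \<rho> ^ n"
          using I[of n] \<rho>(1) by (simp add: divide_right_mono \<rho>(3) flip: power_mult_distrib)
        ultimately show ?thesis using \<rho>(1) by simp
      qed
    qed
  qed
  then have "AE x in lebesgue_on W. convergent (\<lambda>n. jac (\<Phi> n) x) \<and> (\<lambda>n. F (G x + jac (\<Phi> n) x)) \<longlonglongrightarrow> 0"
  proof (rule AE_mp, intro AE_I2 impI conjI)
    fix x assume x: "x \<in> space (lebesgue_on W)" and s: "summable (\<lambda>n. h n x)"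
    then have xW: "x \<in> W" by simp
    have le: "F (G x + jac (\<Phi> n) x) \<le> h n x" for n
    proof -
      have "\<rho> ^ n \<le> 1" using \<rho> by (simp add: power_le_one)
      then show ?thesis using F_pos[OF \<Phi>U[OF xW, of n]] \<rho>(1) by (simp add: h_def pos_le_divide_eq mult_left_le)
    qed
    show "(\<lambda>n. F (G x + jac (\<Phi> n) x)) \<longlonglongrightarrow> 0"
      by (rule tendsto_sandwich[OF _ _ tendsto_const summable_LIMSEQ_zero[OF s]])
        (use le F_pos[OF \<Phi>U[OF xW]] in \<open>auto intro!: always_eventually less_imp_le\<close>)
    have "summable (\<lambda>n. jac (\<Phi> (Suc n)) x - jac (\<Phi> n) x)"
    proof (rule summable_norm_cancel, rule summable_comparison_test')
      show "summable (\<lambda>n. 2 * C * h n x + 2 * \<rho> ^ n)"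
        using s \<rho> by (intro summable_add summable_mult summable_geometric) auto
      show "norm (norm (jac (\<Phi> (Suc n)) x - jac (\<Phi> n) x)) \<le> 2 * C * h n x + 2 * \<rho> ^ n" for n
      proof -
        let ?y = "norm (jac (\<Phi> (Suc n)) x - jac (\<Phi> n) x)"
        have p: "\<rho> ^ n > 0" using \<rho>(1) by simp
        have "?y\<^sup>2 \<le> 2 * C * F (G x + jac (\<Phi> n) x) + r ^ n" using \<Phi>(2)[of n] xW by (simp add: Q_def)
        also have "\<dots> = (2 * C * h n x + \<rho> ^ n) * \<rho> ^ n"
          using p \<rho>(1) by (simp add: h_def \<rho>(3)[symmetric] power_mult_distrib algebra_simps)
        finally have 1: "?y\<^sup>2 \<le> (2 * C * h n x + \<rho> ^ n) * \<rho> ^ n" .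
        \<comment> \<open>Young's inequality in the form y \<le> y^2 / \<rho>^n + \<rho>^n, which
          passes from the squared increment to the increment pointwise; the weight in
          \<open>h\<close> absorbs the division.\<close>
        have "0 \<le> (?y - \<rho> ^ n)\<^sup>2 + ?y * \<rho> ^ n" using p by (intro add_nonneg_nonneg mult_nonneg_nonneg) auto
        then have "?y * \<rho> ^ n \<le> ?y\<^sup>2 + \<rho> ^ n * \<rho> ^ n" by (simp add: power2_eq_square algebra_simps)
        also have "\<dots> \<le> (2 * C * h n x + 2 * \<rho> ^ n) * \<rho> ^ n" using 1 by (simp add: algebra_simps)
        finally have "?y \<le> 2 * C * h n x + 2 * \<rho> ^ n" using p by (simp only: mult_le_cancel_right_pos)
        then show ?thesis by simp
      qed
    qed
    then have "(\<lambda>n. \<Sum>k<n. jac (\<Phi> (Suc k)) x - jac (\<Phi> k) x) \<longlonglongrightarrow> (\<Sum>k. jac (\<Phi> (Suc k)) x - jac (\<Phi> k) x)"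
      by (rule summable_LIMSEQ)
    then have "(\<lambda>n. jac (\<Phi> n) x - jac (\<Phi> 0) x + jac (\<Phi> 0) x) \<longlonglongrightarrow> (\<Sum>k. jac (\<Phi> (Suc k)) x - jac (\<Phi> k) x) + jac (\<Phi> 0) x"
      unfolding sum_lessThan_telescope[of "\<lambda>k. jac (\<Phi> k) x"] by (intro tendsto_add tendsto_const)
    then show "convergent (\<lambda>n. jac (\<Phi> n) x)" by (auto simp: convergent_def)
  qed
  then show thesis
    using that[of \<Phi>] t \<Phi>U \<Phi> by (auto simp: P_def Q_def)
qed

end

lemma Linf_of_bounded:
  assumes "f \<in> borel_measurable lebesgue" "AE x in lebesgue. norm (f x) \<le> c" "\<Omega> \<in> sets lebesgue"
  shows "Linf \<Omega> f"
proof -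
  have "AE x in lebesgue_on \<Omega>. norm (f x) \<le> c"
    using assms by (simp add: AE_restrict_space_iff) (auto elim: AE_mp)
  then show ?thesis using assms(1) by (auto simp: Linf_def intro: measurable_restrict_space1)
qed

text \<open>Dominated convergence passes the integration by parts to the limit. The maps
  \<open>\<Phi> n\<close> themselves are the approximating test functions for \<open>W11_0\<close>:
  on a bounded set, bounded convergence almost everywhere of values and gradients implies
  convergence in the norm.\<close>

lemma W1inf_0_limit:
  fixes \<Phi> :: "nat \<Rightarrow> real^'n \<Rightarrow> real^'m"
  assumes \<Omega>: "open \<Omega>" "bounded \<Omega>"
    and t: "\<And>n. test_function \<Omega> (\<Phi> n)"
    and lim: "\<And>x. (\<lambda>n. \<Phi> n x) \<longlonglongrightarrow> v x" and bd: "\<And>n x. norm (\<Phi> n x) \<le> c"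
    and limJ: "AE x in lebesgue. (\<lambda>n. jac (\<Phi> n) x) \<longlonglongrightarrow> H x" and bdJ: "\<And>n x. norm (jac (\<Phi> n) x) \<le> c"
    and Hm: "H \<in> borel_measurable lebesgue"
  shows "v \<in> W1inf_0 \<Omega>" "weak_gradient \<Omega> v H"
proof -
  have \<Omega>m: "\<Omega> \<in> lmeasurable" using \<Omega> by (simp add: lmeasurable_open)
  have \<Omega>s: "\<Omega> \<in> sets lebesgue" using \<Omega>m by blast
  have Ck: "Ck k (\<Phi> n)" for k n by (rule test_function_Ck[OF t])
  have m\<Phi>: "\<Phi> n \<in> borel_measurable lebesgue" for n
    using Ck[of 0 n] by (simp add: borel_measurable_continuous_onI measurable_completion)
  have mJ: "jac (\<Phi> n) \<in> borel_measurable lebesgue" for n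
    using jac_continuous[OF Ck, of n] by (simp add: borel_measurable_continuous_onI measurable_completion)
  have mv: "v \<in> borel_measurable lebesgue"
    by (rule borel_measurable_LIMSEQ_metric[OF m\<Phi> lim])
  have bv: "norm (v x) \<le> c" for x by (rule LIMSEQ_le_const2[OF tendsto_norm[OF lim]]) (use bd in auto)
  have bH: "AE x in lebesgue. norm (H x) \<le> c"
    using limJ by (rule AE_mp) (auto intro!: AE_I2 LIMSEQ_le_const2[OF tendsto_norm] simp: bdJ)
  have ind: "integrable lebesgue (\<lambda>x. indicator S x *\<^sub>R f x)"
    if S: "S \<in> lmeasurable" and f: "f \<in> borel_measurable lebesgue" and b: "AE x in lebesgue. norm (f x) \<le> b" for S and f :: "real^'n \<Rightarrow> 'c::{banach, second_countable_topology}" and b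
  proof (rule Bochner_Integration.integrable_bound)
    show "integrable lebesgue (\<lambda>x. indicator S x * b)"
      using S by (intro integrable_mult_left) (simp add: lmeasurable_iff_integrable)
    show "(\<lambda>x. indicator S x *\<^sub>R f x) \<in> borel_measurable lebesgue"
      using S f by (intro borel_measurable_scaleR borel_measurable_indicator) auto
    show "AE x in lebesgue. norm (indicator S x *\<^sub>R f x) \<le> norm (indicator S x * b)"
      using b by (rule AE_mp) (auto intro!: AE_I2 simp: indicator_def)
  qed
  have locv: "loc_integrable \<Omega> v" and locH: "loc_integrable \<Omega> H"
    unfolding loc_integrable_def set_integrable_def
    using ind[OF _ mv AE_I2[OF bv]] ind[OF _ Hm bH] by (auto intro: lmeasurable_compact)
  show wg: "weak_gradient \<Omega> v H"
    unfolding weak_gradient_def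
  proof (intro conjI allI impI locv locH)
    fix \<zeta> i j assume \<zeta>: "test_function \<Omega> (\<zeta> :: real^'n \<Rightarrow> real)"
    obtain K where K: "compact K" "K \<subseteq> \<Omega>" "\<And>x. x \<notin> K \<Longrightarrow> \<zeta> x = 0"
      "\<And>x. x \<notin> K \<Longrightarrow> frechet_derivative \<zeta> (at x) = (\<lambda>_. 0)" "continuous_on UNIV \<zeta>"
      "\<And>j. continuous_on UNIV (\<lambda>x. frechet_derivative \<zeta> (at x) (axis j 1))"
      by (rule test_function_support[OF \<zeta>]) (rule that; assumption)
    define \<zeta>j where "\<zeta>j x = frechet_derivative \<zeta> (at x) (axis j 1)" for x
    have c\<zeta>j: "continuous_on UNIV \<zeta>j" unfolding \<zeta>j_def using K(6) by simp
    obtain b1 where b1: "\<And>x. norm (\<zeta> x) \<le> b1"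
      by (rule continuous_compact_support_bounded[OF K(5,1,3)]) (assumption, rule that)
    obtain b2 where b2: "\<And>x. norm (\<zeta>j x) \<le> b2"
      by (rule continuous_compact_support_bounded[OF c\<zeta>j K(1)]) (use K(4) in \<open>auto simp: \<zeta>j_def\<close>)
    have m\<zeta>: "\<zeta> \<in> borel_measurable lebesgue" "\<zeta>j \<in> borel_measurable lebesgue"
      using K(5) c\<zeta>j by (simp_all add: borel_measurable_continuous_onI measurable_completion)
    have c0: "c \<ge> 0" using bd[of 0 0] norm_ge_zero order_trans by blast
    have m1: "(\<lambda>x. f x $ i) \<in> borel_measurable lebesgue" if "f \<in> borel_measurable lebesgue" for f :: "real^'n \<Rightarrow> real^'m"
      using measurable_compose[OF that, of "\<lambda>y. y $ i" borel] by (simp add: borel_measurable_continuous_onI continuous_on_component)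
    have m2: "(\<lambda>x. f x $ i $ j) \<in> borel_measurable lebesgue" if "f \<in> borel_measurable lebesgue" for f :: "real^'n \<Rightarrow> real^'n^'m"
      using measurable_compose[OF that, of "\<lambda>y. y $ i $ j" borel] by (simp add: borel_measurable_continuous_onI continuous_on_component)
    have "(\<lambda>n. LINT x:\<Omega>|lebesgue. \<Phi> n x $ i * \<zeta>j x) \<longlonglongrightarrow> (LINT x:\<Omega>|lebesgue. v x $ i * \<zeta>j x)"
      unfolding set_lebesgue_integral_def
    proof (rule integral_dominated_convergence)
      show "integrable lebesgue (\<lambda>x. indicator \<Omega> x *\<^sub>R (c * b2))"
        by (rule ind[OF \<Omega>m]) auto
      show "AE x in lebesgue. (\<lambda>n. indicator \<Omega> x *\<^sub>R (\<Phi> n x $ i * \<zeta>j x)) \<longlonglongrightarrow> indicator \<Omega> x *\<^sub>R (v x $ i * \<zeta>j x)"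
        by (intro AE_I2 tendsto_intros lim)
      show "AE x in lebesgue. norm (indicator \<Omega> x *\<^sub>R (\<Phi> n x $ i * \<zeta>j x)) \<le> indicator \<Omega> x *\<^sub>R (c * b2)" for n
      proof (rule AE_I2)
        fix x
        have "\<bar>\<Phi> n x $ i\<bar> \<le> c" using component_le_norm_cart[of "\<Phi> n x" i] bd[of n x] by linarith
        then have "\<bar>\<Phi> n x $ i\<bar> * \<bar>\<zeta>j x\<bar> \<le> c * b2" using b2[of x] c0 by (intro mult_mono) auto
        then show "norm (indicator \<Omega> x *\<^sub>R (\<Phi> n x $ i * \<zeta>j x)) \<le> indicator \<Omega> x *\<^sub>R (c * b2)"
          by (simp add: indicator_def abs_mult)
      qed
    qed (use \<Omega>s m\<Phi> mv m\<zeta> in \<open>auto intro!: borel_measurable_scaleR borel_measurable_indicator borel_measurable_times m1\<close>)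
    moreover have "(\<lambda>n. LINT x:\<Omega>|lebesgue. jac (\<Phi> n) x $ i $ j * \<zeta> x) \<longlonglongrightarrow> (LINT x:\<Omega>|lebesgue. H x $ i $ j * \<zeta> x)"
      unfolding set_lebesgue_integral_def
    proof (rule integral_dominated_convergence)
      show "integrable lebesgue (\<lambda>x. indicator \<Omega> x *\<^sub>R (c * b1))"
        by (rule ind[OF \<Omega>m]) auto
      show "AE x in lebesgue. (\<lambda>n. indicator \<Omega> x *\<^sub>R (jac (\<Phi> n) x $ i $ j * \<zeta> x)) \<longlonglongrightarrow> indicator \<Omega> x *\<^sub>R (H x $ i $ j * \<zeta> x)"
        using limJ by (rule AE_mp) (auto intro!: AE_I2 tendsto_intros)
      show "AE x in lebesgue. norm (indicator \<Omega> x *\<^sub>R (jac (\<Phi> n) x $ i $ j * \<zeta> x)) \<le> indicator \<Omega> x *\<^sub>R (c * b1)" for n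
      proof (rule AE_I2)
        fix x
        have "\<bar>jac (\<Phi> n) x $ i $ j\<bar> \<le> c"
          using component_le_norm_cart[of "jac (\<Phi> n) x $ i" j] Finite_Cartesian_Product.norm_nth_le[of "jac (\<Phi> n) x" i] bdJ[of n x] by linarith
        then have "\<bar>jac (\<Phi> n) x $ i $ j\<bar> * \<bar>\<zeta> x\<bar> \<le> c * b1" using b1[of x] c0 by (intro mult_mono) auto
        then show "norm (indicator \<Omega> x *\<^sub>R (jac (\<Phi> n) x $ i $ j * \<zeta> x)) \<le> indicator \<Omega> x *\<^sub>R (c * b1)"
          by (simp add: indicator_def abs_mult)
      qed
    qed (use \<Omega>s mJ Hm m\<zeta> in \<open>auto intro!: borel_measurable_scaleR borel_measurable_indicator borel_measurable_times m2\<close>)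
    moreover have "(LINT x:\<Omega>|lebesgue. \<Phi> n x $ i * \<zeta>j x) = - (LINT x:\<Omega>|lebesgue. jac (\<Phi> n) x $ i $ j * \<zeta> x)" for n
      unfolding \<zeta>j_def
    proof (rule integration_by_parts[OF \<Omega>(1) _ _ \<zeta>])
      show "\<Phi> n differentiable (at x)" for x using Ck[of 1 n] by simp
      show "continuous_on \<Omega> (jac (\<Phi> n))" using jac_continuous[OF Ck] continuous_on_subset by blast
    qed
    ultimately show "(LINT x:\<Omega>|lebesgue. v x $ i * frechet_derivative \<zeta> (at x) (axis j 1))
        = - (LINT x:\<Omega>|lebesgue. H x $ i $ j * \<zeta> x)"
      unfolding \<zeta>j_def[symmetric] by (metis (no_types, lifting) LIMSEQ_unique tendsto_minus tendsto_cong_limit ext)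
  qed
  have "v \<in> W1inf \<Omega>" unfolding W1inf_def
    using wg Linf_of_bounded[OF mv AE_I2[OF bv] \<Omega>s] Linf_of_bounded[OF Hm bH \<Omega>s] by blast
  moreover have "v \<in> W11_0 \<Omega>" unfolding W11_0_def
  proof (intro CollectI exI[of _ H] exI[of _ \<Phi>] conjI allI wg t)
    have res: "f \<in> borel_measurable (lebesgue_on \<Omega>)" if "f \<in> borel_measurable lebesgue" for f :: "real^'n \<Rightarrow> 'c::topological_space"
      using that by (rule measurable_restrict_space1)
    have aer: "AE x in lebesgue_on \<Omega>. P x" if "AE x in lebesgue. P x" for P
      using that \<Omega>s by (simp add: AE_restrict_space_iff) (auto elim: AE_mp)
    show "integrable (lebesgue_on \<Omega>) v"
      by (rule bounded_measurable_integrable[OF \<Omega>m res[OF mv]]) (use bv in auto)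
    show "integrable (lebesgue_on \<Omega>) H"
      by (rule bounded_measurable_integrable[OF \<Omega>m res[OF Hm] aer[OF bH]])
    have ic: "integrable (lebesgue_on \<Omega>) (\<lambda>x. 2 * c)"
      by (rule bounded_measurable_integrable[OF \<Omega>m]) auto
    have "(\<lambda>n. LINT x|lebesgue_on \<Omega>. norm (\<Phi> n x - v x)) \<longlonglongrightarrow> (LINT x|lebesgue_on \<Omega>. 0)"
    proof (rule integral_dominated_convergence[OF _ _ ic])
      show "(\<lambda>x. norm (\<Phi> n x - v x)) \<in> borel_measurable (lebesgue_on \<Omega>)" for n
        by (rule measurable_compose[OF borel_measurable_diff[OF res[OF m\<Phi>] res[OF mv]] borel_measurable_norm])
      show "AE x in lebesgue_on \<Omega>. (\<lambda>n. norm (\<Phi> n x - v x)) \<longlonglongrightarrow> 0"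
        using lim by (auto intro!: AE_I2 tendsto_norm_zero simp: LIM_zero_iff)
      show "AE x in lebesgue_on \<Omega>. norm (norm (\<Phi> n x - v x)) \<le> 2 * c" for n
        using bd[of n] bv norm_triangle_ineq4[of "\<Phi> n _" "v _"] by (auto intro!: AE_I2) (smt (verit))
    qed simp
    then show "(\<lambda>n. LINT x|lebesgue_on \<Omega>. norm (\<Phi> n x - v x)) \<longlonglongrightarrow> 0" by simp
    have "(\<lambda>n. LINT x|lebesgue_on \<Omega>. norm (jac (\<Phi> n) x - H x)) \<longlonglongrightarrow> (LINT x|lebesgue_on \<Omega>. 0)"
    proof (rule integral_dominated_convergence[OF _ _ ic])
      show "(\<lambda>x. norm (jac (\<Phi> n) x - H x)) \<in> borel_measurable (lebesgue_on \<Omega>)" for n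
        by (rule measurable_compose[OF borel_measurable_diff[OF res[OF mJ] res[OF Hm]] borel_measurable_norm])
      show "AE x in lebesgue_on \<Omega>. (\<lambda>n. norm (jac (\<Phi> n) x - H x)) \<longlonglongrightarrow> 0"
        using aer[OF limJ] by (rule AE_mp) (auto intro!: AE_I2 tendsto_norm_zero simp: LIM_zero_iff)
      show "AE x in lebesgue_on \<Omega>. norm (norm (jac (\<Phi> n) x - H x)) \<le> 2 * c" for n
        using aer[OF bH]
      proof (rule AE_mp, intro AE_I2 impI)
        fix x assume "norm (H x) \<le> c"
        then show "norm (norm (jac (\<Phi> n) x - H x)) \<le> 2 * c"
          using bdJ[of n x] norm_triangle_ineq4[of "jac (\<Phi> n) x" "H x"] by simp
      qed
    qed simp
    then show "(\<lambda>n. LINT x|lebesgue_on \<Omega>. norm (matrix (frechet_derivative (\<Phi> n) (at x)) - H x)) \<longlonglongrightarrow> 0"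
      by (simp add: jac_def)
  qed
  ultimately show "v \<in> W1inf_0 \<Omega>" by (simp add: W1inf_0_def)
qed

section \<open>The segment of singular values\<close>

locale singular_value_segment =
  fixes a1 a2 b1 b2 :: real
  assumes ab: "0 < a1" "a1 \<le> a2" "0 < b1" "b1 \<le> b2" "a1 < b1" "a2 < b2"
begin

definition L1 :: "real \<Rightarrow> real" where "L1 s = a1 + s * (b1 - a1)"
definition L2 :: "real \<Rightarrow> real" where "L2 s = a2 + s * (b2 - a2)"

text \<open>The root \<open>s \<ge> 0\<close> of the quadratic equation \<open>L1 s * L2 s = d\<close>.\<close>

definition \<sigma> :: "real \<Rightarrow> real" where
  "\<sigma> d = (sqrt ((a1 * (b2 - a2) + a2 * (b1 - a1))\<^sup>2 + 4 * ((b1 - a1) * (b2 - a2)) * (d - a1 * a2))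
           - (a1 * (b2 - a2) + a2 * (b1 - a1))) / (2 * ((b1 - a1) * (b2 - a2)))"

definition R :: "real \<Rightarrow> real" where "R d = (L2 (\<sigma> d) - L1 (\<sigma> d)) / 2"

definition gap :: "real^2^2 \<Rightarrow> real" where "gap \<xi> = (R (det \<xi>))\<^sup>2 - wsq \<xi>"

definition seg_hull :: "(real^2^2) set" where
  "seg_hull = {\<xi>. a1 * a2 < det \<xi> \<and> det \<xi> < b1 * b2 \<and> 0 < gap \<xi>}"

text \<open>Along the segment the determinant is
  \<open>a1 * a2 + \<beta> * s + \<alpha> * s * s\<close> with \<alpha>, \<beta> > 0, so it
  increases from \<open>a1 * a2\<close> at s = 0 to \<open>b1 * b2\<close> at s = 1 and its inverse
  there is given by the quadratic formula.\<close>

lemma \<sigma>: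
  assumes "a1 * a2 \<le> d" "d \<le> b1 * b2"
  shows "0 \<le> \<sigma> d" "\<sigma> d \<le> 1" "L1 (\<sigma> d) * L2 (\<sigma> d) = d"
proof -
  define \<alpha> where "\<alpha> = (b1 - a1) * (b2 - a2)"
  define \<beta> where "\<beta> = a1 * (b2 - a2) + a2 * (b1 - a1)"
  define q where "q = sqrt (\<beta>\<^sup>2 + 4 * \<alpha> * (d - a1 * a2))"
  have \<alpha>: "\<alpha> > 0" using ab by (simp add: \<alpha>_def)
  have \<beta>: "\<beta> > 0" using ab by (simp add: \<beta>_def add_pos_nonneg)
  have s: "\<sigma> d = (q - \<beta>) / (2 * \<alpha>)" by (simp add: \<sigma>_def q_def \<alpha>_def \<beta>_def)
  have n: "0 \<le> 4 * \<alpha> * (d - a1 * a2)" using \<alpha> assms by simp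
  have q2: "q\<^sup>2 = \<beta>\<^sup>2 + 4 * \<alpha> * (d - a1 * a2)" using n by (simp add: q_def)
  have "\<beta> \<le> q" unfolding q_def using n \<beta> by (intro real_le_rsqrt) simp
  then show s0: "0 \<le> \<sigma> d" using \<alpha> by (simp add: s)
  have root: "\<alpha> * (\<sigma> d)\<^sup>2 + \<beta> * \<sigma> d = d - a1 * a2"
  proof -
    have "q = 2 * \<alpha> * \<sigma> d + \<beta>" using \<alpha> by (simp add: s)
    then have "(2 * \<alpha> * \<sigma> d + \<beta>)\<^sup>2 = \<beta>\<^sup>2 + 4 * \<alpha> * (d - a1 * a2)" using q2 by simp
    then have "4 * \<alpha> * (\<alpha> * (\<sigma> d)\<^sup>2 + \<beta> * \<sigma> d) = 4 * \<alpha> * (d - a1 * a2)"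
      by (simp add: power2_eq_square algebra_simps)
    then show ?thesis using \<alpha> by simp
  qed
  have e: "L1 (\<sigma> d) * L2 (\<sigma> d) = a1 * a2 + \<alpha> * (\<sigma> d)\<^sup>2 + \<beta> * \<sigma> d"
    by (simp add: L1_def L2_def \<alpha>_def \<beta>_def power2_eq_square algebra_simps)
  then show "L1 (\<sigma> d) * L2 (\<sigma> d) = d" using root by simp
  show "\<sigma> d \<le> 1"
  proof (rule ccontr)
    assume "\<not> \<sigma> d \<le> 1"
    then have 1: "\<sigma> d > 1" by simp
    then have "(\<sigma> d)\<^sup>2 > 1" by (simp add: power2_eq_square less_1_mult)
    then have "\<alpha> * (\<sigma> d)\<^sup>2 > \<alpha>" "\<beta> * \<sigma> d > \<beta>" using \<alpha> \<beta> 1 by simp_all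
    moreover have "\<alpha> + \<beta> = b1 * b2 - a1 * a2" by (simp add: \<alpha>_def \<beta>_def algebra_simps)
    ultimately show False using root assms by linarith
  qed
qed

lemma L_bounds:
  assumes "0 \<le> s" "s \<le> 1"
  shows "0 < L1 s" "L1 s \<le> L2 s" "L2 s \<le> b2"
proof -
  have e: "L1 s = (1 - s) * a1 + s * b1" "L2 s = (1 - s) * a2 + s * b2"
    by (simp_all add: L1_def L2_def algebra_simps)
  have "(1 - s) * a1 \<le> (1 - s) * a2" "s * b1 \<le> s * b2" "(1 - s) * a2 \<le> (1 - s) * b2"
    using assms ab by (auto intro!: mult_left_mono)
  then show "L1 s \<le> L2 s" "L2 s \<le> b2" unfolding e by (auto simp: algebra_simps)
  show "0 < L1 s" using assms ab by (simp add: L1_def add_pos_nonneg)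
qed

text \<open>The third identity is the value of \<open>zsq\<close> at the point of the segment with
  determinant \<open>d\<close>: half the sum of the singular values is |z|, half their difference is
  |w|.\<close>

lemma R_bounds:
  assumes "a1 * a2 \<le> d" "d \<le> b1 * b2"
  shows "0 \<le> R d" "R d \<le> b2" "((L1 (\<sigma> d) + L2 (\<sigma> d)) / 2)\<^sup>2 = d + (R d)\<^sup>2"
proof -
  note b = L_bounds[OF \<sigma>(1,2)[OF assms]]
  show "0 \<le> R d" using b by (simp add: R_def)
  show "R d \<le> b2" using b ab by (simp add: R_def)
  have "((L1 (\<sigma> d) + L2 (\<sigma> d)) / 2)\<^sup>2 = L1 (\<sigma> d) * L2 (\<sigma> d) + (R d)\<^sup>2"
    by (simp add: R_def power2_eq_square field_simps)
  then show "((L1 (\<sigma> d) + L2 (\<sigma> d)) / 2)\<^sup>2 = d + (R d)\<^sup>2" using \<sigma>(3)[OF assms] by simp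
qed

text \<open>The real square root is total and continuous, so the formula is continuous also at
  determinants where it no longer describes a point of the segment.\<close>

lemma continuous_gap: "continuous_on UNIV gap"
  unfolding gap_def R_def L1_def L2_def \<sigma>_def det_2 wsq_def
  using ab by (intro continuous_intros) auto

lemma continuous_det2: "continuous_on UNIV (det :: real^2^2 \<Rightarrow> real)"
  unfolding det_2 by (intro continuous_intros)

lemma open_hull: "open seg_hull"
  unfolding seg_hull_def
  by (intro open_Collect_conj open_Collect_less continuous_on_const continuous_gap continuous_det2)

text \<open>The squared norm is 2 det + 4 |w|^2, and both terms are bounded on the hull.\<close>

lemma bounded_hull: "bounded seg_hull"
proof -
  have "norm \<xi> \<le> sqrt (2 * (b1 * b2 + 2 * b2\<^sup>2))" if "\<xi> \<in> seg_hull" for \<xi>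
  proof (rule real_le_rsqrt)
    have d: "a1 * a2 \<le> det \<xi>" "det \<xi> \<le> b1 * b2" and g: "0 < gap \<xi>" using that by (auto simp: seg_hull_def)
    have "(R (det \<xi>))\<^sup>2 \<le> b2\<^sup>2" using R_bounds[OF d] by (simp add: power_mono)
    then have "wsq \<xi> \<le> b2\<^sup>2" using g by (simp add: gap_def)
    then show "(norm \<xi>)\<^sup>2 \<le> 2 * (b1 * b2 + 2 * b2\<^sup>2)"
      using d(2) det_eq_zsq_wsq[of \<xi>] by (simp add: norm_eq_zsq_wsq)
  qed
  then show ?thesis unfolding bounded_iff by blast
qed

text \<open>The rank-one direction is taken with \<open>t = gap \<xi> / 2\<close>. Its squared norm
  4 t gives the constant 2, and full amplitude halves the gap, so the segment stays in the hull and
  the constant 1/2 results.\<close>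

sublocale laminate_gap seg_hull gap 2 "1/2"
proof
  fix \<xi> assume \<xi>: "\<xi> \<in> seg_hull"
  then show g: "0 < gap \<xi>" by (simp add: seg_hull_def)
  then have "gap \<xi> / 2 > 0" by simp
  then obtain A n :: "real^2" where An: "n \<noteq> 0" "(norm (outer A n))\<^sup>2 = 4 * (gap \<xi> / 2)"
    "\<And>s. det (\<xi> + s *\<^sub>R outer A n) = det \<xi>"
    "\<And>s. wsq (\<xi> + s *\<^sub>R outer A n) = wsq \<xi> + s\<^sup>2 * (gap \<xi> / 2)"
    by (rule rank_one_direction[where \<xi>=\<xi>]) (rule that; assumption)
  have gs: "gap (\<xi> + s *\<^sub>R outer A n) = gap \<xi> - 1/2 * s\<^sup>2 * gap \<xi>" for s
    unfolding gap_def[of "\<xi> + s *\<^sub>R outer A n"] An(3,4) by (simp add: gap_def)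
  have "0 < gap \<xi> - 1/2 * s\<^sup>2 * gap \<xi>" if "\<bar>s\<bar> \<le> 1" for s
  proof -
    have "s\<^sup>2 \<le> 1" using that by (simp add: abs_square_le_1)
    then have "s\<^sup>2 * gap \<xi> \<le> 1 * gap \<xi>" using g by (intro mult_right_mono) auto
    then show ?thesis using g by simp
  qed
  then show "\<exists>A n. n \<noteq> 0 \<and> (norm (outer A n))\<^sup>2 \<le> 2 * gap \<xi> \<and>
        (\<forall>s. \<bar>s\<bar> \<le> 1 \<longrightarrow> \<xi> + s *\<^sub>R outer A n \<in> seg_hull \<and> gap (\<xi> + s *\<^sub>R outer A n) \<le> gap \<xi> - 1/2 * s\<^sup>2 * gap \<xi>)"
    using An \<xi> gs by - (rule exI[of _ A], rule exI[of _ n], auto simp: seg_hull_def)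
qed (use open_hull bounded_hull continuous_gap in auto)

lemma det_pos: "a1 * a2 \<le> det \<xi> \<Longrightarrow> 0 < det \<xi>"
  using ab by (meson less_le_trans mult_pos_pos)

text \<open>By contradiction, comparing with the point of the segment that has the same determinant:
  |w| at least its value there forces |z| up too, hence \<open>lambda2\<close> is at least
  \<open>L2 s\<close> and, the product being fixed, \<open>lambda1\<close> at most
  \<open>L1 s\<close>. As the slope is positive, the singular values then lie on or above the line,
  against the hypothesis.\<close>

lemma in_hullI:
  assumes d: "a1 * a2 < det \<xi>" "det \<xi> < b1 * b2"
    and l: "lambda2 \<xi> < lambda1 \<xi> * ((b2 - a2) / (b1 - a1)) + (a2 * b1 - b2 * a1) / (b1 - a1)"
  shows "\<xi> \<in> seg_hull"
proof (rule ccontr)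
  assume "\<xi> \<notin> seg_hull"
  then have "(R (det \<xi>))\<^sup>2 \<le> wsq \<xi>" using d by (simp add: seg_hull_def gap_def)
  note d' = less_imp_le[OF d(1)] less_imp_le[OF d(2)]
  define s where "s = \<sigma> (det \<xi>)"
  note sv = singular_values_2[OF det_pos[OF d'(1)]]
  have L: "0 < L1 s" "L1 s \<le> L2 s" using L_bounds[OF \<sigma>(1,2)[OF d']] by (auto simp: s_def)
  have w: "R (det \<xi>) \<le> sqrt (wsq \<xi>)" using \<open>(R (det \<xi>))\<^sup>2 \<le> wsq \<xi>\<close> by (rule real_le_rsqrt)
  have "((L1 s + L2 s) / 2)\<^sup>2 \<le> zsq \<xi>"
    unfolding s_def R_bounds(3)[OF d'] using \<open>(R (det \<xi>))\<^sup>2 \<le> wsq \<xi>\<close> det_eq_zsq_wsq[of \<xi>] by simp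
  then have z: "(L1 s + L2 s) / 2 \<le> sqrt (zsq \<xi>)" by (rule real_le_rsqrt)
  have l2: "L2 s \<le> lambda2 \<xi>"
    using w z unfolding sv R_def s_def by (simp add: field_simps)
  have "lambda1 \<xi> * lambda2 \<xi> = (sqrt (zsq \<xi>))\<^sup>2 - (sqrt (wsq \<xi>))\<^sup>2"
    unfolding sv by (simp add: power2_eq_square algebra_simps)
  also have "\<dots> = L1 s * L2 s"
    using zsq_wsq_nonneg[of \<xi>] \<sigma>(3)[OF d'] det_eq_zsq_wsq[of \<xi>] by (simp add: s_def)
  finally have p: "lambda1 \<xi> * lambda2 \<xi> = L1 s * L2 s" .
  have l1: "lambda1 \<xi> \<le> L1 s"
  proof (rule ccontr)
    assume "\<not> lambda1 \<xi> \<le> L1 s"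
    then have "L1 s * lambda2 \<xi> < lambda1 \<xi> * lambda2 \<xi>"
      using L l2 by (intro mult_strict_right_mono) auto
    moreover have "L1 s * L2 s \<le> L1 s * lambda2 \<xi>" using L l2 by (intro mult_left_mono) auto
    ultimately have "L1 s * L2 s < lambda1 \<xi> * lambda2 \<xi>" by linarith
    then show False using p by simp
  qed
  have "lambda1 \<xi> * ((b2 - a2) / (b1 - a1)) \<le> L1 s * ((b2 - a2) / (b1 - a1))"
    using l1 ab by (intro mult_right_mono) auto
  \<comment> \<open>The affine function in the hypothesis describes the line through the two
    endpoints.\<close>
  moreover have "L1 s * ((b2 - a2) / (b1 - a1)) + (a2 * b1 - b2 * a1) / (b1 - a1) = L2 s"
  proof -
    have "L1 s * (b2 - a2) + (a2 * b1 - b2 * a1) = L2 s * (b1 - a1)"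
      by (simp add: L1_def L2_def algebra_simps)
    then have "(L1 s * (b2 - a2) + (a2 * b1 - b2 * a1)) / (b1 - a1) = L2 s" using ab by simp
    then show ?thesis by (simp add: add_divide_distrib)
  qed
  ultimately show False using l l2 by linarith
qed

text \<open>Gap zero fixes |w|, the determinant then fixes |z|, and both agree with the point of
  parameter \<sigma> (det \<xi>). Strict bounds on the determinant are lost in the limit; equality
  corresponds to the endpoints of the segment.\<close>

lemma gap_zero_imp_segment:
  assumes d: "a1 * a2 \<le> det \<xi>" "det \<xi> \<le> b1 * b2" and g: "gap \<xi> = 0"
  shows "(lambda1 \<xi>, lambda2 \<xi>) \<in> closed_segment (a1, a2) (b1, b2)"
proof -
  define s where "s = \<sigma> (det \<xi>)"
  have s: "0 \<le> s" "s \<le> 1" using \<sigma>[OF d] by (auto simp: s_def)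
  note sv = singular_values_2[OF det_pos[OF d(1)]]
  have w: "sqrt (wsq \<xi>) = (L2 s - L1 s) / 2"
    using g R_bounds(1)[OF d] by (simp add: gap_def R_def s_def real_sqrt_unique)
  have "zsq \<xi> = ((L1 s + L2 s) / 2)\<^sup>2"
    unfolding s_def R_bounds(3)[OF d] using g det_eq_zsq_wsq[of \<xi>] by (simp add: gap_def)
  then have z: "sqrt (zsq \<xi>) = (L1 s + L2 s) / 2"
    using L_bounds[OF s] by simp
  have "lambda1 \<xi> = L1 s" "lambda2 \<xi> = L2 s" unfolding sv w z by (simp_all add: field_simps)
  then have "(lambda1 \<xi>, lambda2 \<xi>) = (1 - s) *\<^sub>R (a1, a2) + s *\<^sub>R (b1, b2)"
    by (simp add: L1_def L2_def algebra_simps)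
  then show ?thesis using s unfolding closed_segment_def by blast
qed

end

section \<open>From the piecewise datum to the limit map\<close>

theorem theorem1p3:
  fixes \<Lambda> :: "(real \<times> real) set"
    and a1 a2 b1 b2 :: real
    and E :: "(real^2^2) set"
    and \<Omega> :: "(real^2) set"
    and \<phi> :: "real^2 \<Rightarrow> real^2"
    and D\<phi> :: "real^2 \<Rightarrow> real^2^2"
  assumes "closed_segment (a1, a2) (b1, b2) \<subseteq> \<Lambda>"
    and "(a1, a2) \<noteq> (b1, b2)"
    and "0 < a1" "a1 \<le> a2" "0 < b1" "b1 \<le> b2"
    and "a1 < b1" "a2 < b2"
    and "a1 < a2 \<or> b1 < b2"
    and "E = {\<xi>. (lambda1 \<xi>, lambda2 \<xi>) \<in> \<Lambda> \<and> det \<xi> > 0}"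
    and "open \<Omega>" "bounded \<Omega>"
    and "\<phi> \<in> C1_piec \<Omega>"
    and "weak_gradient \<Omega> \<phi> D\<phi>"
    and "AE x in lebesgue_on \<Omega>. a1 * a2 < det (D\<phi> x) \<and> det (D\<phi> x) < b1 * b2"
    and "AE x in lebesgue_on \<Omega>. lambda2 (D\<phi> x) <
           lambda1 (D\<phi> x) * ((b2 - a2) / (b1 - a1)) + (a2 * b1 - b2 * a1) / (b1 - a1)"
  shows "\<exists>u Du. (\<lambda>x. u x - \<phi> x) \<in> W1inf_0 \<Omega> \<and> weak_gradient \<Omega> u Du \<and>
           (AE x in lebesgue_on \<Omega>. Du x \<in> E)"
proof -
  interpret singular_value_segment a1 a2 b1 b2 using assms(3-8) by unfold_locales
  note \<Omega> = \<open>open \<Omega>\<close> \<open>bounded \<Omega>\<close>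
  have \<Omega>m: "\<Omega> \<in> sets lebesgue" using \<Omega>(1) by simp
  have AE_on: "(AE x in lebesgue_on S. P x) \<longleftrightarrow> (AE x in lebesgue. x \<in> S \<longrightarrow> P x)" if "S \<in> sets lebesgue"
    for P and S :: "(real^2) set"
    using that by (simp add: AE_restrict_space_iff)
  note AE\<Omega> = AE_on[OF \<Omega>m]
  obtain \<U> where \<U>: "countable \<U>" "\<And>V. V \<in> \<U> \<Longrightarrow> open V \<and> V \<subseteq> \<Omega> \<and> C1_closure V \<phi>"
      "\<Omega> - \<Union>\<U> \<in> null_sets lebesgue"
    using \<open>\<phi> \<in> C1_piec \<Omega>\<close> unfolding C1_piec_def by blast
  have contJ: "continuous_on (\<Union>\<U>) (jac \<phi>)"
    using \<U>(2) by (intro continuous_on_open_Union) (auto intro: C1_closure_jac(2))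
  \<comment> \<open>Intersecting with the preimage keeps the set open and makes the classical
    gradient admissible at every point of it, as \<open>solution_sequence\<close> requires.\<close>
  define W where "W = \<Union>\<U> \<inter> jac \<phi> -` seg_hull"
  have W: "open W" "bounded W" "W \<subseteq> \<Omega>"
  proof -
    show "open W" unfolding W_def using \<U>(2) by (intro continuous_open_preimage[OF contJ _ open_hull]) auto
    show "W \<subseteq> \<Omega>" using \<U>(2) by (auto simp: W_def)
    then show "bounded W" using \<Omega>(2) bounded_subset by blast
  qed
  \<comment> \<open>Since the pieces are countably many, the exceptional null sets on which weak and
    classical gradient differ can be united; \<open>W\<close> fills \<open>\<Omega>\<close> up to a
    null set.\<close>
  have AEW: "AE x in lebesgue. x \<in> \<Omega> \<longrightarrow> x \<in> W \<and> D\<phi> x = jac \<phi> x"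
  proof -
    have "AE x in lebesgue. \<forall>V\<in>\<U>. x \<in> V \<longrightarrow> D\<phi> x = jac \<phi> x"
      using \<U>(1,2) weak_gradient_eq_classical[OF _ _ _ \<open>weak_gradient \<Omega> \<phi> D\<phi>\<close>]
      by (subst AE_ball_countable) auto
    moreover have "AE x in lebesgue. x \<notin> \<Omega> - \<Union>\<U>" by (rule AE_not_in[OF \<U>(3)])
    moreover have "AE x in lebesgue. x \<in> \<Omega> \<longrightarrow> D\<phi> x \<in> seg_hull"
      using assms(15,16) unfolding AE\<Omega> by eventually_elim (auto intro: in_hullI)
    ultimately show ?thesis by eventually_elim (auto simp: W_def)
  qed
  have JU: "jac \<phi> x \<in> seg_hull" if "x \<in> W" for x using that by (simp add: W_def)
  have JW: "continuous_on W (jac \<phi>)" by (rule continuous_on_subset[OF contJ]) (auto simp: W_def)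
  obtain \<Phi> :: "nat \<Rightarrow> real^2 \<Rightarrow> real^2" where \<Phi>:
    "\<Phi> 0 = (\<lambda>_. 0)" "\<And>n. test_function W (\<Phi> n)" "\<And>n x. norm (\<Phi> (Suc n) x - \<Phi> n x) \<le> (1/2)^n"
    "\<And>n x. x \<in> W \<Longrightarrow> jac \<phi> x + jac (\<Phi> n) x \<in> seg_hull"
    "AE x in lebesgue_on W. convergent (\<lambda>n. jac (\<Phi> n) x) \<and> (\<lambda>n. gap (jac \<phi> x + jac (\<Phi> n) x)) \<longlonglongrightarrow> 0"
    by (rule solution_sequence[OF W(1,2) JW JU]) (assumption, (rule that; assumption))
  define v where "v x = (\<Sum>k. \<Phi> (Suc k) x - \<Phi> k x)" for x
  \<comment> \<open>Off \<open>W\<close> all terms are 0 and so is the limit; at the null set of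
    points of \<open>W\<close> without convergence the value is arbitrary.\<close>
  define H where "H x = lim (\<lambda>n. jac (\<Phi> n) x)" for x
  have tel: "(\<Sum>k<n. \<Phi> (Suc k) x - \<Phi> k x) = \<Phi> n x" for n x
    unfolding sum_lessThan_telescope[of "\<lambda>k. \<Phi> k x"] by (simp add: \<Phi>(1))
  have limv: "(\<lambda>n. \<Phi> n x) \<longlonglongrightarrow> v x" for x
  proof -
    have "summable (\<lambda>k. \<Phi> (Suc k) x - \<Phi> k x)"
      by (rule summable_comparison_test'[of "\<lambda>k. (1/2)^k"]) (use \<Phi>(3) in \<open>auto intro: summable_geometric\<close>)
    from summable_LIMSEQ[OF this] show ?thesis unfolding tel v_def .
  qed
  have bv: "norm (\<Phi> n x) \<le> 2" for n x
  proof -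
    have "norm (\<Phi> n x) \<le> (\<Sum>k<n. (1/2)^k)" unfolding tel[of x n, symmetric] by (rule sum_norm_le) (rule \<Phi>(3))
    also have "(\<Sum>k<n. (1/2)^k) = 2 - 2 * (1/2::real)^n" by (induction n) auto
    also have "\<dots> \<le> 2" by simp
    finally show ?thesis .
  qed
  obtain B where B: "\<And>\<xi>. \<xi> \<in> seg_hull \<Longrightarrow> norm \<xi> \<le> B" using bounded_hull by (auto simp: bounded_iff)
  \<comment> \<open>On \<open>W\<close> this is a difference of two members of the bounded hull; the
    maximum with 0 covers the points off \<open>W\<close>.\<close>
  have bJ: "norm (jac (\<Phi> n) x) \<le> max 0 (2 * B)" for n x
  proof (cases "x \<in> W")
    case True
    have "norm (jac (\<Phi> n) x) \<le> norm (jac \<phi> x + jac (\<Phi> n) x) + norm (jac \<phi> x)"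
      using norm_triangle_ineq4[of "jac \<phi> x + jac (\<Phi> n) x" "jac \<phi> x"] by simp
    then show ?thesis using B[OF JU[OF True]] B[OF \<Phi>(4)[OF True, of n]] by simp
  next
    case False
    then show ?thesis by (simp add: test_function_outside(2)[OF \<Phi>(2)])
  qed
  have AEJ: "AE x in lebesgue. x \<in> W \<longrightarrow> convergent (\<lambda>n. jac (\<Phi> n) x) \<and> (\<lambda>n. gap (jac \<phi> x + jac (\<Phi> n) x)) \<longlonglongrightarrow> 0"
    using \<Phi>(5) W(1) by (subst (asm) AE_on) auto
  have limJ: "AE x in lebesgue. (\<lambda>n. jac (\<Phi> n) x) \<longlonglongrightarrow> H x"
    using AEJ
  proof eventually_elim
    case (elim x)
    show ?case
    proof (cases "x \<in> W")
      case True
      then show ?thesis using elim by (simp add: H_def convergent_LIMSEQ_iff)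
    next
      case False
      then show ?thesis by (simp add: H_def test_function_outside(2)[OF \<Phi>(2)])
    qed
  qed
  have Hm: "H \<in> borel_measurable lebesgue"
    unfolding H_def[abs_def]
  proof (rule borel_measurable_lim_metric)
    show "jac (\<Phi> n) \<in> borel_measurable lebesgue" for n
      using jac_continuous[OF test_function_Ck[OF \<Phi>(2)], of n] by (simp add: borel_measurable_continuous_onI measurable_completion)
  qed
  let ?c = "max 2 (max 0 (2 * B))"
  note lim = W1inf_0_limit[OF \<Omega> test_function_mono[OF \<Phi>(2) W(3)] limv _ limJ _ Hm, of ?c]
  have v: "v \<in> W1inf_0 \<Omega>" "weak_gradient \<Omega> v H"
    using bv bJ by (auto intro!: lim simp: le_max_iff_disj)
  have "AE x in lebesgue. x \<in> \<Omega> \<longrightarrow> D\<phi> x + H x \<in> E"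
    using AEW AEJ limJ
  proof eventually_elim
    case (elim x)
    show ?case
    proof
      assume "x \<in> \<Omega>"
      then have xW: "x \<in> W" and D: "D\<phi> x = jac \<phi> x" using elim(1) by auto
      have l: "(\<lambda>n. jac \<phi> x + jac (\<Phi> n) x) \<longlonglongrightarrow> D\<phi> x + H x"
        unfolding D by (intro tendsto_add tendsto_const elim(3))
      have "(\<lambda>n. gap (jac \<phi> x + jac (\<Phi> n) x)) \<longlonglongrightarrow> gap (D\<phi> x + H x)"
        by (rule continuous_on_tendsto_compose[OF continuous_gap l]) auto
      then have g: "gap (D\<phi> x + H x) = 0" using elim(2) xW LIMSEQ_unique by blast
      have ld: "(\<lambda>n. det (jac \<phi> x + jac (\<Phi> n) x)) \<longlonglongrightarrow> det (D\<phi> x + H x)"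
        by (rule continuous_on_tendsto_compose[OF continuous_det2 l]) auto
      have d1: "a1 * a2 \<le> det (D\<phi> x + H x)"
        by (rule LIMSEQ_le_const[OF ld], rule exI[of _ 0]) (use \<Phi>(4)[OF xW] in \<open>auto simp: seg_hull_def less_imp_le\<close>)
      have d2: "det (D\<phi> x + H x) \<le> b1 * b2"
        by (rule LIMSEQ_le_const2[OF ld], rule exI[of _ 0]) (use \<Phi>(4)[OF xW] in \<open>auto simp: seg_hull_def less_imp_le\<close>)
      show "D\<phi> x + H x \<in> E"
        using gap_zero_imp_segment[OF d1 d2 g] det_pos[OF d1] assms(1,10) by auto
    qed
  qed
  then have "AE x in lebesgue_on \<Omega>. D\<phi> x + H x \<in> E" unfolding AE\<Omega> .
  moreover have "weak_gradient \<Omega> (\<lambda>x. \<phi> x + v x) (\<lambda>x. D\<phi> x + H x)"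
    by (rule weak_gradient_add[OF \<open>weak_gradient \<Omega> \<phi> D\<phi>\<close> v(2)])
  ultimately show ?thesis
    using v(1) by (intro exI[of _ "\<lambda>x. \<phi> x + v x"] exI[of _ "\<lambda>x. D\<phi> x + H x"]) simp
qed

end
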